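(* Suppose that $0<\alpha\le1$, $0<p<\infty$ and $\alpha+p>1$. (a) If $0<p\le2$, then $B^p_\alpha\subset A^p_\alpha$. (b) If $2\le p<\infty$, then $A^p_\alpha\subset B^p_\alpha$. Moreover, $A^p_\alpha\ne B^p_\alpha$ unless $p=2$.
   Context: $\mathbb{D}$ is the open unit disc in $\mathbb{C}$ and $m$ is Lebesgue area measure normalized so that $m(\mathbb{D})=1$. For $f$ analytic in $\mathbb{D}$, $0<p<\infty$ and $0<r<1$, set $M_p^p(r,f)=\int_0^{2\pi}|f(re^{i\theta})|^p\,\frac{d\theta}{2\pi}$; the function $r\mapsto M_p^p(r,f)$ is increasing and differentiable on $(0,1)$. For $0<\alpha,p<\infty$ define $$\|f\|_{\alpha,p}^p=|f(0)|^p+\int_0^1\left(\frac{d}{dr}M_p^p(r,f)\right)(1-r^2)^{\alpha-1}\,dr\in[0,\infty],$$ and let $A^p_\alpha$ be the class of all analytic functions $f$ in $\mathbb{D}$ with $\|f\|_{\alpha,p}<\infty$. For $\alpha+p>1$, the Besov space $B^p_\alpha$ is the space of all analytic functions $f$ in $\mathbb{D}$ with $\|f\|_{B^p_\alpha}<\infty$, where $$\|f\|_{B^p_\alpha}^p=|f(0)|^p+(\alpha+p-1)\int_{\mathbb{D}}|f'(z)|^p(1-|z|^2)^{\alpha+p-2}\,dm(z).$$ Inclusions and equality are as sets of functions ($\subset$ allows equality). *)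

theory Defs
  imports "HOL-Complex_Analysis.Complex_Analysis"
begin

definition area_measure :: "complex measure" where
  "area_measure = uniform_measure lborel (ball 0 1)"

definition mean_pow :: "real \<Rightarrow> (complex \<Rightarrow> complex) \<Rightarrow> real \<Rightarrow> real" where
  "mean_pow p f r = integral {0..2 * pi} (\<lambda>\<theta>. cmod (f (rcis r \<theta>)) powr p) / (2 * pi)"

text \<open>
  For an analytic f the function \<open>mean_pow p f\<close> is increasing and differentiable on (0, 1),
  so the integrand below is nonnegative there and nothing is truncated by \<open>ennreal\<close>.
  The quantities \<open>A_norm_pow\<close> and \<open>B_norm_pow\<close> are the p-th powers of the norms, with
  values in \<open>[0, \<infinity>]\<close>.
\<close>

definition A_norm_pow :: "real \<Rightarrow> real \<Rightarrow> (complex \<Rightarrow> complex) \<Rightarrow> ennreal" where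
  "A_norm_pow \<alpha> p f =
     ennreal (cmod (f 0) powr p) +
     (\<integral>\<^sup>+ r \<in> {0<..<1}. ennreal (deriv (mean_pow p f) r * (1 - r\<^sup>2) powr (\<alpha> - 1)) \<partial>lborel)"

definition B_norm_pow :: "real \<Rightarrow> real \<Rightarrow> (complex \<Rightarrow> complex) \<Rightarrow> ennreal" where
  "B_norm_pow \<alpha> p f =
     ennreal (cmod (f 0) powr p) +
     ennreal (\<alpha> + p - 1) *
     (\<integral>\<^sup>+ z \<in> ball 0 1. ennreal (cmod (deriv f z) powr p * (1 - (cmod z)\<^sup>2) powr (\<alpha> + p - 2))
        \<partial>area_measure)"

text \<open>
  Functions on the disc are represented by total functions with arbitrary values outside it.
  Membership in the two spaces below depends only on the restriction to the open disc, so
  inclusion and equality of these sets agree with those of the spaces of functions on the disc.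
\<close>

definition A_space :: "real \<Rightarrow> real \<Rightarrow> (complex \<Rightarrow> complex) set" where
  "A_space \<alpha> p = {f. f analytic_on ball 0 1 \<and> A_norm_pow \<alpha> p f < \<infinity>}"

definition B_space :: "real \<Rightarrow> real \<Rightarrow> (complex \<Rightarrow> complex) set" where
  "B_space \<alpha> p = {f. f analytic_on ball 0 1 \<and> B_norm_pow \<alpha> p f < \<infinity>}"

end

theory Submission imports Defs begin

text \<open>
  Write \<open>M(r) = mean_pow p f r\<close> and let \<open>dA\<close> be area.  Everything rests on the Hardy--Stein identity
  \<open>r M'(r) = p^2/(2 pi) * (integral of |f|^(p-2) |f'|^2 dA over |z| < r)\<close> (\<open>hardy_stein\<close>).
  It shows that M is increasing, hence that \<open>|f|^p\<close> is subharmonic for every \<open>p > 0\<close>, and it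
  turns the A-norm into a weighted area integral of \<open>|f|^(p-2) |f'|^2\<close>.  For \<open>f\<close> without zeros it
  is Green's formula for \<open>|f|^p\<close>; in general one regularizes \<open>|f|^p\<close> to
  \<open>(|f|^2 + e)^(p/2)\<close>, differentiates twice under the integral sign over circles, and lets
  \<open>e\<close> tend to 0.

  For \<open>p \<ge> 2\<close>, Clarkson's inequality, applied to \<open>F\<close> and the constant \<open>F(0)\<close>, gives
  \<open>mean |F|^p - |F(0)|^p \<ge> c |F'(0)|^p\<close> on a fixed circle.  Apply this on circles
  centred at the points of \<open>|z| = r\<close> with radius comparable to \<open>1 - r\<close>, and average over the centres.
  The result is \<open>(1-r)^p * (mean of |f'|^p on |z| = r) \<le> C (M((1+r)/2) - M(r))\<close>
  (\<open>deriv_mean_pow_le\<close>), and Tonelli's theorem in the radius yields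
  \<open>A_space \<alpha> p \<subseteq> B_space \<alpha> p\<close>.

  For \<open>p \<le> 2\<close>, concavity gives the opposite local bound: on a disc about \<open>z\<close> of radius
  comparable to \<open>1 - |z|\<close>, the integral of \<open>|f|^(p-2) |f'|^2\<close> is at most
  \<open>C (1-|z|)^(p-2)\<close> times the integral of \<open>|f'|^p\<close> over a larger such disc
  (\<open>hs_density_local\<close>).  Tonelli's theorem in the plane yields
  \<open>B_space \<alpha> p \<subseteq> A_space \<alpha> p\<close>.  In particular the two spaces agree for \<open>p = 2\<close>.

  For \<open>p \<noteq> 2\<close> consider \<open>f = const + \<Sum> a_k z^(Q^k)\<close> with a large ratio \<open>Q\<close>.  On the annulus
  where \<open>1 - |z|\<close> is comparable to \<open>Q^(-j)\<close> the \<open>j\<close>-th term of \<open>f'\<close> dominates, so \<open>f\<close> lies in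
  \<open>B_space \<alpha> p\<close> if and only if \<open>\<Sum> |a_j|^p Q^(j (1 - \<alpha>))\<close> converges.  Choosing the \<open>a_j\<close>
  suitably separates \<open>B_space \<alpha> p\<close> from \<open>B_space \<alpha> 2 = A_space \<alpha> 2\<close> in the direction in which
  membership in \<open>A_space \<alpha> 2\<close> and in \<open>A_space \<alpha> p\<close> can be compared: for \<open>\<alpha> = 1\<close> because
  integral means are comparable in \<open>p\<close>, and for \<open>\<alpha> < 1\<close> by the Hardy--Stein identity, because the
  constant can then be chosen with \<open>|f| \<ge> 1\<close>, which makes \<open>|f|^(p-2)\<close> monotone in \<open>p\<close>.
\<close>

section \<open>Polar coordinates\<close>

lemma lborel_complex_eq:
  "(lborel :: complex measure) = distr (lborel \<Otimes>\<^sub>M lborel) borel (\<lambda>(x, y). Complex x y)"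
proof (rule lborel_eqI)
  fix l u :: complex
  assume le: "\<And>b. b \<in> Basis \<Longrightarrow> l \<bullet> b \<le> u \<bullet> b"
  have [measurable]: "(\<lambda>(x, y). Complex x y) \<in> borel_measurable (lborel \<Otimes>\<^sub>M lborel)"
    by (simp add: lborel_prod borel_measurable_continuous_onI continuous_on_Complex split_beta continuous_on_fst continuous_on_snd continuous_on_id)
  have le': "Re l \<le> Re u" "Im l \<le> Im u"
    using le[of 1] le[of "\<i>"] by (simp_all add: Basis_complex_def)
  have "emeasure (distr (lborel \<Otimes>\<^sub>M lborel) borel (\<lambda>(x, y). Complex x y)) (box l u) =
     emeasure (lborel \<Otimes>\<^sub>M lborel) ((\<lambda>(x, y). Complex x y) -` box l u \<inter> space (lborel \<Otimes>\<^sub>M lborel))"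
    by (rule emeasure_distr) auto
  also have "(\<lambda>(x, y). Complex x y) -` box l u \<inter> space (lborel \<Otimes>\<^sub>M lborel)
       = {Re l<..<Re u} \<times> {Im l<..<Im u}"
    by (auto simp: space_pair_measure box_def Basis_complex_def inner_complex_def)
  also have "emeasure (lborel \<Otimes>\<^sub>M lborel) ({Re l<..<Re u} \<times> {Im l<..<Im u}) =
      ennreal (Re u - Re l) * ennreal (Im u - Im l)"
    using le' by (subst lborel.emeasure_pair_measure_Times) auto
  also have "\<dots> = ennreal (\<Prod>b\<in>Basis. (u - l) \<bullet> b)"
    using le' by (simp add: Basis_complex_def inner_complex_def ennreal_mult)
  finally show "emeasure (distr (lborel \<Otimes>\<^sub>M lborel) borel (\<lambda>(x, y). Complex x y)) (box l u) =
      ennreal (\<Prod>b\<in>Basis. (u - l) \<bullet> b)" .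
qed auto

lemma borel_measurable_Complex [measurable (raw)]:
  assumes "f \<in> borel_measurable M" "g \<in> borel_measurable M"
  shows "(\<lambda>x. Complex (f x) (g x)) \<in> borel_measurable M"
proof -
  have "(\<lambda>x. Complex (f x) (g x)) = (\<lambda>x. complex_of_real (f x) + \<i> * complex_of_real (g x))"
    by (simp add: fun_eq_iff Complex_eq)
  then show ?thesis using assms by simp
qed

lemma nn_integral_lborel_complex:
  assumes [measurable]: "h \<in> borel_measurable borel"
  shows "(\<integral>\<^sup>+ z. h z \<partial>lborel) = (\<integral>\<^sup>+ x. \<integral>\<^sup>+ y. h (Complex x y) \<partial>lborel \<partial>lborel)"
  unfolding lborel_complex_eq
  by (subst nn_integral_distr) (auto simp: lborel.nn_integral_fst[symmetric])

lemma nn_integral_UN_incseq: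
  fixes A :: "nat \<Rightarrow> 'a set"
  assumes "k \<in> borel_measurable M" "\<And>n. A n \<in> sets M" "incseq A"
  shows "(\<integral>\<^sup>+ x \<in> (\<Union>n. A n). k x \<partial>M) = (SUP n. \<integral>\<^sup>+ x \<in> A n. k x \<partial>M)"
proof -
  have "(SUP n. emeasure (density M k) (A n)) = emeasure (density M k) (\<Union>n. A n)"
    by (rule SUP_emeasure_incseq) (use assms in auto)
  then show ?thesis using assms by (simp add: emeasure_density sets.countable_UN')
qed

lemma nn_integral_substitution_tan:
  fixes k :: "real \<Rightarrow> ennreal"
  assumes [measurable]: "k \<in> borel_measurable borel"
  shows "(\<integral>\<^sup>+ u. k u \<partial>lborel) =
    (\<integral>\<^sup>+ t \<in> {-(pi/2)<..<pi/2}. k (tan t) * ennreal (inverse ((cos t)\<^sup>2)) \<partial>lborel)"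
proof -
  have [measurable]: "(tan :: real \<Rightarrow> real) \<in> borel_measurable borel"
    by (simp add: tan_def[abs_def])
  define c where "c n = pi/2 - inverse (real (Suc n))" for n
  have c0: "0 < c n" "c n < pi/2" for n
  proof -
    have "inverse (real (Suc n)) \<le> 1" by (simp add: divide_simps)
    then show "0 < c n" using pi_gt3 unfolding c_def by linarith
    show "c n < pi/2" by (simp add: c_def)
  qed
  have inc_c: "c m \<le> c n" if "m \<le> n" for m n
    using that by (simp add: c_def le_imp_inverse_le)
  have cos_pos: "0 < cos t" if "-(pi/2) < t" "t < pi/2" for t
    using that by (intro cos_gt_zero_pi) auto
  have 1: "(\<integral>\<^sup>+u. k u * indicator {tan (- c n)..tan (c n)} u \<partial>lborel) =
     (\<integral>\<^sup>+t. k (tan t) * ennreal (inverse ((cos t)\<^sup>2)) * indicator {- c n..c n} t \<partial>lborel)" for n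
  proof (rule nn_integral_substitution_aux)
    fix x assume "x \<in> {-c n..c n}"
    then have "cos x > 0" using c0[of n] by (intro cos_pos) auto
    then show "(tan has_real_derivative inverse ((cos x)\<^sup>2)) (at x)" by (intro DERIV_tan) auto
  next
    show "continuous_on {- c n..c n} (\<lambda>x. inverse ((cos x)\<^sup>2))"
    proof (intro continuous_intros ballI)
      fix x assume "x \<in> {-c n..c n}"
      then have "cos x > 0" using c0[of n] by (intro cos_pos) auto
      then show "(cos x)\<^sup>2 \<noteq> 0" by auto
    qed
  qed (use c0[of n] in auto)
  have ex: "\<exists>n. \<bar>t\<bar> < c n" if "\<bar>t\<bar> < pi/2" for t
    using reals_Archimedean[of "pi/2 - \<bar>t\<bar>"] that by (auto simp: c_def algebra_simps)
  have tmono: "tan (c m) \<le> tan (c n)" if "m \<le> n" for m n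
  proof (rule tan_mono_le)
    show "- (pi/2) < c m" using c0(1)[of m] pi_gt_zero by linarith
  qed (use c0 inc_c[OF that] in auto)
  have U1: "(\<Union>n. {tan (- c n)..tan (c n)}) = UNIV"
  proof (intro set_eqI iffI UNIV_I)
    fix u :: real
    have "\<bar>arctan u\<bar> < pi/2" using arctan_bounded[of u] by auto
    then obtain n where "\<bar>arctan u\<bar> < c n" using ex by blast
    then have "arctan u < c n" "-c n < arctan u" by auto
    then have "tan (arctan u) < tan (c n)" "tan (- c n) < tan (arctan u)"
      using c0[of n] arctan_bounded[of u] by (intro tan_monotone; linarith)+
    then show "u \<in> (\<Union>n. {tan (- c n)..tan (c n)})" by (auto simp: tan_arctan intro!: exI[of _ n])
  qed
  have U2: "(\<Union>n. {- c n..c n}) = {-(pi/2)<..<pi/2}"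
  proof (intro set_eqI iffI)
    fix t assume "t \<in> {-(pi/2)<..<pi/2}"
    then have "\<bar>t\<bar> < pi/2" by auto
    then obtain n where "\<bar>t\<bar> < c n" using ex by blast
    then show "t \<in> (\<Union>n. {- c n..c n})" by (intro UN_I[of n]) auto
  next
    fix t assume "t \<in> (\<Union>n. {- c n..c n})"
    then obtain n where "- c n \<le> t" "t \<le> c n" by auto
    then show "t \<in> {-(pi/2)<..<pi/2}" using c0(2)[of n] by auto
  qed
  have "(\<integral>\<^sup>+ u \<in> (\<Union>n. {tan (- c n)..tan (c n)}). k u \<partial>lborel) = (SUP n. \<integral>\<^sup>+ u \<in> {tan (- c n)..tan (c n)}. k u \<partial>lborel)"
    by (rule nn_integral_UN_incseq) (use tmono in \<open>auto simp: incseq_def\<close>)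
  moreover have "(\<integral>\<^sup>+ t \<in> (\<Union>n. {- c n..c n}). k (tan t) * ennreal (inverse ((cos t)\<^sup>2)) \<partial>lborel) =
      (SUP n. \<integral>\<^sup>+ t \<in> {- c n..c n}. k (tan t) * ennreal (inverse ((cos t)\<^sup>2)) \<partial>lborel)"
    by (rule nn_integral_UN_incseq) (use inc_c in \<open>auto simp: incseq_def\<close>)
  ultimately show ?thesis unfolding U1 U2 1 by simp
qed

lemma nn_integral_lborel_scale:
  fixes k :: "'a::euclidean_space \<Rightarrow> ennreal"
  assumes [measurable]: "k \<in> borel_measurable borel" and "c \<noteq> 0"
  shows "(\<integral>\<^sup>+ y. k y \<partial>lborel) = ennreal (\<bar>c\<bar> ^ DIM('a)) * (\<integral>\<^sup>+ y. k (t + c *\<^sub>R y) \<partial>lborel)"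
proof -
  have "(\<integral>\<^sup>+ y. k y \<partial>lborel) =
     (\<integral>\<^sup>+ y. k y \<partial>density (distr lborel borel (\<lambda>x::'a. t + c *\<^sub>R x)) (\<lambda>_. ennreal (\<bar>c\<bar> ^ DIM('a))))"
    using lborel_affine[of c t] \<open>c \<noteq> 0\<close> by simp
  also have "\<dots> = ennreal (\<bar>c\<bar> ^ DIM('a)) * (\<integral>\<^sup>+ y. k (t + c *\<^sub>R y) \<partial>lborel)"
    by (subst nn_integral_density) (simp_all add: nn_integral_cmult nn_integral_distr)
  finally show ?thesis .
qed

text \<open>
  In the half plane \<open>Re z > 0\<close> the substitutions \<open>y = x u\<close>, \<open>u = tan t\<close> and \<open>x = s cos t\<close>
  introduce polar coordinates one variable at a time.
\<close>
lemma nn_integral_polar_right_half: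
  fixes h :: "complex \<Rightarrow> ennreal"
  assumes [measurable]: "h \<in> borel_measurable borel"
  shows "(\<integral>\<^sup>+ z \<in> {z. Re z > 0}. h z \<partial>lborel) =
    (\<integral>\<^sup>+ t \<in> {-(pi/2)<..<pi/2}. (\<integral>\<^sup>+ s \<in> {0<..}. ennreal s * h (rcis s t) \<partial>lborel) \<partial>lborel)"
proof -
  have "(\<integral>\<^sup>+ z \<in> {z. Re z > 0}. h z \<partial>lborel) =
      (\<integral>\<^sup>+ x. \<integral>\<^sup>+ y. h (Complex x y) * indicator {0<..} x \<partial>lborel \<partial>lborel)"
    by (subst nn_integral_lborel_complex) (auto intro!: nn_integral_cong split: split_indicator)
  also have "\<dots> = (\<integral>\<^sup>+ x. \<integral>\<^sup>+ u. ennreal x * h (Complex x (x * u)) * indicator {0<..} x \<partial>lborel \<partial>lborel)"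
  proof (rule nn_integral_cong)
    fix x :: real
    show "(\<integral>\<^sup>+ y. h (Complex x y) * indicator {0<..} x \<partial>lborel) =
       (\<integral>\<^sup>+ u. ennreal x * h (Complex x (x * u)) * indicator {0<..} x \<partial>lborel)"
    proof (cases "x > 0")
      case True
      have "(\<integral>\<^sup>+ y. h (Complex x y) \<partial>lborel) = ennreal x * (\<integral>\<^sup>+ u. h (Complex x (x * u)) \<partial>lborel)"
        using nn_integral_lborel_scale[of "\<lambda>y. h (Complex x y)" x 0] True by simp
      with True show ?thesis by (simp add: nn_integral_cmult)
    qed simp
  qed
  also have "\<dots> = (\<integral>\<^sup>+ u. \<integral>\<^sup>+ x. ennreal x * h (Complex x (x * u)) * indicator {0<..} x \<partial>lborel \<partial>lborel)"
    by (subst lborel_pair.Fubini') (simp_all add: split_beta')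
  also have "\<dots> = (\<integral>\<^sup>+ t \<in> {-(pi/2)<..<pi/2}.
       (\<integral>\<^sup>+ x. ennreal x * h (Complex x (x * tan t)) * indicator {0<..} x \<partial>lborel) *
            ennreal (inverse ((cos t)\<^sup>2)) \<partial>lborel)"
    by (subst nn_integral_substitution_tan) auto
  also have "\<dots> = (\<integral>\<^sup>+ t \<in> {-(pi/2)<..<pi/2}. (\<integral>\<^sup>+ s \<in> {0<..}. ennreal s * h (rcis s t) \<partial>lborel) \<partial>lborel)"
  proof (intro nn_integral_cong)
    fix t :: real
    show "(\<integral>\<^sup>+ x. ennreal x * h (Complex x (x * tan t)) * indicator {0<..} x \<partial>lborel) *
            ennreal (inverse ((cos t)\<^sup>2)) * indicator {-(pi/2)<..<pi/2} t =
      (\<integral>\<^sup>+ s \<in> {0<..}. ennreal s * h (rcis s t) \<partial>lborel) * indicator {-(pi/2)<..<pi/2} t"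
    proof (cases "t \<in> {-(pi/2)<..<pi/2}")
      case True
      then have c: "cos t > 0" by (intro cos_gt_zero_pi) auto
      have "(\<integral>\<^sup>+ x. ennreal x * h (Complex x (x * tan t)) * indicator {0<..} x \<partial>lborel) =
         ennreal (cos t) * (\<integral>\<^sup>+ s. ennreal (cos t * s) * h (Complex (cos t * s) (cos t * s * tan t)) * indicator {0<..} (cos t * s) \<partial>lborel)"
        using nn_integral_lborel_scale[of "\<lambda>x. ennreal x * h (Complex x (x * tan t)) * indicator {0<..} x" "cos t" 0] c by simp
      also have "\<dots> = ennreal (cos t) * (\<integral>\<^sup>+ s. ennreal (cos t) * (ennreal s * h (rcis s t) * indicator {0<..} s) \<partial>lborel)"
      proof (rule arg_cong[where f="\<lambda>x. ennreal (cos t) * x"], rule nn_integral_cong)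
        fix s :: real
        have *: "Complex (cos t * s) (cos t * s * tan t) = rcis s t"
          using c by (simp add: rcis_def complex_eq_iff tan_def)
        show "ennreal (cos t * s) * h (Complex (cos t * s) (cos t * s * tan t)) * indicator {0<..} (cos t * s) =
          ennreal (cos t) * (ennreal s * h (rcis s t) * indicator {0<..} s)"
          unfolding * using c by (auto simp: indicator_def ennreal_mult zero_less_mult_iff mult.assoc)
      qed
      also have "\<dots> = ennreal ((cos t)\<^sup>2) * (\<integral>\<^sup>+ s. (ennreal s * h (rcis s t) * indicator {0<..} s) \<partial>lborel)"
        using c by (subst nn_integral_cmult) (auto simp: rcis_def power2_eq_square ennreal_mult mult.assoc)
      finally have "(\<integral>\<^sup>+ x. ennreal x * h (Complex x (x * tan t)) * indicator {0<..} x \<partial>lborel) * ennreal (inverse ((cos t)\<^sup>2))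
         = ennreal ((cos t)\<^sup>2 * inverse ((cos t)\<^sup>2)) * (\<integral>\<^sup>+ s. (ennreal s * h (rcis s t) * indicator {0<..} s) \<partial>lborel)"
        by (simp add: ennreal_mult mult_ac)
      then show ?thesis using c True by simp
    qed simp
  qed
  finally show ?thesis .
qed


text \<open>
  The left half plane is the reflection of the right one, and the imaginary axis is a null set.
\<close>
lemma nn_integral_polar_angle_first:
  fixes h :: "complex \<Rightarrow> ennreal"
  assumes [measurable]: "h \<in> borel_measurable borel"
  shows "(\<integral>\<^sup>+ z. h z \<partial>lborel) =
    (\<integral>\<^sup>+ t \<in> {0..2*pi}. (\<integral>\<^sup>+ s \<in> {0<..}. ennreal s * h (rcis s t) \<partial>lborel) \<partial>lborel)"
proof -
  define J where "J t = (\<integral>\<^sup>+ s \<in> {0<..}. ennreal s * h (rcis s t) \<partial>lborel)" for t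
  have [measurable]: "(\<lambda>(t, s). rcis s t) \<in> borel_measurable (lborel \<Otimes>\<^sub>M lborel)"
    unfolding rcis_def cis_conv_exp by measurable
  have [measurable]: "J \<in> borel_measurable borel"
    unfolding J_def by measurable
  have per: "J (t + 2 * pi) = J t" for t
    by (simp add: J_def rcis_def cis.code)
  have shift: "(\<integral>\<^sup>+ t. k (t + c) \<partial>lborel) = (\<integral>\<^sup>+ t. k t \<partial>lborel)"
    if [measurable]: "k \<in> borel_measurable borel" for k :: "real \<Rightarrow> ennreal" and c
    using nn_integral_lborel_scale[of k 1 c] by (simp add: add.commute)
  have R: "(\<integral>\<^sup>+ z \<in> {z. Re z > 0}. h z \<partial>lborel) = (\<integral>\<^sup>+ t \<in> {-(pi/2)<..<pi/2}. J t \<partial>lborel)"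
    unfolding J_def by (rule nn_integral_polar_right_half) measurable
  have m: "- rcis s t = rcis s (t + pi)" for s t
    by (simp add: rcis_def complex_eq_iff)
  have "(\<integral>\<^sup>+ z \<in> {z. Re z < 0}. h z \<partial>lborel) = (\<integral>\<^sup>+ z \<in> {z. Re z > 0}. h (-z) \<partial>lborel)"
    using nn_integral_lborel_scale[of "\<lambda>z. h z * indicator {z. Re z < 0} z" "-1" 0]
    by (auto intro!: nn_integral_cong split: split_indicator)
  also have "\<dots> = (\<integral>\<^sup>+ t \<in> {-(pi/2)<..<pi/2}. J (t + pi) \<partial>lborel)"
    unfolding J_def by (subst nn_integral_polar_right_half) (simp_all add: m)
  also have "\<dots> = (\<integral>\<^sup>+ t. J t * indicator {pi/2<..<3*pi/2} t \<partial>lborel)"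
    by (subst shift[symmetric, where c = pi])
       (auto intro!: nn_integral_cong split: split_indicator)
  finally have L: "(\<integral>\<^sup>+ z \<in> {z. Re z < 0}. h z \<partial>lborel) = (\<integral>\<^sup>+ t \<in> {pi/2<..<3*pi/2}. J t \<partial>lborel)" .
  have "(\<integral>\<^sup>+ z \<in> {z. Re z = 0}. h z \<partial>lborel) = (\<integral>\<^sup>+ x. \<integral>\<^sup>+ y. h (Complex x y) * indicator {0} x \<partial>lborel \<partial>lborel)"
    by (subst nn_integral_lborel_complex) (auto intro!: nn_integral_cong split: split_indicator)
  also have "\<dots> = (\<integral>\<^sup>+ (x::real). 0 \<partial>lborel)"
  proof (rule nn_integral_cong_AE)
    show "AE x in lborel. (\<integral>\<^sup>+ y. h (Complex x y) * indicator {0} x \<partial>lborel) = 0"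
      using AE_lborel_singleton[of "0::real"] by eventually_elim simp
  qed
  finally have Z: "(\<integral>\<^sup>+ z \<in> {z. Re z = 0}. h z \<partial>lborel) = 0" by simp
  have "(\<integral>\<^sup>+ z. h z \<partial>lborel) = (\<integral>\<^sup>+ z. (h z * indicator {z. Re z > 0} z + h z * indicator {z. Re z < 0} z)
       + h z * indicator {z. Re z = 0} z \<partial>lborel)"
    by (intro nn_integral_cong) (auto split: split_indicator)
  also have "\<dots> = (\<integral>\<^sup>+ z \<in> {z. Re z > 0}. h z \<partial>lborel) + (\<integral>\<^sup>+ z \<in> {z. Re z < 0}. h z \<partial>lborel)
       + (\<integral>\<^sup>+ z \<in> {z. Re z = 0}. h z \<partial>lborel)"
    by (subst nn_integral_add; (subst nn_integral_add)?) auto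
  also have "\<dots> = (\<integral>\<^sup>+ t \<in> {-(pi/2)<..<pi/2}. J t \<partial>lborel) + (\<integral>\<^sup>+ t \<in> {pi/2<..<3*pi/2}. J t \<partial>lborel)"
    by (simp add: R L Z)
  also have "(\<integral>\<^sup>+ t \<in> {-(pi/2)<..<pi/2}. J t \<partial>lborel) =
      (\<integral>\<^sup>+ t. J t * indicator {-(pi/2)<..<0} t + J t * indicator {0..<pi/2} t \<partial>lborel)"
    by (intro nn_integral_cong) (auto split: split_indicator)
  also have "\<dots> = (\<integral>\<^sup>+ t \<in> {-(pi/2)<..<0}. J t \<partial>lborel) + (\<integral>\<^sup>+ t \<in> {0..<pi/2}. J t \<partial>lborel)"
    by (rule nn_integral_add) auto
  also have "(\<integral>\<^sup>+ t \<in> {-(pi/2)<..<0}. J t \<partial>lborel) = (\<integral>\<^sup>+ t. J (t + 2 * pi) * indicator {3*pi/2<..<2*pi} (t + 2 * pi) \<partial>lborel)"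
    by (intro nn_integral_cong) (auto simp: per split: split_indicator)
  also have "\<dots> = (\<integral>\<^sup>+ t. J t * indicator {3*pi/2<..<2*pi} t \<partial>lborel)"
    by (rule shift) measurable
  also have "(\<integral>\<^sup>+ t. J t * indicator {3*pi/2<..<2*pi} t \<partial>lborel) + (\<integral>\<^sup>+ t \<in> {0..<pi/2}. J t \<partial>lborel)
        + (\<integral>\<^sup>+ t \<in> {pi/2<..<3*pi/2}. J t \<partial>lborel) =
     (\<integral>\<^sup>+ t. (J t * indicator {3*pi/2<..<2*pi} t + J t * indicator {0..<pi/2} t) + J t * indicator {pi/2<..<3*pi/2} t \<partial>lborel)"
    by (subst nn_integral_add; (subst nn_integral_add)?) auto
  also have "\<dots> = (\<integral>\<^sup>+ t \<in> {0..2*pi}. J t \<partial>lborel)"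
  proof (rule nn_integral_cong_AE)
    show "AE t in lborel. J t * indicator {3*pi/2<..<2*pi} t + J t * indicator {0..<pi/2} t + J t * indicator {pi/2<..<3*pi/2} t
       = J t * indicator {0..2*pi} t"
      using AE_lborel_singleton[of "pi/2"] AE_lborel_singleton[of "3*pi/2"] AE_lborel_singleton[of "2*pi"]
      by eventually_elim (auto simp: field_simps split: split_indicator)
  qed
  finally show ?thesis by (simp add: J_def)
qed

theorem nn_integral_polar:
  fixes h :: "complex \<Rightarrow> ennreal"
  assumes [measurable]: "h \<in> borel_measurable borel"
  shows "(\<integral>\<^sup>+ z. h z \<partial>lborel) =
    (\<integral>\<^sup>+ s \<in> {0<..}. ennreal s * (\<integral>\<^sup>+ t \<in> {0..2*pi}. h (rcis s t) \<partial>lborel) \<partial>lborel)"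
proof -
  have [measurable]: "(\<lambda>(t, s). rcis s t) \<in> borel_measurable (lborel \<Otimes>\<^sub>M lborel)"
    unfolding rcis_def cis_conv_exp by measurable
  have [measurable]: "(\<lambda>(s, t). rcis s t) \<in> borel_measurable (lborel \<Otimes>\<^sub>M lborel)"
    unfolding rcis_def cis_conv_exp by measurable
  have "(\<integral>\<^sup>+ z. h z \<partial>lborel) =
    (\<integral>\<^sup>+ t. \<integral>\<^sup>+ s. (ennreal s * indicator {0<..} s) * (h (rcis s t) * indicator {0..2*pi} t) \<partial>lborel \<partial>lborel)"
    unfolding nn_integral_polar_angle_first[OF assms]
    by (subst nn_integral_multc[symmetric]) (auto intro!: nn_integral_cong simp: mult_ac)
  also have "\<dots> = (\<integral>\<^sup>+ s. \<integral>\<^sup>+ t. (ennreal s * indicator {0<..} s) * (h (rcis s t) * indicator {0..2*pi} t) \<partial>lborel \<partial>lborel)"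
    by (subst lborel_pair.Fubini') (simp_all add: split_beta')
  also have "\<dots> = (\<integral>\<^sup>+ s \<in> {0<..}. ennreal s * (\<integral>\<^sup>+ t \<in> {0..2*pi}. h (rcis s t) \<partial>lborel) \<partial>lborel)"
    by (subst nn_integral_cmult) (auto intro!: nn_integral_cong simp: mult_ac)
  finally show ?thesis .
qed

section \<open>Integrals over circles\<close>

text \<open>
  The integral of \<open>k\<close> over the circle of radius \<open>r\<close> about 0 with respect to the angle.  It is not
  normalized, so it equals \<open>2 pi\<close> times the mean.
\<close>
definition circ :: "(complex \<Rightarrow> real) \<Rightarrow> real \<Rightarrow> real" where
  "circ k r = integral {0..2 * pi} (\<lambda>\<theta>. k (rcis r \<theta>))"

lemma mean_pow_eq_circ: "mean_pow p f r = circ (\<lambda>z. cmod (f z) powr p) r / (2 * pi)"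
  by (simp add: mean_pow_def circ_def)

lemma continuous_on_rcis [continuous_intros]:
  assumes "continuous_on S f" "continuous_on S g"
  shows "continuous_on S (\<lambda>x. rcis (f x) (g x))"
  unfolding rcis_def by (intro continuous_intros assms)

lemma continuous_on_polar:
  assumes "continuous_on (ball 0 1) k"
  shows "continuous_on ({0..<1} \<times> T) (\<lambda>(r, \<theta>). k (rcis r \<theta>))"
  unfolding split_beta
  by (rule continuous_on_compose2[OF assms]) (auto intro!: continuous_intros)

lemma continuous_on_circle:
  assumes "continuous_on (ball 0 1) k" "0 \<le> r" "r < 1"
  shows "continuous_on T (\<lambda>\<theta>. k (rcis r \<theta>))"
  by (rule continuous_on_compose2[OF assms(1)]) (use assms in \<open>auto intro!: continuous_intros\<close>)

lemma circ_has_integral: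
  assumes "continuous_on (ball 0 1) k" "0 \<le> r" "r < 1"
  shows "((\<lambda>\<theta>. k (rcis r \<theta>)) has_integral circ k r) {0..2 * pi}"
  unfolding circ_def
  by (intro integrable_integral integrable_continuous_real continuous_on_circle assms)

lemma continuous_on_circ:
  assumes "continuous_on (ball 0 1) k"
  shows "continuous_on {0..<1} (circ k)"
  using integral_continuous_on_param[of "{0..<1}" 0 "2 * pi" "\<lambda>r \<theta>. k (rcis r \<theta>)"]
    continuous_on_polar[OF assms, of "{0..2*pi}"]
  by (simp add: circ_def[abs_def])

lemma circ_nonneg:
  assumes "continuous_on (ball 0 1) k" "0 \<le> r" "r < 1" "\<And>z. z \<in> ball 0 1 \<Longrightarrow> 0 \<le> k z"
  shows "0 \<le> circ k r"
  using assms by (intro has_integral_nonneg[OF circ_has_integral[OF assms(1-3)]]) auto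

lemma circ_mono:
  assumes "continuous_on (ball 0 1) k" "continuous_on (ball 0 1) l" "0 \<le> r" "r < 1"
    "\<And>z. cmod z = r \<Longrightarrow> k z \<le> l z"
  shows "circ k r \<le> circ l r"
  using assms by (intro has_integral_le[OF circ_has_integral[of k] circ_has_integral[of l]]) auto

lemma circ_const: "circ (\<lambda>_. c) r = 2 * pi * c"
  by (simp add: circ_def)

lemma circ_0: "circ k 0 = 2 * pi * k 0"
  by (simp add: circ_def)

lemma ennreal_circ:
  assumes "continuous_on (ball 0 1) k" "0 \<le> r" "r < 1" "\<And>z. z \<in> ball 0 1 \<Longrightarrow> 0 \<le> k z"
  shows "ennreal (circ k r) = (\<integral>\<^sup>+ \<theta> \<in> {0..2*pi}. ennreal (k (rcis r \<theta>)) \<partial>lborel)"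
  using assms
  by (subst nn_integral_has_integral_lebesgue'[OF _ circ_has_integral[OF assms(1-3)]]) auto

text \<open>
  Differentiation under the integral sign.  Here \<open>k'\<close> is \<open>r\<close> times the radial derivative of \<open>k\<close>;
  unlike the radial derivative itself it is a continuous function of the point, also at 0.
\<close>
lemma circ_has_real_derivative:
  assumes k: "continuous_on (ball 0 1) k" and k': "continuous_on (ball 0 1) k'"
    and der: "\<And>r \<theta>. 0 < r \<Longrightarrow> r < 1 \<Longrightarrow>
      ((\<lambda>r. k (rcis r \<theta>)) has_real_derivative k' (rcis r \<theta>) / r) (at r)"
    and r: "0 < r" "r < 1"
  shows "(circ k has_real_derivative circ k' r / r) (at r)"
proof -
  have "((\<lambda>r. integral (cbox 0 (2*pi)) (\<lambda>\<theta>. k (rcis r \<theta>))) has_real_derivative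
      integral (cbox 0 (2*pi)) (\<lambda>\<theta>. k' (rcis r \<theta>) / r)) (at r within {0<..<1})"
  proof (rule leibniz_rule_field_derivative)
    fix x t :: real assume "x \<in> {0<..<1}"
    then show "((\<lambda>x. k (rcis x t)) has_real_derivative k' (rcis x t) / x) (at x within {0<..<1})"
      using der[of x t] by (auto intro: has_field_derivative_at_within)
  next
    fix x :: real assume "x \<in> {0<..<1}"
    then show "(\<lambda>\<theta>. k (rcis x \<theta>)) integrable_on cbox 0 (2 * pi)"
      using circ_has_integral[OF k, of x] by auto
  next
    have "continuous_on ({0<..<1} \<times> cbox 0 (2 * pi)) (\<lambda>(r, \<theta>). k' (rcis r \<theta>))"
      by (rule continuous_on_subset[OF continuous_on_polar[OF k', of UNIV]]) auto
    then show "continuous_on ({0<..<1} \<times> cbox 0 (2 * pi)) (\<lambda>(x, t). k' (rcis x t) / x)"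
      unfolding split_beta by (intro continuous_intros) auto
  qed (use r in auto)
  moreover have "integral {0..2*pi} (\<lambda>\<theta>. k' (rcis r \<theta>) / r) = circ k' r / r"
    by (simp add: circ_def)
  ultimately show ?thesis
    using r by (simp add: circ_def[abs_def] at_within_open[of r "{0<..<1}"])
qed

lemma measurable_if_continuous_on_ball [measurable]:
  fixes k :: "complex \<Rightarrow> 'b::{second_countable_topology, t2_space, real_normed_vector}"
  assumes "continuous_on (ball 0 1) k"
  shows "(\<lambda>z. if cmod z < 1 then k z else 0) \<in> borel_measurable borel"
proof -
  have "(\<lambda>z. if z \<in> ball 0 1 then k z else 0) \<in> borel_measurable borel"
    using assms by (intro borel_measurable_continuous_on_if) auto
  then show ?thesis by simp
qed

lemma ball_in_sets_borel [measurable]: "ball (c :: 'a::metric_space) r \<in> sets borel"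
  by simp

lemma nn_integral_ball_eq_circ:
  assumes k: "continuous_on (ball 0 1) k" and r: "0 < r" "r \<le> 1"
    and k0: "\<And>z. z \<in> ball 0 1 \<Longrightarrow> 0 \<le> k z"
  shows "(\<integral>\<^sup>+ z \<in> ball 0 r. ennreal (k z) \<partial>lborel) = (\<integral>\<^sup>+ s \<in> {0<..<r}. ennreal (s * circ k s) \<partial>lborel)"
proof -
  define l where "l z = (if cmod z < 1 then k z else 0)" for z
  have [measurable]: "l \<in> borel_measurable borel"
    unfolding l_def by (rule measurable_if_continuous_on_ball[OF k])
  have "(\<integral>\<^sup>+ z \<in> ball 0 r. ennreal (k z) \<partial>lborel) =
     (\<integral>\<^sup>+ z. ennreal (l z) * indicator (ball 0 r) z \<partial>lborel)"
    using r by (intro nn_integral_cong) (auto simp: l_def split: split_indicator)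
  also have "\<dots> = (\<integral>\<^sup>+ s \<in> {0<..}. ennreal s * (\<integral>\<^sup>+ t \<in> {0..2*pi}.
       ennreal (l (rcis s t)) * indicator (ball 0 r) (rcis s t) \<partial>lborel) \<partial>lborel)"
    by (rule nn_integral_polar) measurable
  also have "\<dots> = (\<integral>\<^sup>+ s \<in> {0<..<r}. ennreal (s * circ k s) \<partial>lborel)"
  proof (rule nn_integral_cong)
    fix s :: real
    show "ennreal s * (\<integral>\<^sup>+ t \<in> {0..2*pi}.
       ennreal (l (rcis s t)) * indicator (ball 0 r) (rcis s t) \<partial>lborel) * indicator {0<..} s
      = ennreal (s * circ k s) * indicator {0<..<r} s"
    proof (cases "0 < s \<and> s < r")
      case True
      have "(\<integral>\<^sup>+ t \<in> {0..2*pi}. ennreal (l (rcis s t)) * indicator (ball 0 r) (rcis s t) \<partial>lborel)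
        = ennreal (circ k s)"
        using True r by (subst ennreal_circ[OF k _ _ k0]) (auto intro!: nn_integral_cong simp: l_def)
      then show ?thesis using True by (simp add: ennreal_mult')
    next
      case False
      then show ?thesis by (auto split: split_indicator)
    qed
  qed
  finally show ?thesis .
qed

section \<open>The Hardy--Stein identity\<close>

lemma has_real_derivative_powr_norm_sq:
  fixes g D :: "real \<Rightarrow> complex"
  assumes g: "(g has_vector_derivative g') (at x)" and e: "e > 0"
  shows "((\<lambda>x. ((cmod (g x))\<^sup>2 + e) powr q) has_real_derivative
    2 * (q * ((cmod (g x))\<^sup>2 + e) powr (q - 1)) * Re (cnj (g x) * g')) (at x)"
proof -
  have R: "((\<lambda>x. Re (g x)) has_real_derivative Re g') (at x)"
    and I: "((\<lambda>x. Im (g x)) has_real_derivative Im g') (at x)"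
    using has_field_derivative_Re[OF g] has_field_derivative_Im[OF g] by auto
  have pos: "(cmod (g x))\<^sup>2 + e > 0" using e by (simp add: add_nonneg_pos)
  have "((\<lambda>x. ((Re (g x))\<^sup>2 + (Im (g x))\<^sup>2 + e)) has_real_derivative 2 * Re (cnj (g x) * g')) (at x)"
    by (rule derivative_eq_intros R I refl | simp)+
  then have *: "((\<lambda>x. (cmod (g x))\<^sup>2 + e) has_real_derivative 2 * Re (cnj (g x) * g')) (at x)"
    by (simp add: cmod_power2)
  have "((\<lambda>x. ((cmod (g x))\<^sup>2 + e) powr q) has_real_derivative
    q * ((cmod (g x))\<^sup>2 + e) powr (q - 1) * (2 * Re (cnj (g x) * g'))) (at x)"
    using DERIV_fun_powr[OF * pos, of q] by simp
  then show ?thesis by (rule DERIV_cong) (simp add: algebra_simps)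
qed

lemma has_real_derivative_powr_norm_sq_times:
  fixes g D :: "real \<Rightarrow> complex"
  assumes g: "(g has_vector_derivative g') (at x)" and D: "(D has_vector_derivative D') (at x)"
    and e: "e > 0"
  shows "((\<lambda>x. 2 * (q * ((cmod (g x))\<^sup>2 + e) powr (q - 1)) * Re (cnj (g x) * D x)) has_real_derivative
     4 * (q * (q - 1) * ((cmod (g x))\<^sup>2 + e) powr (q - 2)) * Re (cnj (g x) * g') * Re (cnj (g x) * D x)
    + 2 * (q * ((cmod (g x))\<^sup>2 + e) powr (q - 1)) * (Re (cnj g' * D x) + Re (cnj (g x) * D'))) (at x)"
proof -
  have R: "((\<lambda>x. Re (g x)) has_real_derivative Re g') (at x)"
    and I: "((\<lambda>x. Im (g x)) has_real_derivative Im g') (at x)"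
    and R': "((\<lambda>x. Re (D x)) has_real_derivative Re D') (at x)"
    and I': "((\<lambda>x. Im (D x)) has_real_derivative Im D') (at x)"
    using has_field_derivative_Re[OF g] has_field_derivative_Im[OF g]
      has_field_derivative_Re[OF D] has_field_derivative_Im[OF D] by auto
  have "((\<lambda>x. Re (g x) * Re (D x) + Im (g x) * Im (D x)) has_real_derivative
      (Re (cnj g' * D x) + Re (cnj (g x) * D'))) (at x)"
    by (rule derivative_eq_intros R I R' I' refl | simp add: algebra_simps)+
  then have 1: "((\<lambda>x. Re (cnj (g x) * D x)) has_real_derivative
      (Re (cnj g' * D x) + Re (cnj (g x) * D'))) (at x)" by simp
  have 2: "((\<lambda>x. ((cmod (g x))\<^sup>2 + e) powr (q - 1)) has_real_derivative
    2 * ((q - 1) * ((cmod (g x))\<^sup>2 + e) powr (q - 2)) * Re (cnj (g x) * g')) (at x)"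
    using has_real_derivative_powr_norm_sq[OF g e, of "q - 1"] by simp
  show ?thesis
    by (rule derivative_eq_intros 1 2 refl | simp only:)+ (simp add: algebra_simps)
qed


text \<open>
  For holomorphic \<open>f\<close> the Laplacian of \<open>(|f|^2 + e)^q\<close> is \<open>|f'|^2 * hs_kernel q e (|f|^2)\<close>.
  With \<open>q = p/2\<close> it tends to \<open>p^2 |f|^(p-2) |f'|^2\<close> off the zeros of \<open>f\<close> as \<open>e\<close> tends to 0.
\<close>
definition hs_kernel :: "real \<Rightarrow> real \<Rightarrow> real \<Rightarrow> real" where
  "hs_kernel q e t = 4 * q * (t + e) powr (q - 2) * (q * t + e)"

lemma hs_kernel_eq:
  assumes "t \<ge> 0" "e > 0"
  shows "hs_kernel q e t = 4 * (q * (q - 1) * (t + e) powr (q - 2)) * t + 4 * (q * (t + e) powr (q - 1))"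
proof -
  have "(t + e) powr (q - 1) = (t + e) powr (q - 2) * (t + e)"
    using assms powr_add[of "t + e" "q - 2" 1] by simp
  then show ?thesis by (simp add: hs_kernel_def algebra_simps)
qed

lemma hs_kernel_bounds:
  assumes "t \<ge> 0" "e > 0" "q > 0"
  shows "0 \<le> hs_kernel q e t" "hs_kernel q e t \<le> 4 * q * max q 1 * (t + e) powr (q - 1)"
proof -
  show "0 \<le> hs_kernel q e t" using assms by (simp add: hs_kernel_def)
  have "q * t \<le> max q 1 * t" "1 * e \<le> max q 1 * e"
    using assms by (auto intro!: mult_right_mono)
  then have "q * t + e \<le> max q 1 * (t + e)" by (simp add: algebra_simps)
  then have "hs_kernel q e t \<le> 4 * q * (t + e) powr (q - 2) * (max q 1 * (t + e))"
    unfolding hs_kernel_def using assms by (intro mult_left_mono) auto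
  also have "\<dots> = 4 * q * max q 1 * ((t + e) powr (q - 2) * (t + e) powr 1)" using assms by simp
  also have "\<dots> = 4 * q * max q 1 * (t + e) powr (q - 1)" using powr_add[of "t + e" "q - 2" 1] by simp
  finally show "hs_kernel q e t \<le> 4 * q * max q 1 * (t + e) powr (q - 1)" .
qed

text \<open>
  The Hardy--Stein identity for the smooth function \<open>u = (|f|^2 + e)^q\<close>.  Write
  \<open>D = z f'\<close>.  In polar coordinates \<open>w = r du/dr\<close> and \<open>v = - du/d\<theta>\<close>, while
  \<open>w'\<close> and \<open>v'\<close> below are \<open>r dw/dr\<close> and \<open>dv/d\<theta>\<close>; their difference is \<open>|z|^2\<close> times the
  Laplacian \<open>k\<close> of \<open>u\<close>.  The circle integral of \<open>v'\<close> vanishes by periodicity.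
\<close>
lemma hs_regularized:
  fixes f :: "complex \<Rightarrow> complex"
  assumes f: "f holomorphic_on ball 0 1" and e: "e > 0" and q: "q > 0"
  defines "u \<equiv> \<lambda>z. ((cmod (f z))\<^sup>2 + e) powr q"
    and "w \<equiv> \<lambda>z. 2 * (q * ((cmod (f z))\<^sup>2 + e) powr (q - 1)) * Re (cnj (f z) * (z * deriv f z))"
    and "k \<equiv> \<lambda>z. (cmod (deriv f z))\<^sup>2 * hs_kernel q e ((cmod (f z))\<^sup>2)"
  shows "\<And>r. 0 < r \<Longrightarrow> r < 1 \<Longrightarrow> (circ u has_real_derivative circ w r / r) (at r)"
    and "\<And>r. 0 < r \<Longrightarrow> r < 1 \<Longrightarrow>
        ennreal (circ w r) = (\<integral>\<^sup>+ z \<in> ball 0 r. ennreal (k z) \<partial>lborel)"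
    and "\<And>r. 0 < r \<Longrightarrow> r < 1 \<Longrightarrow> 0 \<le> circ w r"
proof -
  define D where "D z = z * deriv f z" for z
  define D2 where "D2 z = z * deriv D z" for z
  have f': "deriv f holomorphic_on ball 0 1" using f by (simp add: holomorphic_deriv)
  have D: "D holomorphic_on ball 0 1" unfolding D_def by (intro holomorphic_intros f')
  have D2: "D2 holomorphic_on ball 0 1" unfolding D2_def
    by (intro holomorphic_intros holomorphic_deriv D) auto
  note [continuous_intros] = holomorphic_on_imp_continuous_on[OF f] holomorphic_on_imp_continuous_on[OF f']
    holomorphic_on_imp_continuous_on[OF D] holomorphic_on_imp_continuous_on[OF D2]
  have pos: "(cmod (f z))\<^sup>2 + e > 0" for z using e by (simp add: add_nonneg_pos)
  then have ne: "(cmod (f z))\<^sup>2 + e \<noteq> 0" for z by (metis less_irrefl)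
  have vr: "((\<lambda>r. g (rcis r \<theta>)) has_vector_derivative (rcis r \<theta> * deriv g (rcis r \<theta>)) / of_real r) (at r)"
    if g: "g holomorphic_on ball 0 1" and r: "0 < r" "r < 1" for g r \<theta>
  proof -
    have "(g has_field_derivative deriv g (rcis r \<theta>)) (at (rcis r \<theta>))"
      using r by (intro holomorphic_derivI[OF g]) auto
    moreover have "((\<lambda>r. rcis r \<theta>) has_vector_derivative cis \<theta>) (at r)"
      unfolding rcis_def by (auto intro!: derivative_eq_intros)
    ultimately have "((g \<circ> (\<lambda>r. rcis r \<theta>)) has_vector_derivative cis \<theta> * deriv g (rcis r \<theta>)) (at r)"
      by (rule field_vector_diff_chain_at[rotated])
    then show ?thesis using r by (simp add: o_def rcis_def)
  qed
  have vt: "((\<lambda>\<theta>. g (rcis r \<theta>)) has_vector_derivative \<i> * (rcis r \<theta> * deriv g (rcis r \<theta>))) (at \<theta>)"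
    if g: "g holomorphic_on ball 0 1" and r: "0 < r" "r < 1" for g r \<theta>
  proof -
    have "(g has_field_derivative deriv g (rcis r \<theta>)) (at (rcis r \<theta>))"
      using r by (intro holomorphic_derivI[OF g]) auto
    moreover have "((\<lambda>\<theta>. rcis r \<theta>) has_vector_derivative \<i> * rcis r \<theta>) (at \<theta>)"
      unfolding rcis_def cis_conv_exp
      by (rule has_vector_derivative_eq_rhs, rule has_vector_derivative_real_field)
         (auto intro!: derivative_eq_intros)
    ultimately have "((g \<circ> (\<lambda>\<theta>. rcis r \<theta>)) has_vector_derivative \<i> * rcis r \<theta> * deriv g (rcis r \<theta>)) (at \<theta>)"
      by (rule field_vector_diff_chain_at[rotated])
    then show ?thesis by (simp add: o_def mult_ac)
  qed
  define w' where "w' z = 4 * (q * (q - 1) * ((cmod (f z))\<^sup>2 + e) powr (q - 2)) * (Re (cnj (f z) * D z))\<^sup>2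
     + 2 * (q * ((cmod (f z))\<^sup>2 + e) powr (q - 1)) * ((cmod (D z))\<^sup>2 + Re (cnj (f z) * D2 z))" for z
  define v where "v z = 2 * (q * ((cmod (f z))\<^sup>2 + e) powr (q - 1)) * Re (cnj (f z) * (- \<i> * D z))" for z
  define v' where "v' z = - 4 * (q * (q - 1) * ((cmod (f z))\<^sup>2 + e) powr (q - 2)) * (Im (cnj (f z) * D z))\<^sup>2
     + 2 * (q * ((cmod (f z))\<^sup>2 + e) powr (q - 1)) * (- (cmod (D z))\<^sup>2 + Re (cnj (f z) * D2 z))" for z
  have w_D: "w = (\<lambda>z. 2 * (q * ((cmod (f z))\<^sup>2 + e) powr (q - 1)) * Re (cnj (f z) * D z))"
    by (simp add: w_def D_def)
  have cu: "continuous_on (ball 0 1) u" unfolding u_def using ne by (auto intro!: continuous_intros)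
  have cw: "continuous_on (ball 0 1) w" unfolding w_D using ne by (auto intro!: continuous_intros)
  have cw': "continuous_on (ball 0 1) w'" unfolding w'_def using ne by (auto intro!: continuous_intros)
  have cv': "continuous_on (ball 0 1) v'" unfolding v'_def using ne by (auto intro!: continuous_intros)
  have ck: "continuous_on (ball 0 1) k" unfolding k_def hs_kernel_def using ne by (auto intro!: continuous_intros)
  have k0: "0 \<le> k z" for z unfolding k_def using hs_kernel_bounds(1)[of "(cmod (f z))\<^sup>2" e q] e q by simp
  show du: "(circ u has_real_derivative circ w r / r) (at r)" if "0 < r" "r < 1" for r
  proof (rule circ_has_real_derivative[OF cu cw _ that])
    fix r \<theta> :: real assume r: "0 < r" "r < 1"
    show "((\<lambda>r. u (rcis r \<theta>)) has_real_derivative w (rcis r \<theta>) / r) (at r)"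
      unfolding u_def by (rule DERIV_cong[OF has_real_derivative_powr_norm_sq[OF vr[OF f r, of \<theta>] e, of q]])
        (simp only: w_def times_divide_eq_right Re_divide_of_real)
  qed
  have dw: "(circ w has_real_derivative circ w' r / r) (at r)" if "0 < r" "r < 1" for r
  proof (rule circ_has_real_derivative[OF cw cw' _ that])
    fix r \<theta> :: real assume r: "0 < r" "r < 1"
    let ?z = "rcis r \<theta>"
    have a: "Re (cnj (D ?z / of_real r) * D ?z) = (cmod (D ?z))\<^sup>2 / r"
      by (simp add: cmod_power2 add_divide_distrib) (simp add: power2_eq_square)
    show "((\<lambda>r. w (rcis r \<theta>)) has_real_derivative w' ?z / r) (at r)"
      unfolding w_D
      by (rule DERIV_cong[OF has_real_derivative_powr_norm_sq_times[OF
            vr[OF f r, of \<theta>, folded D_def] vr[OF D r, of \<theta>, folded D2_def] e, of q]])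
        (use r in \<open>simp only: a w'_def, simp add: field_simps power2_eq_square\<close>)
  qed
  have pv: "circ v' r = 0" if r: "0 < r" "r < 1" for r
  proof -
    have "((\<lambda>\<theta>. v' (rcis r \<theta>)) has_integral v (rcis r (2 * pi)) - v (rcis r 0)) {0..2*pi}"
    proof (rule fundamental_theorem_of_calculus)
      fix \<theta> :: real
      let ?z = "rcis r \<theta>"
      have "((\<lambda>\<theta>. - \<i> * D (rcis r \<theta>)) has_vector_derivative D2 ?z) (at \<theta>)"
        using has_vector_derivative_mult_right[OF vt[OF D r, of \<theta>, folded D2_def], of "- \<i>"] by simp
      note d = has_real_derivative_powr_norm_sq_times[OF vt[OF f r, of \<theta>, folded D_def] this e, of q]
      have a: "Re (cnj (\<i> * D ?z) * (- \<i> * D ?z)) = - (cmod (D ?z))\<^sup>2"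
        by (simp add: cmod_power2) (simp add: power2_eq_square)
      have b: "Re (cnj (f ?z) * (\<i> * D ?z)) = - Im (cnj (f ?z) * D ?z)"
        "Re (cnj (f ?z) * (- \<i> * D ?z)) = Im (cnj (f ?z) * D ?z)" by simp_all
      have "((\<lambda>\<theta>. v (rcis r \<theta>)) has_real_derivative v' ?z) (at \<theta>)"
        unfolding v_def by (rule DERIV_cong[OF d]) (unfold a b v'_def power2_eq_square, simp add: algebra_simps)
      then show "((\<lambda>\<theta>. v (rcis r \<theta>)) has_vector_derivative v' ?z) (at \<theta> within {0..2*pi})"
        by (simp add: has_real_derivative_iff_has_vector_derivative has_vector_derivative_at_within)
    qed simp
    then show ?thesis by (simp add: circ_def rcis_def integral_unique)
  qed
  have wk: "circ w' r / r = r * circ k r" if r: "0 < r" "r < 1" for r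
  proof -
    have "w' z - v' z = (cmod z)\<^sup>2 * k z" for z
    proof -
      have 1: "(Re (cnj (f z) * D z))\<^sup>2 + (Im (cnj (f z) * D z))\<^sup>2 = (cmod (f z))\<^sup>2 * (cmod (D z))\<^sup>2"
        by (simp only: cmod_power2[symmetric] norm_mult power_mult_distrib complex_mod_cnj)
      have "w' z - v' z = 4 * (q * (q - 1) * ((cmod (f z))\<^sup>2 + e) powr (q - 2)) *
           ((Re (cnj (f z) * D z))\<^sup>2 + (Im (cnj (f z) * D z))\<^sup>2) +
           4 * (q * ((cmod (f z))\<^sup>2 + e) powr (q - 1)) * (cmod (D z))\<^sup>2"
        unfolding w'_def v'_def by (simp only: algebra_simps)
      also have "\<dots> = (cmod (D z))\<^sup>2 * hs_kernel q e ((cmod (f z))\<^sup>2)"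
        unfolding 1 using e by (subst hs_kernel_eq) (auto simp: algebra_simps)
      finally show ?thesis by (simp add: D_def k_def norm_mult power_mult_distrib)
    qed
    then have *: "r\<^sup>2 * k (rcis r \<theta>) = w' (rcis r \<theta>) - v' (rcis r \<theta>)" for \<theta> using r by simp
    have "((\<lambda>\<theta>. r\<^sup>2 * k (rcis r \<theta>)) has_integral circ w' r - circ v' r) {0..2*pi}"
      unfolding * using r cw' cv' by (intro has_integral_diff circ_has_integral) auto
    moreover have "((\<lambda>\<theta>. r\<^sup>2 * k (rcis r \<theta>)) has_integral r\<^sup>2 * circ k r) {0..2*pi}"
      using r ck by (intro has_integral_mult_right circ_has_integral) auto
    ultimately have "circ w' r - circ v' r = r\<^sup>2 * circ k r" by (rule has_integral_unique)
    then show ?thesis using r pv[OF r] by (simp add: power2_eq_square)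
  qed
  have ck0: "0 \<le> circ k r" if "0 \<le> r" "r < 1" for r using circ_nonneg[OF ck] that k0 by auto
  have hi: "((\<lambda>s. s * circ k s) has_integral circ w r) {0..r}" if r: "0 < r" "r < 1" for r
  proof -
    have "((\<lambda>s. s * circ k s) has_integral circ w r - circ w 0) {0..r}"
    proof (rule fundamental_theorem_of_calculus_interior)
      show "continuous_on {0..r} (circ w)"
        by (rule continuous_on_subset[OF continuous_on_circ[OF cw]]) (use r in auto)
      fix s assume "s \<in> {0<..<r}"
      then show "(circ w has_vector_derivative s * circ k s) (at s)"
        using dw[of s] wk[of s] r by (simp add: has_real_derivative_iff_has_vector_derivative)
    qed (use r in auto)
    moreover have "circ w 0 = 0" by (simp add: circ_0 w_def)
    ultimately show ?thesis by simp
  qed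
  show "0 \<le> circ w r" if r: "0 < r" "r < 1" for r
    by (rule has_integral_nonneg[OF hi[OF r]]) (use r ck0 in auto)
  show "ennreal (circ w r) = (\<integral>\<^sup>+ z \<in> ball 0 r. ennreal (k z) \<partial>lborel)" if r: "0 < r" "r < 1" for r
  proof -
    have "(\<integral>\<^sup>+ z \<in> ball 0 r. ennreal (k z) \<partial>lborel) = (\<integral>\<^sup>+ s \<in> {0<..<r}. ennreal (s * circ k s) \<partial>lborel)"
      using r k0 by (intro nn_integral_ball_eq_circ ck) auto
    also have "\<dots> = (\<integral>\<^sup>+ s \<in> {0..r}. ennreal (s * circ k s) \<partial>lborel)"
      by (intro nn_integral_cong_AE, use AE_lborel_singleton[of 0] AE_lborel_singleton[of r] in eventually_elim)
         (auto split: split_indicator)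
    also have "\<dots> = ennreal (circ w r)"
      by (rule nn_integral_has_integral_lebesgue'[OF _ hi[OF r]]) (use r ck0 in auto)
    finally show ?thesis ..
  qed
qed

text \<open>
  The density in the Hardy--Stein identity.  At the zeros of \<open>f\<close> it is 0 for every \<open>p\<close>, because
  \<open>0 powr a = 0\<close>; this is immaterial, since the zeros form a null set unless \<open>f' = 0\<close>.
\<close>
definition hs_density :: "real \<Rightarrow> (complex \<Rightarrow> complex) \<Rightarrow> complex \<Rightarrow> real" where
  "hs_density p f z = cmod (f z) powr (p - 2) * (cmod (deriv f z))\<^sup>2"

text \<open>
  The integral of the density over the disc of radius \<open>r\<close>, with respect to unnormalized area.
\<close>
definition hs_mass :: "real \<Rightarrow> (complex \<Rightarrow> complex) \<Rightarrow> real \<Rightarrow> ennreal" where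
  "hs_mass p f r = (\<integral>\<^sup>+ z \<in> ball 0 r. ennreal (hs_density p f z) \<partial>lborel)"

lemma hs_density_nonneg: "0 \<le> hs_density p f z"
  by (simp add: hs_density_def)

lemma measurable_if_holomorphic:
  assumes "f holomorphic_on ball 0 1"
  shows "(\<lambda>z. if cmod z < 1 then f z else 0) \<in> borel_measurable borel"
  by (rule measurable_if_continuous_on_ball[OF holomorphic_on_imp_continuous_on[OF assms]])

lemma measurable_hs_density:
  assumes f: "f holomorphic_on ball 0 1"
  shows "(\<lambda>z. if cmod z < 1 then hs_density p f z else 0) \<in> borel_measurable borel"
proof -
  define g where "g z = (if cmod z < 1 then f z else 0)" for z
  define g' where "g' z = (if cmod z < 1 then deriv f z else 0)" for z
  have [measurable]: "g \<in> borel_measurable borel" unfolding g_def by (rule measurable_if_holomorphic[OF f])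
  have [measurable]: "g' \<in> borel_measurable borel"
    unfolding g'_def by (rule measurable_if_holomorphic) (use f in \<open>simp add: holomorphic_deriv\<close>)
  have "(\<lambda>z. if cmod z < 1 then hs_density p f z else 0) =
    (\<lambda>z. if cmod z < 1 then cmod (g z) powr (p - 2) * (cmod (g' z))\<^sup>2 else 0)"
    by (auto simp: hs_density_def g_def g'_def)
  also have "\<dots> \<in> borel_measurable borel" by measurable
  finally show ?thesis .
qed

lemma fsigma_unit_disc: "fsigma (ball (0::complex) 1)"
proof -
  have "ball (0::complex) 1 = (\<Union>n::nat. cball 0 (1 - inverse (real (Suc n))))"
  proof (intro set_eqI iffI)
    fix z :: complex assume "z \<in> ball 0 1"
    then obtain n where "inverse (real (Suc n)) < 1 - cmod z"
      using reals_Archimedean[of "1 - cmod z"] by auto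
    then show "z \<in> (\<Union>n::nat. cball 0 (1 - inverse (real (Suc n))))" by (intro UN_I[of n]) auto
  next
    fix z :: complex assume "z \<in> (\<Union>n::nat. cball 0 (1 - inverse (real (Suc n))))"
    then obtain n where "cmod z \<le> 1 - inverse (real (Suc n))" by auto
    also have "\<dots> < 1" by simp
    finally show "z \<in> ball 0 1" by simp
  qed
  also have "fsigma \<dots>" by (rule fsigma.intros) simp
  finally show ?thesis .
qed

text \<open>
  Almost everywhere \<open>f\<close> has no zero at which the density could be singular: the zeros are countable
  unless \<open>f\<close> is constant.
\<close>
lemma AE_nonzero_or_deriv_zero:
  assumes f: "f holomorphic_on ball 0 1"
  shows "AE z in lborel. z \<in> ball 0 1 \<longrightarrow> f z \<noteq> 0 \<or> deriv f z = 0"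
proof (cases "f constant_on ball 0 1")
  case True
  then obtain c where c: "\<And>z. z \<in> ball 0 1 \<Longrightarrow> f z = c" by (auto simp: constant_on_def)
  have "deriv f z = 0" if "z \<in> ball 0 1" for z
  proof -
    have "deriv f z = deriv (\<lambda>_. c) z"
      by (rule deriv_cong_ev[OF eventually_mono[OF eventually_nhds_in_open[OF open_ball that]]]) (auto simp: c)
    then show ?thesis by simp
  qed
  then show ?thesis by simp
next
  case False
  have "countable {z \<in> ball 0 1. f z = 0}"
    by (rule holomorphic_countable_zeros[OF f]) (use False fsigma_unit_disc in auto)
  then have "AE z in lborel. z \<notin> {z \<in> ball 0 1. f z = 0}"
    by (intro AE_not_in countable_imp_null_set_lborel)
  then show ?thesis by eventually_elim auto
qed

lemma powr_half_square: "0 \<le> x \<Longrightarrow> (x\<^sup>2) powr (p / 2) = x powr (p::real)"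
  by (cases "x = 0") (simp_all add: powr_powr flip: powr_numeral)

lemma bounded_on_cball:
  fixes g :: "complex \<Rightarrow> complex"
  assumes "g holomorphic_on ball 0 1" "r < 1"
  obtains B where "B > 0" "\<And>z. cmod z \<le> r \<Longrightarrow> cmod (g z) \<le> B"
proof -
  have "compact (g ` cball 0 r)"
    by (intro compact_continuous_image continuous_on_subset[OF holomorphic_on_imp_continuous_on[OF assms(1)]])
      (use assms in auto)
  then obtain B where "B > 0" "\<And>y. y \<in> g ` cball 0 r \<Longrightarrow> norm y \<le> B"
    using compact_imp_bounded bounded_pos by metis
  then show ?thesis using that by auto
qed

lemma continuous_on_norm_powr:
  assumes "f holomorphic_on S" "0 < p"
  shows "continuous_on S (\<lambda>z. cmod (f z) powr p)"
  by (intro continuous_on_powr' continuous_intros holomorphic_on_imp_continuous_on[OF assms(1)])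
     (use assms in auto)

text \<open>
  If \<open>r U'(r) = W r\<close> is nondecreasing, then the increments of \<open>U\<close> are bounded by values of \<open>W\<close>
  alone.  The bounds contain no derivative or integral, so they survive the passage to the limit in
  the regularization, and the next lemma recovers the derivative from them.
\<close>
lemma ln_scale_bounds_by_derivative:
  fixes U W :: "real \<Rightarrow> real"
  assumes ab: "0 < a" "a < b" "b < 1"
    and U: "\<And>r. 0 < r \<Longrightarrow> r < 1 \<Longrightarrow> (U has_real_derivative W r / r) (at r)"
    and W: "\<And>r s. 0 < r \<Longrightarrow> r \<le> s \<Longrightarrow> s < 1 \<Longrightarrow> W r \<le> W s"
  shows "W a * (ln b - ln a) \<le> U b - U a" "U b - U a \<le> W b * (ln b - ln a)"
proof -
  have d: "((\<lambda>r. U r - c * ln r) has_real_derivative (W r - c) / r) (at r)" if "0 < r" "r < 1" for r c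
    by (rule derivative_eq_intros U refl that | use that in \<open>simp add: diff_divide_distrib\<close>)+
  have "U a - W a * ln a \<le> U b - W a * ln b"
  proof (rule DERIV_nonneg_imp_nondecreasing[where f = "\<lambda>r. U r - W a * ln r"])
    fix x assume "a \<le> x" "x \<le> b"
    then show "\<exists>y. ((\<lambda>r. U r - W a * ln r) has_real_derivative y) (at x) \<and> 0 \<le> y"
      using d[of x "W a"] W[of a x] ab by (intro exI[of _ "(W x - W a) / x"]) auto
  qed (use ab in auto)
  then show "W a * (ln b - ln a) \<le> U b - U a" by (simp add: algebra_simps)
  have "U a - W b * ln a \<ge> U b - W b * ln b"
  proof (rule DERIV_nonpos_imp_nonincreasing[where f = "\<lambda>r. U r - W b * ln r"])
    fix x assume "a \<le> x" "x \<le> b"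
    then show "\<exists>y. ((\<lambda>r. U r - W b * ln r) has_real_derivative y) (at x) \<and> y \<le> 0"
      using d[of x "W b"] W[of x b] ab by (intro exI[of _ "(W x - W b) / x"]) (auto simp: divide_nonpos_pos)
  qed (use ab in auto)
  then show "U b - U a \<le> W b * (ln b - ln a)" by (simp add: algebra_simps)
qed

lemma abs_diff_le_of_between:
  fixes l :: real
  assumes l: "l > 0" "Ly = l" "(Tr * l \<le> Q \<and> Q \<le> Ty * l) \<or> (Ty * l \<le> Q \<and> Q \<le> Tr * l)"
  shows "norm (Q - Tr * Ly) \<le> \<bar>Ty - Tr\<bar> * \<bar>Ly\<bar>"
proof -
  have "\<bar>Ty - Tr\<bar> * l = \<bar>Ty * l - Tr * l\<bar>" using l(1) by (simp add: abs_mult flip: left_diff_distrib)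
  then show ?thesis using l by auto
qed

text \<open>
  Conversely, such bounds with a continuous \<open>T\<close> determine the derivative: the difference quotient
  of \<open>U\<close> lies between \<open>T r\<close> and \<open>T y\<close> times that of the logarithm.
\<close>
lemma derivative_from_ln_scale_bounds:
  fixes U T :: "real \<Rightarrow> real"
  assumes B: "\<And>a b. 0 < a \<Longrightarrow> a < b \<Longrightarrow> b < 1 \<Longrightarrow> T a * (ln b - ln a) \<le> U b - U a \<and> U b - U a \<le> T b * (ln b - ln a)"
    and r: "0 < r" "r < 1" and T: "isCont T r"
  shows "(U has_real_derivative T r / r) (at r)"
proof -
  define L where "L y = (ln y - ln r) / (y - r)" for y
  have "(ln has_real_derivative inverse r) (at r)" using r by (intro DERIV_ln)
  then have L: "L \<midarrow>r\<rightarrow> inverse r" by (simp add: has_field_derivative_iff L_def[abs_def])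
  have "\<forall>\<^sub>F y in at r. y \<in> {0<..<1}" using r by (intro eventually_at_in_open') auto
  moreover have "\<forall>\<^sub>F y in at r. y \<noteq> r" by (simp add: eventually_at_filter)
  ultimately have "\<forall>\<^sub>F y in at r. norm ((U y - U r) / (y - r) - T r * L y) \<le> \<bar>T y - T r\<bar> * \<bar>L y\<bar>"
  proof eventually_elim
    case (elim y)
    have q: "\<exists>l > 0. L y = l \<and> ((T r * l \<le> (U y - U r) / (y - r) \<and> (U y - U r) / (y - r) \<le> T y * l) \<or>
       (T y * l \<le> (U y - U r) / (y - r) \<and> (U y - U r) / (y - r) \<le> T r * l))"
    proof (cases "r < y")
      case True
      then have "L y > 0" using r elim by (simp add: L_def)
      moreover have "T r * L y \<le> (U y - U r) / (y - r)" "(U y - U r) / (y - r) \<le> T y * L y"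
        using B[of r y] r elim True unfolding L_def times_divide_eq_right by (auto intro!: divide_right_mono)
      ultimately show ?thesis by auto
    next
      case False
      then have yr: "y < r" using elim by auto
      have sym: "L y = (ln r - ln y) / (r - y)" "(U y - U r) / (y - r) = (U r - U y) / (r - y)"
        using minus_divide_divide[of "ln y - ln r" "y - r"] minus_divide_divide[of "U y - U r" "y - r"]
        by (simp_all add: L_def)
      have "L y > 0" unfolding sym using r elim yr by simp
      moreover have "T y * L y \<le> (U y - U r) / (y - r)" "(U y - U r) / (y - r) \<le> T r * L y"
        unfolding sym times_divide_eq_right using B[of y r] r elim yr by (auto intro!: divide_right_mono)
      ultimately show ?thesis by auto
    qed
    then obtain l where l: "l > 0" "L y = l" "(T r * l \<le> (U y - U r) / (y - r) \<and> (U y - U r) / (y - r) \<le> T y * l) \<or>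
       (T y * l \<le> (U y - U r) / (y - r) \<and> (U y - U r) / (y - r) \<le> T r * l)" by blast
    show ?case by (rule abs_diff_le_of_between[OF l])
  qed
  moreover have "(\<lambda>y. \<bar>T y - T r\<bar> * \<bar>L y\<bar>) \<midarrow>r\<rightarrow> 0"
  proof -
    have "(\<lambda>y. \<bar>T y - T r\<bar> * \<bar>L y\<bar>) \<midarrow>r\<rightarrow> \<bar>T r - T r\<bar> * \<bar>inverse r\<bar>"
      by (rule tendsto_mult[OF tendsto_rabs[OF tendsto_diff[OF T[unfolded isCont_def] tendsto_const]] tendsto_rabs[OF L]])
    then show ?thesis by simp
  qed
  ultimately have "(\<lambda>y. (U y - U r) / (y - r) - T r * L y) \<midarrow>r\<rightarrow> 0"
    by (rule Lim_null_comparison)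
  from tendsto_add[OF this tendsto_mult[OF tendsto_const[of "T r"] L]]
  have "(\<lambda>y. (U y - U r) / (y - r)) \<midarrow>r\<rightarrow> T r / r" by (simp add: divide_inverse)
  then show ?thesis by (simp only: has_field_derivative_iff)
qed

lemma AE_not_circle: "AE z in lborel. cmod z \<noteq> r"
proof (rule AE_I)
  show "{z \<in> space lborel. \<not> cmod z \<noteq> r} \<subseteq> sphere 0 r" by auto
  have [measurable]: "sphere (0::complex) r \<in> sets borel" by simp
  have "emeasure lborel (sphere (0::complex) r) = (\<integral>\<^sup>+ z. indicator (sphere (0::complex) r) z \<partial>lborel)" by simp
  also have "\<dots> = (\<integral>\<^sup>+ s \<in> {0<..}. ennreal s * (\<integral>\<^sup>+ t \<in> {0..2*pi}. indicator (sphere 0 r) (rcis s t) \<partial>lborel) \<partial>lborel)"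
    by (rule nn_integral_polar) measurable
  also have "\<dots> = (\<integral>\<^sup>+ (s::real). 0 \<partial>lborel)"
    by (rule nn_integral_cong_AE, use AE_lborel_singleton[of r] in eventually_elim) (auto split: split_indicator)
  finally show "emeasure lborel (sphere (0::complex) r) = 0" by simp
qed simp


lemma hs_mass_mono: "r \<le> s \<Longrightarrow> hs_mass p f r \<le> hs_mass p f s"
  unfolding hs_mass_def by (intro nn_integral_mono) (auto split: split_indicator)

lemma isCont_hs_mass:
  assumes f: "f holomorphic_on ball 0 1" and fin: "\<And>r. r < 1 \<Longrightarrow> hs_mass p f r < \<infinity>"
    and r: "0 < r" "r < 1"
  shows "isCont (\<lambda>r. enn2real (hs_mass p f r)) r"
  unfolding continuous_at_sequentially
proof (intro allI impI)
  fix X :: "nat \<Rightarrow> real" assume X: "X \<longlonglongrightarrow> r"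
  define R where "R = (1 + r) / 2"
  have R: "r < R" "R < 1" using r by (auto simp: R_def)
  define h where "h z = (if cmod z < 1 then hs_density p f z else 0)" for z
  have [measurable]: "h \<in> borel_measurable borel" unfolding h_def by (rule measurable_hs_density[OF f])
  have mass: "hs_mass p f s = (\<integral>\<^sup>+ z. ennreal (h z) * indicator (ball 0 s) z \<partial>lborel)" if "s \<le> R" for s
    unfolding hs_mass_def using that R by (intro nn_integral_cong) (auto simp: h_def split: split_indicator)
  define Y where "Y n = min (X n) R" for n
  have Y: "Y \<longlonglongrightarrow> r" unfolding Y_def using tendsto_min[OF X tendsto_const[of R]] R by simp
  have "(\<lambda>n. \<integral>\<^sup>+ z. ennreal (h z) * indicator (ball 0 (Y n)) z \<partial>lborel) \<longlonglongrightarrow>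
      (\<integral>\<^sup>+ z. ennreal (h z) * indicator (ball 0 r) z \<partial>lborel)"
  proof (rule nn_integral_dominated_convergence)
    show "AE z in lborel. ennreal (h z) * indicator (ball 0 (Y j)) z \<le> ennreal (h z) * indicator (ball 0 R) z" for j
      by (auto simp: Y_def split: split_indicator)
    show "(\<integral>\<^sup>+z. ennreal (h z) * indicator (ball 0 R) z \<partial>lborel) < \<infinity>"
      using fin[of R] R by (simp add: mass)
    show "AE z in lborel. (\<lambda>i. ennreal (h z) * indicator (ball 0 (Y i)) z) \<longlonglongrightarrow> ennreal (h z) * indicator (ball 0 r) z"
      using AE_not_circle[of r]
    proof eventually_elim
      case (elim z)
      then have "cmod z < r \<or> r < cmod z" by linarith
      then have ev: "\<forall>\<^sub>F i in sequentially. indicator (ball 0 (Y i)) z = (indicator (ball 0 r) z :: ennreal)"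
      proof
        assume "cmod z < r"
        then show ?thesis
          by (intro eventually_mono[OF order_tendstoD(1)[OF Y]]) (simp_all add: indicator_def)
      next
        assume "r < cmod z"
        then show ?thesis
          by (intro eventually_mono[OF order_tendstoD(2)[OF Y]]) (auto simp: indicator_def)
      qed
      show ?case
        by (rule tendsto_eventually, rule eventually_mono[OF ev]) simp
    qed
  qed measurable
  then have "(\<lambda>n. hs_mass p f (Y n)) \<longlonglongrightarrow> hs_mass p f r"
    using R by (simp add: mass Y_def)
  then have "(\<lambda>n. enn2real (hs_mass p f (Y n))) \<longlonglongrightarrow> enn2real (hs_mass p f r)"
    using fin[OF r(2)] by (intro tendsto_enn2real) auto
  moreover have "\<forall>\<^sub>F n in sequentially. enn2real (hs_mass p f (Y n)) = ((\<lambda>r. enn2real (hs_mass p f r)) \<circ> X) n"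
    using order_tendstoD(2)[OF X R(1)] by eventually_elim (simp add: Y_def)
  ultimately show "((\<lambda>r. enn2real (hs_mass p f r)) \<circ> X) \<longlonglongrightarrow> enn2real (hs_mass p f r)"
    by (rule Lim_transform_eventually)
qed

lemma tendsto_circ:
  assumes K: "\<And>n. continuous_on (ball 0 1) (K n)" and r: "0 \<le> r" "r < 1"
    and bound: "\<And>n z. cmod z = r \<Longrightarrow> \<bar>K n z\<bar> \<le> B"
    and lim: "\<And>z. cmod z = r \<Longrightarrow> (\<lambda>n. K n z) \<longlonglongrightarrow> k z"
  shows "(\<lambda>n. circ (K n) r) \<longlonglongrightarrow> circ k r"
  unfolding circ_def
  by (rule dominated_convergence(2)[where h = "\<lambda>_. B"])
     (use assms in \<open>auto intro!: integrable_continuous_real continuous_on_circle\<close>)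

text \<open>
  The regularized bounds with \<open>e = 1/(n+1)\<close>, in the limit.  Finiteness of \<open>hs_mass\<close> comes from
  Fatou's lemma; once it is known, the convergence of the area integrals is dominated, by a multiple
  of the density itself when \<open>p \<le> 2\<close> and by a constant when \<open>p \<ge> 2\<close>.
\<close>
lemma hs_limit:
  fixes f :: "complex \<Rightarrow> complex"
  assumes f: "f holomorphic_on ball 0 1" and p: "p > 0" and ab: "0 < a" "a < b" "b < 1"
  shows "hs_mass p f a < \<infinity>"
    and "p\<^sup>2 * enn2real (hs_mass p f a) * (ln b - ln a) \<le> circ (\<lambda>z. cmod (f z) powr p) b - circ (\<lambda>z. cmod (f z) powr p) a"
    and "hs_mass p f b < \<infinity> \<Longrightarrow> circ (\<lambda>z. cmod (f z) powr p) b - circ (\<lambda>z. cmod (f z) powr p) a \<le> p\<^sup>2 * enn2real (hs_mass p f b) * (ln b - ln a)"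
proof -
  define q where "q = p / 2"
  have q: "q > 0" using p by (simp add: q_def)
  define e where "e n = inverse (real (Suc n))" for n
  have e: "e n > 0" "e n \<le> 1" for n by (auto simp: e_def divide_simps)
  have e0: "e \<longlonglongrightarrow> 0" unfolding e_def by (rule LIMSEQ_inverse_real_of_nat)
  define u where "u n z = ((cmod (f z))\<^sup>2 + e n) powr q" for n z
  define w where "w n z = 2 * (q * ((cmod (f z))\<^sup>2 + e n) powr (q - 1)) * Re (cnj (f z) * (z * deriv f z))" for n z
  define k where "k n z = (cmod (deriv f z))\<^sup>2 * hs_kernel q (e n) ((cmod (f z))\<^sup>2)" for n z
  have du: "(circ (u n) has_real_derivative circ (w n) r / r) (at r)"
    and wk: "ennreal (circ (w n) r) = (\<integral>\<^sup>+ z \<in> ball 0 r. ennreal (k n z) \<partial>lborel)"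
    and w0: "0 \<le> circ (w n) r" if "0 < r" "r < 1" for n r
    using hs_regularized[OF f e(1)[of n] q, folded u_def w_def k_def] that by blast+
  have wmono: "circ (w n) r \<le> circ (w n) s" if "0 < r" "r \<le> s" "s < 1" for n r s
  proof -
    have "ennreal (circ (w n) r) \<le> ennreal (circ (w n) s)"
      using that by (subst (1 2) wk) (auto intro!: nn_integral_mono split: split_indicator)
    then show ?thesis using w0[of s n] that by (simp add: ennreal_le_iff)
  qed
  \<comment> \<open>\<open>circ (w n) r\<close> is an area integral over the disc of radius \<open>r\<close>, hence nondecreasing in \<open>r\<close>.\<close>
  note sandwich = ln_scale_bounds_by_derivative[OF _ _ _ du wmono]
  have cf: "continuous_on (ball 0 1) (\<lambda>z. cmod (f z))"
    by (intro continuous_intros holomorphic_on_imp_continuous_on f)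
  have pos: "(cmod (f z))\<^sup>2 + e n > 0" for z n using e(1)[of n] by (simp add: add_nonneg_pos)
  then have ne: "(cmod (f z))\<^sup>2 + e n \<noteq> 0" for z n by (metis less_irrefl)
  have cu: "continuous_on (ball 0 1) (u n)" for n
    unfolding u_def by (intro continuous_intros cf) (use ne in auto)
  have limu: "(\<lambda>n. circ (u n) r) \<longlonglongrightarrow> circ (\<lambda>z. cmod (f z) powr p) r" if r: "0 \<le> r" "r < 1" for r
  proof -
    obtain B where B: "B > 0" "\<And>z. cmod z \<le> r \<Longrightarrow> cmod (f z) \<le> B" using bounded_on_cball[OF f r(2)] by blast
    show ?thesis
    proof (rule tendsto_circ[OF cu r])
      fix n z assume z: "cmod z = r"
      have "(cmod (f z))\<^sup>2 + e n \<le> B\<^sup>2 + 1" using B(2)[of z] e(2)[of n] z by (intro add_mono power_mono) auto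
      then show "\<bar>u n z\<bar> \<le> (B\<^sup>2 + 1) powr q" unfolding u_def using q pos[of z n] by (auto intro: powr_mono2)
    next
      fix z
      have "(\<lambda>n. ((cmod (f z))\<^sup>2 + e n) powr q) \<longlonglongrightarrow> ((cmod (f z))\<^sup>2 + 0) powr q"
        using q e by (intro tendsto_powr' tendsto_intros e0) (auto simp: less_imp_le add_nonneg_nonneg)
      then show "(\<lambda>n. u n z) \<longlonglongrightarrow> cmod (f z) powr p" by (simp add: u_def powr_half_square q_def)
    qed
  qed
  define h where "h z = (if cmod z < 1 then hs_density p f z else 0)" for z
  have [measurable]: "h \<in> borel_measurable borel" unfolding h_def by (rule measurable_hs_density[OF f])
  define k' where "k' n z = (if cmod z < 1 then k n z else 0)" for n z
  have f': "deriv f holomorphic_on ball 0 1" using f by (simp add: holomorphic_deriv)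
  have ck: "continuous_on (ball 0 1) (k n)" for n
    unfolding k_def hs_kernel_def using ne f'
    by (auto intro!: continuous_intros cf holomorphic_on_imp_continuous_on)
  have [measurable]: "k' n \<in> borel_measurable borel" for n
    unfolding k'_def by (rule measurable_if_continuous_on_ball[OF ck])
  have mass: "ennreal (p\<^sup>2) * hs_mass p f r = (\<integral>\<^sup>+ z. ennreal (p\<^sup>2 * h z) * indicator (ball 0 r) z \<partial>lborel)" if "r < 1" for r
  proof -
    have "hs_mass p f r = (\<integral>\<^sup>+ z. ennreal (h z) * indicator (ball 0 r) z \<partial>lborel)"
      unfolding hs_mass_def using that by (intro nn_integral_cong) (auto simp: h_def split: split_indicator)
    then show ?thesis
      by (simp add: nn_integral_cmult[symmetric] ennreal_mult' mult.assoc)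
  qed
  have wk': "ennreal (circ (w n) r) = (\<integral>\<^sup>+ z. ennreal (k' n z) * indicator (ball 0 r) z \<partial>lborel)" if "0 < r" "r < 1" for n r
    unfolding wk[OF that] using that by (intro nn_integral_cong) (auto simp: k'_def split: split_indicator)
  have lim: "AE z in lborel. (\<lambda>n. ennreal (k' n z) * indicator (ball 0 r) z) \<longlonglongrightarrow> ennreal (p\<^sup>2 * h z) * indicator (ball 0 r) z"
    if r: "r < 1" for r
    using AE_nonzero_or_deriv_zero[OF f]
  proof eventually_elim
    case (elim z)
    show ?case
    proof (cases "cmod z < r")
      case True
      have "(\<lambda>n. k' n z) \<longlonglongrightarrow> p\<^sup>2 * h z"
      proof (cases "f z = 0")
        case True
        then show ?thesis using elim r \<open>cmod z < r\<close> by (simp add: k'_def h_def k_def hs_density_def)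
      next
        case False
        have "(\<lambda>n. k n z) \<longlonglongrightarrow> (cmod (deriv f z))\<^sup>2 * (4 * q * ((cmod (f z))\<^sup>2 + 0) powr (q - 2) * (q * (cmod (f z))\<^sup>2 + 0))"
          unfolding k_def hs_kernel_def using False by (intro tendsto_intros e0) auto
        also have "(cmod (deriv f z))\<^sup>2 * (4 * q * ((cmod (f z))\<^sup>2 + 0) powr (q - 2) * (q * (cmod (f z))\<^sup>2 + 0))
          = p\<^sup>2 * ((((cmod (f z))\<^sup>2) powr (q - 2) * ((cmod (f z))\<^sup>2) powr 1) * (cmod (deriv f z))\<^sup>2)"
          by (simp add: q_def power2_eq_square)
        also have "((cmod (f z))\<^sup>2) powr (q - 2) * ((cmod (f z))\<^sup>2) powr 1 = cmod (f z) powr (p - 2)"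
          unfolding powr_add[symmetric] using powr_half_square[of "cmod (f z)" "p - 2"] by (simp add: q_def diff_divide_distrib)
        finally show ?thesis using r \<open>cmod z < r\<close> by (simp add: k'_def h_def hs_density_def)
      qed
      then show ?thesis using True by (auto intro: tendsto_ennrealI)
    qed simp
  qed
  have ubound: "circ (u n) s \<ge> 0" if "0 \<le> s" "s < 1" for n s
    by (rule circ_nonneg[OF cu]) (use that in \<open>auto simp: u_def\<close>)
  have fin: "hs_mass p f a < \<infinity>" if ab: "0 < a" "a < b" "b < 1" for a b
  proof -
    have l: "ln b - ln a > 0" using ab by simp
    have "Bseq (\<lambda>n. circ (u n) b)" using limu[of b] ab by (intro convergent_imp_Bseq convergentI) auto
    then obtain C where C: "C > 0" "\<And>n. \<bar>circ (u n) b\<bar> \<le> C" by (auto simp: Bseq_def)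
    have bd: "ennreal (circ (w n) a) \<le> ennreal (C / (ln b - ln a))" for n
    proof -
      have "circ (w n) a * (ln b - ln a) \<le> C"
        using sandwich(1)[OF ab, of n] C(2)[of n] ubound[of a n] ab by linarith
      then show ?thesis using l by (intro ennreal_leI) (simp add: pos_le_divide_eq)
    qed
    have "ennreal (p\<^sup>2) * hs_mass p f a = (\<integral>\<^sup>+ z. liminf (\<lambda>n. ennreal (k' n z) * indicator (ball 0 a) z) \<partial>lborel)"
      unfolding mass[of a, OF less_trans[OF ab(2,3)]]
      by (rule nn_integral_cong_AE, rule eventually_mono[OF lim[of a, OF less_trans[OF ab(2,3)]]])
         (rule lim_imp_Liminf[symmetric, OF sequentially_bot])
    also have "\<dots> \<le> liminf (\<lambda>n. ennreal (circ (w n) a))"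
      using ab by (subst wk') (auto intro!: nn_integral_liminf)
    also have "\<dots> \<le> liminf (\<lambda>n. ennreal (C / (ln b - ln a)))" by (intro Liminf_mono always_eventually allI bd)
    also have "\<dots> < \<infinity>" by (simp add: Liminf_const)
    finally show ?thesis using p by (auto simp: ennreal_mult_less_top less_top)
  qed
  have limw: "(\<lambda>n. circ (w n) r) \<longlonglongrightarrow> p\<^sup>2 * enn2real (hs_mass p f r)" if r: "0 < r" "r < 1" and fr: "hs_mass p f r < \<infinity>" for r
  proof -
    obtain B where B: "B > 0" "\<And>z. cmod z \<le> r \<Longrightarrow> cmod (f z) \<le> B" using bounded_on_cball[OF f r(2)] by blast
    obtain B' where B': "B' > 0" "\<And>z. cmod z \<le> r \<Longrightarrow> cmod (deriv f z) \<le> B'" using bounded_on_cball[OF f' r(2)] by blast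
    define C where "C = 4 * q * max q 1"
    have C: "C > 0" using q by (auto simp: C_def)
    define dom where "dom z = C * h z + C * B'\<^sup>2 * (B\<^sup>2 + 1) powr (q - 1)" for z
    have h0: "0 \<le> h z" for z by (simp add: h_def hs_density_nonneg)
    have dom0: "0 \<le> dom z" for z unfolding dom_def using C h0[of z] by (intro add_nonneg_nonneg mult_nonneg_nonneg) auto
    have [measurable]: "dom \<in> borel_measurable borel" unfolding dom_def by measurable
    have "(\<lambda>n. \<integral>\<^sup>+ z. ennreal (k' n z) * indicator (ball 0 r) z \<partial>lborel) \<longlonglongrightarrow>
       (\<integral>\<^sup>+ z. ennreal (p\<^sup>2 * h z) * indicator (ball 0 r) z \<partial>lborel)"
    proof (rule nn_integral_dominated_convergence[where w = "\<lambda>z. ennreal (dom z) * indicator (ball 0 r) z"])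
      fix n
      show "AE z in lborel. ennreal (k' n z) * indicator (ball 0 r) z \<le> ennreal (dom z) * indicator (ball 0 r) z"
        using AE_nonzero_or_deriv_zero[OF f]
      proof eventually_elim
        case (elim z)
        have "k' n z \<le> dom z" if z: "cmod z < r"
        proof (cases "deriv f z = 0")
          case True
          then show ?thesis using dom0[of z] z by (simp add: k'_def k_def)
        next
          case False
          then have fz: "cmod (f z) > 0" using elim z r by auto
          have "k' n z \<le> (cmod (deriv f z))\<^sup>2 * (C * ((cmod (f z))\<^sup>2 + e n) powr (q - 1))"
            using hs_kernel_bounds(2)[of "(cmod (f z))\<^sup>2" "e n" q] e q z r
            by (simp add: k'_def k_def C_def mult_left_mono)
          also have "\<dots> \<le> dom z"
          proof (cases "q \<le> 1")
            case True
            have "((cmod (f z))\<^sup>2 + e n) powr (q - 1) \<le> ((cmod (f z))\<^sup>2) powr (q - 1)"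
              using True fz e[of n] by (intro powr_mono2') auto
            also have "\<dots> = cmod (f z) powr (p - 2)"
              using powr_half_square[of "cmod (f z)" "p - 2"] by (simp add: q_def diff_divide_distrib)
            finally have "(cmod (deriv f z))\<^sup>2 * (C * ((cmod (f z))\<^sup>2 + e n) powr (q - 1)) \<le> C * h z"
              using C z r by (simp add: h_def hs_density_def mult_ac mult_left_mono)
            also have "\<dots> \<le> dom z" unfolding dom_def using C by simp
            finally show ?thesis .
          next
            case False
            have "((cmod (f z))\<^sup>2 + e n) powr (q - 1) \<le> (B\<^sup>2 + 1) powr (q - 1)"
              using False e(1)[of n] e(2)[of n] B(2)[of z] z by (intro powr_mono2 add_mono power_mono) auto
            moreover have "(cmod (deriv f z))\<^sup>2 \<le> B'\<^sup>2" using B'(2)[of z] z by (intro power_mono) auto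
            ultimately have "(cmod (deriv f z))\<^sup>2 * (C * ((cmod (f z))\<^sup>2 + e n) powr (q - 1)) \<le> B'\<^sup>2 * (C * (B\<^sup>2 + 1) powr (q - 1))"
              using C by (intro mult_mono) auto
            also have "\<dots> \<le> dom z" unfolding dom_def using C h0[of z] by (simp add: mult_ac)
            finally show ?thesis .
          qed
          finally show ?thesis .
        qed
        then show ?case by (auto split: split_indicator intro: ennreal_leI)
      qed
    next
      have "(\<integral>\<^sup>+z. ennreal (dom z) * indicator (ball 0 r) z \<partial>lborel) =
         (\<integral>\<^sup>+z. ennreal C * (ennreal (h z) * indicator (ball 0 r) z) + ennreal (C * B'\<^sup>2 * (B\<^sup>2 + 1) powr (q - 1)) * indicator (ball 0 r) z \<partial>lborel)"
        using C h0 by (intro nn_integral_cong) (auto simp: dom_def ennreal_mult split: split_indicator)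
      also have "\<dots> = ennreal C * (\<integral>\<^sup>+z. ennreal (h z) * indicator (ball 0 r) z \<partial>lborel) +
          ennreal (C * B'\<^sup>2 * (B\<^sup>2 + 1) powr (q - 1)) * emeasure lborel (ball (0::complex) r)"
        by (simp add: nn_integral_add nn_integral_cmult)
      also have "(\<integral>\<^sup>+z. ennreal (h z) * indicator (ball 0 r) z \<partial>lborel) = hs_mass p f r"
        unfolding hs_mass_def using r by (intro nn_integral_cong) (auto simp: h_def split: split_indicator)
      finally have eq: "(\<integral>\<^sup>+z. ennreal (dom z) * indicator (ball 0 r) z \<partial>lborel) = ennreal C * hs_mass p f r +
          ennreal (C * B'\<^sup>2 * (B\<^sup>2 + 1) powr (q - 1)) * emeasure lborel (ball (0::complex) r)" .
      have "ennreal C * hs_mass p f r < \<infinity>" using fr by (simp add: ennreal_mult_less_top)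
      moreover have "ennreal (C * B'\<^sup>2 * (B\<^sup>2 + 1) powr (q - 1)) * emeasure lborel (ball (0::complex) r) < \<infinity>"
        using emeasure_bounded_finite[of "ball (0::complex) r"] by (simp add: ennreal_mult_less_top)
      ultimately show "(\<integral>\<^sup>+z. ennreal (dom z) * indicator (ball 0 r) z \<partial>lborel) < \<infinity>"
        unfolding eq by (simp only: ennreal_add_less_top infinity_ennreal_def simp_thms)
    next
      show "AE z in lborel. (\<lambda>n. ennreal (k' n z) * indicator (ball 0 r) z) \<longlonglongrightarrow> ennreal (p\<^sup>2 * h z) * indicator (ball 0 r) z"
        by (rule lim[OF r(2)])
    qed measurable
    then have "(\<lambda>n. ennreal (circ (w n) r)) \<longlonglongrightarrow> ennreal (p\<^sup>2) * hs_mass p f r"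
      using r by (simp add: wk' mass)
    also have "ennreal (p\<^sup>2) * hs_mass p f r = ennreal (p\<^sup>2 * enn2real (hs_mass p f r))"
      using fr by (simp add: ennreal_mult ennreal_enn2real)
    finally show ?thesis
      using w0[OF r] by (subst (asm) tendsto_ennreal_iff) auto
  qed
  show fa: "hs_mass p f a < \<infinity>" using fin[OF ab] .
  have U: "(\<lambda>n. circ (u n) b - circ (u n) a) \<longlonglongrightarrow> circ (\<lambda>z. cmod (f z) powr p) b - circ (\<lambda>z. cmod (f z) powr p) a"
    using ab by (intro tendsto_intros limu) auto
  show "p\<^sup>2 * enn2real (hs_mass p f a) * (ln b - ln a) \<le> circ (\<lambda>z. cmod (f z) powr p) b - circ (\<lambda>z. cmod (f z) powr p) a"
    by (rule LIMSEQ_le[OF tendsto_mult[OF limw[OF _ _ fa] tendsto_const] U]) (use sandwich(1)[OF ab] ab in auto)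
  show "circ (\<lambda>z. cmod (f z) powr p) b - circ (\<lambda>z. cmod (f z) powr p) a \<le> p\<^sup>2 * enn2real (hs_mass p f b) * (ln b - ln a)"
    if fb: "hs_mass p f b < \<infinity>"
    by (rule LIMSEQ_le[OF U tendsto_mult[OF limw[OF _ _ fb] tendsto_const]]) (use sandwich(2)[OF ab] ab in auto)
qed

theorem hardy_stein:
  fixes f :: "complex \<Rightarrow> complex"
  assumes f: "f holomorphic_on ball 0 1" and p: "p > 0"
  shows "\<And>r. r < 1 \<Longrightarrow> hs_mass p f r < \<infinity>"
    and "\<And>r. 0 < r \<Longrightarrow> r < 1 \<Longrightarrow> (mean_pow p f has_real_derivative
           p\<^sup>2 / (2 * pi) * enn2real (hs_mass p f r) / r) (at r)"
proof -
  show fin: "hs_mass p f r < \<infinity>" if "r < 1" for r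
  proof -
    have "hs_mass p f r \<le> hs_mass p f (max r (1/2))" by (rule hs_mass_mono) simp
    also have "\<dots> < \<infinity>"
      using hs_limit(1)[OF f p, of "max r (1/2)" "(1 + max r (1/2)) / 2"] that by (simp add: max_def)
    finally show ?thesis .
  qed
  fix r :: real assume r: "0 < r" "r < 1"
  have "(circ (\<lambda>z. cmod (f z) powr p) has_real_derivative p\<^sup>2 * enn2real (hs_mass p f r) / r) (at r)"
    by (rule derivative_from_ln_scale_bounds[where T = "\<lambda>r. p\<^sup>2 * enn2real (hs_mass p f r)"])
       (use hs_limit(2,3)[OF f p] fin isCont_hs_mass[OF f fin r] r in auto)
  then have "((\<lambda>r. circ (\<lambda>z. cmod (f z) powr p) r / (2 * pi)) has_real_derivative
      p\<^sup>2 * enn2real (hs_mass p f r) / r / (2 * pi)) (at r)"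
    by (rule DERIV_cdivide)
  then show "(mean_pow p f has_real_derivative p\<^sup>2 / (2 * pi) * enn2real (hs_mass p f r) / r) (at r)"
    by (simp add: mean_pow_eq_circ[abs_def] mult_ac)
qed

section \<open>Integral means\<close>

context
  fixes f :: "complex \<Rightarrow> complex" and p :: real
  assumes f: "f holomorphic_on ball 0 1" and p: "p > 0"
begin

lemma deriv_mean_pow:
  assumes "0 < r" "r < 1"
  shows "deriv (mean_pow p f) r = p\<^sup>2 / (2 * pi) * enn2real (hs_mass p f r) / r"
  by (rule DERIV_imp_deriv[OF hardy_stein(2)[OF f p assms]])

lemma deriv_mean_pow_nonneg:
  assumes "0 < r" "r < 1"
  shows "0 \<le> deriv (mean_pow p f) r"
  unfolding deriv_mean_pow[OF assms] using assms by (intro divide_nonneg_pos mult_nonneg_nonneg) auto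

lemma mean_pow_has_deriv:
  assumes "0 < r" "r < 1"
  shows "(mean_pow p f has_real_derivative deriv (mean_pow p f) r) (at r)"
  using hardy_stein(2)[OF f p assms] deriv_mean_pow[OF assms] by simp

lemma continuous_on_mean_pow: "continuous_on {0..<1} (mean_pow p f)"
  unfolding mean_pow_eq_circ[abs_def]
  by (intro continuous_intros continuous_on_circ continuous_on_norm_powr f p) auto

lemma continuous_on_deriv_mean_pow: "continuous_on {0<..<1} (deriv (mean_pow p f))"
proof -
  have "continuous_on {0<..<1} (\<lambda>r. p\<^sup>2 / (2 * pi) * enn2real (hs_mass p f r) / r)"
    using isCont_hs_mass[OF f hardy_stein(1)[OF f p]]
    by (intro continuous_intros continuous_at_imp_continuous_on) auto
  then show ?thesis by (rule continuous_on_eq) (simp add: deriv_mean_pow)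
qed

lemma mean_pow_0: "mean_pow p f 0 = cmod (f 0) powr p"
  by (simp add: mean_pow_eq_circ circ_0)

lemma mean_pow_nonneg: "0 \<le> r \<Longrightarrow> r < 1 \<Longrightarrow> 0 \<le> mean_pow p f r"
  unfolding mean_pow_eq_circ
  by (intro divide_nonneg_pos circ_nonneg continuous_on_norm_powr f p) auto

lemma mean_pow_FTC:
  assumes "0 \<le> a" "a \<le> b" "b < 1"
  shows "(deriv (mean_pow p f) has_integral (mean_pow p f b - mean_pow p f a)) {a<..<b}"
proof -
  have "(deriv (mean_pow p f) has_integral (mean_pow p f b - mean_pow p f a)) {a..b}"
  proof (rule fundamental_theorem_of_calculus_interior)
    show "continuous_on {a..b} (mean_pow p f)"
      by (rule continuous_on_subset[OF continuous_on_mean_pow]) (use assms in auto)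
    fix x assume "x \<in> {a<..<b}"
    then show "(mean_pow p f has_vector_derivative deriv (mean_pow p f) x) (at x)"
      using mean_pow_has_deriv[of x] assms
      by (auto simp: has_real_derivative_iff_has_vector_derivative[symmetric])
  qed (use assms in auto)
  then show ?thesis
    using has_integral_open_interval[of "deriv (mean_pow p f)" _ a b] by simp
qed

lemma nn_integral_deriv_mean_pow:
  assumes "0 \<le> a" "a \<le> b" "b < 1"
  shows "(\<integral>\<^sup>+ t \<in> {a<..<b}. ennreal (deriv (mean_pow p f) t) \<partial>lborel) = ennreal (mean_pow p f b - mean_pow p f a)"
  by (rule nn_integral_has_integral_lebesgue'[OF _ mean_pow_FTC[OF assms]])
     (use assms in \<open>auto intro!: deriv_mean_pow_nonneg\<close>)

lemma mean_pow_mono: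
  assumes "0 \<le> a" "a \<le> b" "b < 1"
  shows "mean_pow p f a \<le> mean_pow p f b"
  using has_integral_nonneg[OF mean_pow_FTC[OF assms]] assms deriv_mean_pow_nonneg by auto

lemma subharmonic_circle:
  assumes "0 \<le> r" "r < 1"
  shows "cmod (f 0) powr p \<le> mean_pow p f r"
  using mean_pow_mono[of 0 r] assms by (simp add: mean_pow_0)

lemma circ_powr_eq_mean_pow: "circ (\<lambda>z. cmod (f z) powr p) r = 2 * pi * mean_pow p f r"
  by (simp add: mean_pow_eq_circ)

text \<open>
  Integrating the circle version in polar coordinates; \<open>pi\<close> is the area of the disc.
\<close>
lemma subharmonic_disc:
  "ennreal (pi * cmod (f 0) powr p) \<le> (\<integral>\<^sup>+ z \<in> ball 0 1. ennreal (cmod (f z) powr p) \<partial>lborel)"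
proof -
  have i: "((\<lambda>s. s * (2 * pi * cmod (f 0) powr p)) has_integral pi * cmod (f 0) powr p) {0<..<1}"
  proof -
    have "((\<lambda>s. s * (2 * pi * cmod (f 0) powr p)) has_integral
        (pi * cmod (f 0) powr p * 1\<^sup>2 - pi * cmod (f 0) powr p * 0\<^sup>2)) {0..1}"
      by (rule fundamental_theorem_of_calculus)
        (auto intro!: derivative_eq_intros simp flip: has_real_derivative_iff_has_vector_derivative)
    then show ?thesis
      using has_integral_open_interval[of "\<lambda>s. s * (2 * pi * cmod (f 0) powr p)" _ 0 1] by simp
  qed
  have "ennreal (pi * cmod (f 0) powr p) = (\<integral>\<^sup>+ s \<in> {0<..<1}. ennreal (s * (2 * pi * cmod (f 0) powr p)) \<partial>lborel)"
    by (rule nn_integral_has_integral_lebesgue'[OF _ i, symmetric]) auto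
  also have "\<dots> \<le> (\<integral>\<^sup>+ s \<in> {0<..<1}. ennreal (s * circ (\<lambda>z. cmod (f z) powr p) s) \<partial>lborel)"
    by (intro nn_integral_mono)
       (auto split: split_indicator intro!: ennreal_leI mult_left_mono subharmonic_circle simp: circ_powr_eq_mean_pow)
  also have "\<dots> = (\<integral>\<^sup>+ z \<in> ball 0 1. ennreal (cmod (f z) powr p) \<partial>lborel)"
    by (subst nn_integral_ball_eq_circ) (auto intro!: continuous_on_norm_powr f p)
  finally show ?thesis .
qed

end

section \<open>The spaces in terms of radial integrals\<close>

lemma powr_comparable:
  fixes x y k :: real
  assumes "0 < x" "0 < y" "1 \<le> k" "x \<le> k * y" "y \<le> k * x"
  shows "x powr e \<le> k powr \<bar>e\<bar> * y powr e"
proof (cases "e \<ge> 0")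
  case True
  have "x powr e \<le> (k * y) powr e" using True assms by (intro powr_mono2) auto
  then show ?thesis using True assms by (simp add: powr_mult)
next
  case False
  have "x powr e \<le> (y / k) powr e" using False assms by (intro powr_mono2') (auto simp: pos_divide_le_eq mult.commute)
  also have "\<dots> = k powr \<bar>e\<bar> * y powr e" using False assms by (simp add: powr_divide powr_minus_divide)
  finally show ?thesis .
qed

text \<open>
  The weights in the definitions of the two norms may be replaced by powers of \<open>1 - r\<close>.
\<close>
lemma weight_comparable:
  fixes r e :: real
  assumes "0 \<le> r" "r < 1"
  shows "(1 - r\<^sup>2) powr e \<le> 2 powr \<bar>e\<bar> * (1 - r) powr e" "(1 - r) powr e \<le> 2 powr \<bar>e\<bar> * (1 - r\<^sup>2) powr e"
proof -
  have e: "1 - r\<^sup>2 = (1 - r) * (1 + r)" by (simp add: power2_eq_square algebra_simps)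
  have "(1 - r) * (1 + r) \<le> (1 - r) * 2" "(1 - r) * 1 \<le> (1 - r) * (1 + r)"
    using assms by (intro mult_left_mono; simp)+
  moreover have "0 < 1 - r\<^sup>2" unfolding e using assms by (intro mult_pos_pos) auto
  ultimately show "(1 - r\<^sup>2) powr e \<le> 2 powr \<bar>e\<bar> * (1 - r) powr e" "(1 - r) powr e \<le> 2 powr \<bar>e\<bar> * (1 - r\<^sup>2) powr e"
    using assms by (intro powr_comparable; simp add: e mult.commute)+
qed

lemma nn_integral_finite_compare:
  assumes [measurable]: "g \<in> borel_measurable M" and "C < \<infinity>" "AE x in M. f x \<le> C * g x" "(\<integral>\<^sup>+ x. g x \<partial>M) < \<infinity>"
  shows "(\<integral>\<^sup>+ x. f x \<partial>M) < \<infinity>"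
proof -
  have "(\<integral>\<^sup>+ x. f x \<partial>M) \<le> (\<integral>\<^sup>+ x. C * g x \<partial>M)" by (rule nn_integral_mono_AE) fact
  also have "\<dots> = C * (\<integral>\<^sup>+ x. g x \<partial>M)" by (rule nn_integral_cmult) measurable
  also have "\<dots> < \<infinity>" using assms by (simp add: ennreal_mult_less_top)
  finally show ?thesis .
qed

lemma measurable_indicator_continuous:
  fixes k :: "'a::{topological_space} \<Rightarrow> real"
  assumes "continuous_on A k" "A \<in> sets borel"
  shows "(\<lambda>x. ennreal (k x) * indicator A x) \<in> borel_measurable borel"
proof -
  have "(\<lambda>x. indicator A x *\<^sub>R k x) \<in> borel_measurable borel"
    using assms by (intro borel_measurable_continuous_on_indicator)
  then have "(\<lambda>x. ennreal (indicator A x *\<^sub>R k x)) \<in> borel_measurable borel" by measurable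
  also have "(\<lambda>x. ennreal (indicator A x *\<^sub>R k x)) = (\<lambda>x. ennreal (k x) * indicator A x)"
    by (auto simp: fun_eq_iff split: split_indicator)
  finally show ?thesis .
qed

lemma weighted_integral_finite_iff:
  fixes \<rho> d :: "'a \<Rightarrow> real"
  assumes m1: "(\<lambda>x. ennreal (d x * (1 - (\<rho> x)\<^sup>2) powr e) * indicator A x) \<in> borel_measurable M"
    and m2: "(\<lambda>x. ennreal (d x * (1 - \<rho> x) powr e) * indicator A x) \<in> borel_measurable M"
    and d: "\<And>x. x \<in> A \<Longrightarrow> 0 \<le> d x" and \<rho>: "\<And>x. x \<in> A \<Longrightarrow> 0 \<le> \<rho> x" "\<And>x. x \<in> A \<Longrightarrow> \<rho> x < 1"
  shows "(\<integral>\<^sup>+ x \<in> A. ennreal (d x * (1 - (\<rho> x)\<^sup>2) powr e) \<partial>M) < \<infinity> \<longleftrightarrow>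
    (\<integral>\<^sup>+ x \<in> A. ennreal (d x * (1 - \<rho> x) powr e) \<partial>M) < \<infinity>" (is "?I < \<infinity> \<longleftrightarrow> ?J < \<infinity>")
proof
  note w = weight_comparable[OF \<rho>, of _ e]
  show "?J < \<infinity>" if "?I < \<infinity>"
    by (rule nn_integral_finite_compare[OF m1 _ _ that, where C = "ennreal (2 powr \<bar>e\<bar>)"])
       (use d w(2) in \<open>auto split: split_indicator simp: ennreal_mult[symmetric] mult.left_commute
          intro!: AE_I2 ennreal_leI mult_left_mono\<close>)
  show "?I < \<infinity>" if "?J < \<infinity>"
    by (rule nn_integral_finite_compare[OF m2 _ _ that, where C = "ennreal (2 powr \<bar>e\<bar>)"])
       (use d w(1) in \<open>auto split: split_indicator simp: ennreal_mult[symmetric] mult.left_commute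
          intro!: AE_I2 ennreal_leI mult_left_mono\<close>)
qed

lemma mem_A_space_iff:
  assumes p: "p > 0"
  shows "f \<in> A_space \<alpha> p \<longleftrightarrow> f holomorphic_on ball 0 1 \<and>
    (\<integral>\<^sup>+ r \<in> {0<..<1}. ennreal (deriv (mean_pow p f) r * (1 - r) powr (\<alpha> - 1)) \<partial>lborel) < \<infinity>"
proof (cases "f holomorphic_on ball 0 1")
  case True
  define d where "d = deriv (mean_pow p f)"
  have d: "continuous_on {0<..<1} d" "\<And>r. 0 < r \<Longrightarrow> r < 1 \<Longrightarrow> 0 \<le> d r"
    unfolding d_def using continuous_on_deriv_mean_pow[OF True p] deriv_mean_pow_nonneg[OF True p] by auto
  let ?I = "\<integral>\<^sup>+ r \<in> {0<..<1}. ennreal (d r * (1 - r\<^sup>2) powr (\<alpha> - 1)) \<partial>lborel"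
  let ?J = "\<integral>\<^sup>+ r \<in> {0<..<1}. ennreal (d r * (1 - r) powr (\<alpha> - 1)) \<partial>lborel"
  have ne: "1 - r\<^sup>2 > 0" if "0 < r" "r < 1" for r :: real
    using that by (simp add: power_less_one_iff abs_square_less_1)
  have m1: "(\<lambda>r. ennreal (d r * (1 - r\<^sup>2) powr (\<alpha> - 1)) * indicator {0<..<1} r) \<in> borel_measurable borel"
    using ne by (intro measurable_indicator_continuous continuous_intros d) (auto simp: less_le)
  have m2: "(\<lambda>r. ennreal (d r * (1 - r) powr (\<alpha> - 1)) * indicator {0<..<1} r) \<in> borel_measurable borel"
    by (intro measurable_indicator_continuous continuous_intros d) auto
  have "?I < \<infinity> \<longleftrightarrow> ?J < \<infinity>"
    by (rule weighted_integral_finite_iff) (use m1 m2 d in auto)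
  then show ?thesis
    using True by (simp add: A_space_def A_norm_pow_def analytic_on_open d_def)
qed (simp add: A_space_def analytic_on_open)

lemma mem_B_space_iff:
  assumes p: "p > 0" and \<alpha>: "\<alpha> + p > 1"
  shows "f \<in> B_space \<alpha> p \<longleftrightarrow> f holomorphic_on ball 0 1 \<and>
    (\<integral>\<^sup>+ z \<in> ball 0 1. ennreal (cmod (deriv f z) powr p * (1 - cmod z) powr (\<alpha> + p - 2)) \<partial>lborel) < \<infinity>"
proof (cases "f holomorphic_on ball 0 1")
  case True
  define e where "e = \<alpha> + p - 2"
  define d where "d z = cmod (deriv f z) powr p" for z
  have d: "continuous_on (ball 0 1) d"
    unfolding d_def using True by (intro continuous_on_norm_powr holomorphic_deriv p) auto
  have d0: "0 \<le> d z" for z by (simp add: d_def)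
  let ?I = "\<integral>\<^sup>+ z \<in> ball 0 1. ennreal (d z * (1 - (cmod z)\<^sup>2) powr e) \<partial>lborel"
  let ?J = "\<integral>\<^sup>+ z \<in> ball 0 1. ennreal (d z * (1 - cmod z) powr e) \<partial>lborel"
  have ne: "1 - r\<^sup>2 > 0" if "0 \<le> r" "r < 1" for r :: real
    using that by (simp add: power_less_one_iff abs_square_less_1)
  have m1: "(\<lambda>z. ennreal (d z * (1 - (cmod z)\<^sup>2) powr e) * indicator (ball 0 1) z) \<in> borel_measurable borel"
  proof (intro measurable_indicator_continuous continuous_intros d ballI)
    fix z :: complex assume "z \<in> ball 0 1"
    then show "1 - (cmod z)\<^sup>2 \<noteq> 0" using ne[of "cmod z"] by simp
  qed auto
  have m2: "(\<lambda>z. ennreal (d z * (1 - cmod z) powr e) * indicator (ball 0 1) z) \<in> borel_measurable borel"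
    by (intro measurable_indicator_continuous continuous_intros d) auto
  have "?I < \<infinity> \<longleftrightarrow> ?J < \<infinity>"
    by (rule weighted_integral_finite_iff) (use m1 m2 d0 in auto)
  moreover have "(\<integral>\<^sup>+ z \<in> ball 0 1. ennreal (d z * (1 - (cmod z)\<^sup>2) powr e) \<partial>area_measure) = ?I / ennreal pi"
  proof -
    have "(\<integral>\<^sup>+ z \<in> ball 0 1. ennreal (d z * (1 - (cmod z)\<^sup>2) powr e) \<partial>area_measure) =
       (\<integral>\<^sup>+ z. ennreal (d z * (1 - (cmod z)\<^sup>2) powr e) * indicator (ball 0 1) z * indicator (ball 0 1) z \<partial>lborel) / emeasure lborel (ball (0::complex) 1)"
      unfolding area_measure_def using m1 by (intro nn_integral_uniform_measure) auto
    also have "(\<lambda>z. ennreal (d z * (1 - (cmod z)\<^sup>2) powr e) * indicator (ball 0 1) z * indicator (ball 0 1) z)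
       = (\<lambda>z. ennreal (d z * (1 - (cmod z)\<^sup>2) powr e) * indicator (ball 0 1) z)"
      by (auto simp: fun_eq_iff split: split_indicator)
    also have "emeasure lborel (ball (0::complex) 1) = ennreal pi"
      by (simp add: emeasure_ball unit_ball_vol_2)
    finally show ?thesis .
  qed
  moreover have "x / ennreal pi < \<infinity> \<longleftrightarrow> x < \<infinity>" for x :: ennreal
    by (cases "x = 0") (simp_all add: divide_ennreal_def inverse_ennreal ennreal_mult_less_top)
  moreover have "ennreal (\<alpha> + p - 1) * x < \<infinity> \<longleftrightarrow> x < \<infinity>" for x :: ennreal
    using \<alpha> by (cases "x = 0") (simp_all add: ennreal_mult_less_top)
  ultimately show ?thesis
    using True by (simp add: B_space_def B_norm_pow_def analytic_on_open d_def e_def)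
qed (simp add: B_space_def analytic_on_open)

lemma besov_integral_polar:
  assumes f: "f holomorphic_on ball 0 1" and p: "p > 0"
  shows "(\<integral>\<^sup>+ z \<in> ball 0 1. ennreal (cmod (deriv f z) powr p * (1 - cmod z) powr e) \<partial>lborel) =
    (\<integral>\<^sup>+ s \<in> {0<..<1}. ennreal (2 * pi * s * (1 - s) powr e * mean_pow p (deriv f) s) \<partial>lborel)"
proof -
  have d: "continuous_on (ball 0 1) (\<lambda>z. cmod (deriv f z) powr p)"
    using f by (intro continuous_on_norm_powr holomorphic_deriv p) auto
  have "(\<integral>\<^sup>+ z \<in> ball 0 1. ennreal (cmod (deriv f z) powr p * (1 - cmod z) powr e) \<partial>lborel) =
    (\<integral>\<^sup>+ s \<in> {0<..<1}. ennreal (s * circ (\<lambda>z. cmod (deriv f z) powr p * (1 - cmod z) powr e) s) \<partial>lborel)"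
    by (rule nn_integral_ball_eq_circ) (auto intro!: continuous_intros d)
  also have "\<dots> = (\<integral>\<^sup>+ s \<in> {0<..<1}. ennreal (2 * pi * s * (1 - s) powr e * mean_pow p (deriv f) s) \<partial>lborel)"
    by (intro nn_integral_cong) (auto simp: mean_pow_eq_circ circ_def mult_ac split: split_indicator)
  finally show ?thesis .
qed

text \<open>
  The integral over all rotations of the point \<open>\<zeta>\<close> only depends on \<open>|\<zeta>|\<close>.
\<close>
lemma circ_rotate:
  assumes k: "continuous_on (ball 0 1) k" and \<zeta>: "cmod \<zeta> < 1"
  shows "integral {0..2*pi} (\<lambda>\<theta>. k (cis \<theta> * \<zeta>)) = circ k (cmod \<zeta>)"
proof -
  define a where "a = Arg2pi \<zeta>"
  define r where "r = cmod \<zeta>"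
  define h where "h \<theta> = k (rcis r \<theta>)" for \<theta>
  have a: "0 \<le> a" "a \<le> 2 * pi" using Arg2pi_ge_0[of \<zeta>] Arg2pi_lt_2pi[of \<zeta>] by (auto simp: a_def)
  have z: "\<zeta> = rcis r a" unfolding a_def r_def rcis_def cis_conv_exp by (simp flip: Arg2pi_eq)
  have ch: "continuous_on T h" for T unfolding h_def using \<zeta> by (intro continuous_on_circle[OF k]) (auto simp: r_def)
  have int: "h integrable_on {x..y}" for x y by (intro integrable_continuous_real ch)
  have per: "h (\<theta> + 2 * pi) = h \<theta>" for \<theta> by (simp add: h_def rcis_def cis.code cos_add sin_add)
  have "integral {0..2*pi} (\<lambda>\<theta>. k (cis \<theta> * \<zeta>)) = integral {0..2*pi} (h \<circ> (+) a)"
  proof (intro integral_cong)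
    fix \<theta> :: real
    have "cis \<theta> * \<zeta> = rcis r (a + \<theta>)" by (simp add: z rcis_def mult_ac flip: cis_mult)
    then show "k (cis \<theta> * \<zeta>) = (h \<circ> (+) a) \<theta>" by (simp add: h_def)
  qed
  also have "\<dots> = integral {0 + a..2*pi + a} h" by (rule integral_shift_Icc_real)
  also have "\<dots> = integral {a..2*pi} h + integral {2*pi..2*pi + a} h"
    using Henstock_Kurzweil_Integration.integral_combine[of a "2*pi" "2*pi + a" h] a int by simp
  also have "integral {2*pi..2*pi + a} h = integral {0..a} h"
    using integral_shift_Icc_real[of 0 a h "2*pi"] by (simp add: o_def per add.commute)
  also have "integral {a..2*pi} h + integral {0..a} h = integral {0..2*pi} h"
    using Henstock_Kurzweil_Integration.integral_combine[of 0 a "2*pi" h] a int by simp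
  finally show ?thesis unfolding circ_def r_def[symmetric] h_def[symmetric] .
qed

section \<open>The case p at least 2\<close>

lemma powr_superadditive:
  fixes x y q :: real
  assumes "x \<ge> 0" "y \<ge> 0" "q \<ge> 1"
  shows "x powr q + y powr q \<le> (x + y) powr q"
proof -
  have a: "z powr q \<le> z * (x + y) powr (q - 1)" if "0 \<le> z" "z \<le> x + y" for z
  proof -
    have "z powr q = z * z powr (q - 1)" using that by (simp add: powr_mult_base)
    also have "\<dots> \<le> z * (x + y) powr (q - 1)" using that assms by (intro mult_left_mono powr_mono2) auto
    finally show ?thesis .
  qed
  have "x powr q + y powr q \<le> x * (x + y) powr (q - 1) + y * (x + y) powr (q - 1)"
    using assms by (intro add_mono a) auto
  also have "\<dots> = (x + y) * (x + y) powr (q - 1)" by (simp add: algebra_simps)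
  also have "\<dots> = (x + y) powr q" using assms by (subst powr_mult_base) auto
  finally show ?thesis .
qed

lemma powr_midpoint_convex:
  fixes x y q :: real
  assumes "x \<ge> 0" "y \<ge> 0" "q \<ge> 1"
  shows "((x + y) / 2) powr q \<le> (x powr q + y powr q) / 2"
proof (cases "x = 0 \<or> y = 0")
  case True
  have "2 powr 1 \<le> 2 powr q" using assms by (intro powr_mono) auto
  then have "z powr q / 2 powr q \<le> z powr q / 2" for z :: real
    by (intro divide_left_mono) auto
  then show ?thesis using True assms by (auto simp: powr_divide)
next
  case False
  then show ?thesis
    using convex_onD[OF powr_convex[OF assms(3)], of "1/2" x y] assms by (simp add: field_simps)
qed

text \<open>
  Clarkson's inequality for numbers follows from the parallelogram law, since \<open>x powr (p/2)\<close> is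
  superadditive and convex.
\<close>
lemma clarkson:
  fixes a b :: complex
  assumes p: "p \<ge> 2"
  shows "cmod ((a + b) / 2) powr p + cmod ((a - b) / 2) powr p \<le> (cmod a powr p + cmod b powr p) / 2"
proof -
  define q where "q = p / 2"
  have q: "q \<ge> 1" using p by (simp add: q_def)
  have *: "cmod z powr p = ((cmod z)\<^sup>2) powr q" for z by (simp add: q_def powr_half_square)
  have par: "(cmod ((a + b) / 2))\<^sup>2 + (cmod ((a - b) / 2))\<^sup>2 = ((cmod a)\<^sup>2 + (cmod b)\<^sup>2) / 2"
    by (simp add: cmod_power2 field_simps) (simp add: power2_eq_square algebra_simps)
  have "cmod ((a + b) / 2) powr p + cmod ((a - b) / 2) powr p \<le> (((cmod a)\<^sup>2 + (cmod b)\<^sup>2) / 2) powr q"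
    unfolding * par[symmetric] using q by (intro powr_superadditive) auto
  also have "\<dots> \<le> (cmod a powr p + cmod b powr p) / 2"
    unfolding * using q by (intro powr_midpoint_convex) auto
  finally show ?thesis .
qed

lemma holomorphic_on_compose_lambda:
  assumes "A holomorphic_on S" "f holomorphic_on T" "\<And>w. w \<in> S \<Longrightarrow> A w \<in> T"
  shows "(\<lambda>w. f (A w)) holomorphic_on S"
  using holomorphic_on_compose_gen[OF assms(1,2)] assms(3) by (simp add: o_def image_subset_iff)

text \<open>
  Clarkson's inequality for \<open>a = F z\<close> and \<open>b = F 0\<close>, integrated over the circle.  The
  mean of \<open>|(F z + F 0)/2|^p\<close> is at least \<open>|F 0|^p\<close>, and that of \<open>|(F z - F 0)/z|^p\<close> is
  at least \<open>|F' 0|^p\<close>, by subharmonicity.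
\<close>
lemma mean_pow_growth_lower:
  assumes F: "F holomorphic_on ball 0 1" and p: "p \<ge> 2" and r: "0 < r" "r < 1"
  shows "2 * (r / 2) powr p * cmod (deriv F 0) powr p \<le> mean_pow p F r - cmod (F 0) powr p"
proof -
  have p0: "p > 0" using p by simp
  define G where "G z = (F z + F 0) / 2" for z
  define g where "g z = (if z = 0 then deriv F 0 else (F z - F 0) / (z - 0))" for z
  have G: "G holomorphic_on ball 0 1" unfolding G_def by (intro holomorphic_intros F) auto
  have g: "g holomorphic_on ball 0 1" unfolding g_def by (rule pole_lemma_open[OF F open_ball])
  have "cmod (F 0) powr p \<le> mean_pow p G r" using subharmonic_circle[OF G p0, of r] r by (simp add: G_def)
  moreover have "(r / 2) powr p * cmod (deriv F 0) powr p \<le> (r / 2) powr p * mean_pow p g r"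
    using subharmonic_circle[OF g p0, of r] r by (intro mult_left_mono) (auto simp: g_def)
  moreover have "mean_pow p G r + (r / 2) powr p * mean_pow p g r \<le> (mean_pow p F r + cmod (F 0) powr p) / 2"
  proof -
    have i1: "((\<lambda>\<theta>. cmod (G (rcis r \<theta>)) powr p) has_integral 2 * pi * mean_pow p G r) {0..2*pi}"
      and i2: "((\<lambda>\<theta>. cmod (g (rcis r \<theta>)) powr p) has_integral 2 * pi * mean_pow p g r) {0..2*pi}"
      and i3: "((\<lambda>\<theta>. cmod (F (rcis r \<theta>)) powr p) has_integral 2 * pi * mean_pow p F r) {0..2*pi}"
      using r unfolding circ_powr_eq_mean_pow[OF F p0, symmetric] circ_powr_eq_mean_pow[OF G p0, symmetric] circ_powr_eq_mean_pow[OF g p0, symmetric]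
      by (auto intro!: circ_has_integral[of "\<lambda>z. cmod (F z) powr p"] circ_has_integral[of "\<lambda>z. cmod (G z) powr p"]
          circ_has_integral[of "\<lambda>z. cmod (g z) powr p"] continuous_on_norm_powr F G g p0)
    have i4: "((\<lambda>\<theta>. cmod (F 0) powr p) has_integral 2 * pi * cmod (F 0) powr p) {0..2*pi}"
      using has_integral_const_real[of "cmod (F 0) powr p" 0 "2*pi"] by simp
    have "2 * pi * mean_pow p G r + (r / 2) powr p * (2 * pi * mean_pow p g r)
       \<le> (2 * pi * mean_pow p F r + 2 * pi * cmod (F 0) powr p) / 2"
    proof (rule has_integral_le[OF has_integral_add[OF i1 has_integral_mult_right[OF i2]] has_integral_divide[OF has_integral_add[OF i3 i4]]])
      fix \<theta> :: real
      let ?z = "rcis r \<theta>"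
      have "?z \<noteq> 0" using r by simp
      then have "(r / 2) powr p * cmod (g ?z) powr p = cmod ((F ?z - F 0) / 2) powr p"
        using r by (simp add: g_def norm_divide powr_mult[symmetric])
      then show "cmod (G ?z) powr p + (r / 2) powr p * cmod (g ?z) powr p \<le> (cmod (F ?z) powr p + cmod (F 0) powr p) / 2"
        using clarkson[OF p, of "F ?z" "F 0"] by (simp add: G_def)
    qed
    then have "2 * pi * (mean_pow p G r + (r / 2) powr p * mean_pow p g r) \<le> 2 * pi * ((mean_pow p F r + cmod (F 0) powr p) / 2)"
      by (simp add: algebra_simps)
    then show ?thesis using pi_gt_zero by (subst (asm) mult_le_cancel_left_pos) auto
  qed
  ultimately show ?thesis by simp
qed

text \<open>
  The preceding lemma is applied on the circles of radius \<open>(1 - r)/2\<close> about the points of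
  \<open>|z| = r\<close>.  All of them are rotations of one circle, whose points \<open>z \<phi>\<close> have modulus at most
  \<open>(1 + r)/2\<close>.  Averaging over the centres first therefore produces values of the
  increasing function \<open>mean_pow p f\<close> at radii at most \<open>(1 + r)/2\<close>.
\<close>
lemma deriv_mean_pow_le:
  assumes f: "f holomorphic_on ball 0 1" and p: "p \<ge> 2" and r: "0 < r" "r < 1"
  shows "2 * ((1 - r) / 4) powr p * mean_pow p (deriv f) r \<le> mean_pow p f ((1 + r) / 2) - mean_pow p f r"
proof -
  have p0: "p > 0" using p by simp
  define k where "k z = cmod (f z) powr p" for z
  have k: "continuous_on (ball 0 1) k" unfolding k_def by (rule continuous_on_norm_powr[OF f p0])
  have f': "deriv f holomorphic_on ball 0 1" using f by (simp add: holomorphic_deriv)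
  have kc: "circ k s = 2 * pi * mean_pow p f s" for s
    unfolding k_def by (rule circ_powr_eq_mean_pow[OF f p0])
  define z where "z \<phi> = of_real r + of_real (1 - r) * rcis (1/2) \<phi>" for \<phi>
  have z: "cmod (z \<phi>) \<le> (1 + r) / 2" for \<phi>
  proof -
    have "cmod (z \<phi>) \<le> cmod (of_real r) + cmod (of_real (1 - r) * rcis (1/2) \<phi>)" unfolding z_def by (rule norm_triangle_ineq)
    also have "\<dots> = (1 + r) / 2" using r by (simp only: norm_mult norm_of_real complex_mod_rcis) (simp add: field_simps)
    finally show ?thesis .
  qed
  have z1: "cmod (z \<phi>) < 1" for \<phi> using z[of \<phi>] r by simp
  have zc: "continuous_on S z" for S unfolding z_def by (intro continuous_intros)
  have "continuous_on (cbox (0, 0) (2*pi, 2*pi)) (\<lambda>(\<theta>, \<phi>). k (cis \<theta> * z \<phi>))"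
    unfolding split_beta
    by (rule continuous_on_compose2[OF k]) (auto intro!: continuous_intros continuous_on_compose2[OF zc[of UNIV]] simp: norm_mult z1)
  note swap = integral_swap_continuous[OF this]
  have local: "k (rcis r \<theta>) + 2 * ((1 - r) / 4) powr p * cmod (deriv f (rcis r \<theta>)) powr p
      \<le> integral {0..2*pi} (\<lambda>\<phi>. k (cis \<theta> * z \<phi>)) / (2 * pi)" for \<theta>
  proof -
    define A where "A w = cis \<theta> * (of_real r + of_real (1 - r) * w)" for w
    have A: "A w \<in> ball 0 1" if "w \<in> ball 0 1" for w
    proof -
      have "cmod (A w) = cmod (of_real r + of_real (1 - r) * w)" by (simp add: A_def norm_mult)
      also have "\<dots> \<le> cmod (of_real r) + cmod (of_real (1 - r) * w)" by (rule norm_triangle_ineq)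
      also have "\<dots> = r + (1 - r) * cmod w" using r by (simp only: norm_mult norm_of_real)
      also have "\<dots> < r + (1 - r) * 1" using that r by (intro add_strict_left_mono mult_strict_left_mono) auto
      finally show ?thesis by simp
    qed
    define F where "F w = f (A w)" for w
    have Ah: "A holomorphic_on ball 0 1" unfolding A_def by (intro holomorphic_intros)
    have F: "F holomorphic_on ball 0 1"
      unfolding F_def using A by (rule holomorphic_on_compose_lambda[OF Ah f])
    have A0: "A 0 = rcis r \<theta>" by (simp add: A_def rcis_def mult.commute)
    have "(A has_field_derivative cis \<theta> * of_real (1 - r)) (at 0)"
      unfolding A_def by (auto intro!: derivative_eq_intros)
    moreover have "(f has_field_derivative deriv f (A 0)) (at (A 0))"
      using r A[of 0] by (intro holomorphic_derivI[OF f]) auto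
    ultimately have "(F has_field_derivative deriv f (A 0) * (cis \<theta> * of_real (1 - r))) (at 0)"
      unfolding F_def by (rule DERIV_chain2[rotated])
    then have "deriv F 0 = deriv f (A 0) * (cis \<theta> * of_real (1 - r))" by (rule DERIV_imp_deriv)
    then have dF: "cmod (deriv F 0) powr p = cmod (deriv f (rcis r \<theta>)) powr p * (1 - r) powr p"
      using r by (simp only: norm_mult norm_cis norm_of_real A0) (simp add: powr_mult)
    have "2 * ((1 - r) / 4) powr p * cmod (deriv f (rcis r \<theta>)) powr p = 2 * ((1/2) / 2) powr p * cmod (deriv F 0) powr p"
      unfolding dF using r by (simp add: powr_divide)
    also have "\<dots> \<le> mean_pow p F (1/2) - cmod (F 0) powr p"
      by (rule mean_pow_growth_lower[OF F p]) auto
    also have "cmod (F 0) powr p = k (rcis r \<theta>)" by (simp add: F_def A0 k_def)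
    also have "mean_pow p F (1/2) = integral {0..2*pi} (\<lambda>\<phi>. k (cis \<theta> * z \<phi>)) / (2 * pi)"
      by (simp add: mean_pow_def F_def k_def A_def z_def)
    finally show ?thesis by simp
  qed
  have inner: "continuous_on {0..2*pi} (\<lambda>\<theta>. integral {0..2*pi} (\<lambda>\<phi>. k (cis \<theta> * z \<phi>)))"
    using integral_continuous_on_param[of "{0..2*pi}" 0 "2*pi" "\<lambda>\<theta> \<phi>. k (cis \<theta> * z \<phi>)"]
      \<open>continuous_on (cbox (0, 0) (2*pi, 2*pi)) (\<lambda>(\<theta>, \<phi>). k (cis \<theta> * z \<phi>))\<close>
    by (simp add: cbox_Pair_eq)
  define I where "I = integral {0..2*pi} (\<lambda>\<theta>. integral {0..2*pi} (\<lambda>\<phi>. k (cis \<theta> * z \<phi>)))"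
  have "circ k r + 2 * ((1 - r) / 4) powr p * circ (\<lambda>z. cmod (deriv f z) powr p) r \<le> I / (2 * pi)"
  proof (rule has_integral_le)
    show "((\<lambda>\<theta>. k (rcis r \<theta>) + 2 * ((1 - r) / 4) powr p * cmod (deriv f (rcis r \<theta>)) powr p) has_integral
       circ k r + 2 * ((1 - r) / 4) powr p * circ (\<lambda>z. cmod (deriv f z) powr p) r) {0..2*pi}"
      using r by (intro has_integral_add has_integral_mult_right circ_has_integral k continuous_on_norm_powr f' p0) auto
    show "((\<lambda>\<theta>. integral {0..2*pi} (\<lambda>\<phi>. k (cis \<theta> * z \<phi>)) / (2 * pi)) has_integral I / (2 * pi)) {0..2*pi}"
      unfolding I_def by (intro has_integral_divide integrable_integral integrable_continuous_real inner)
  qed (rule local)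
  also have "I = integral {0..2*pi} (\<lambda>\<phi>. circ k (cmod (z \<phi>)))"
    unfolding I_def using swap by (simp add: circ_rotate[OF k z1])
  also have "\<dots> \<le> integral {0..2*pi} (\<lambda>\<phi>. circ k ((1 + r) / 2))"
  proof (rule integral_le)
    show "(\<lambda>\<phi>. circ k (cmod (z \<phi>))) integrable_on {0..2*pi}"
      by (intro integrable_continuous_real continuous_on_compose2[OF continuous_on_circ[OF k]])
         (auto intro!: continuous_intros zc simp: z1)
    fix \<phi>
    show "circ k (cmod (z \<phi>)) \<le> circ k ((1 + r) / 2)"
      unfolding k_def circ_powr_eq_mean_pow[OF f p0]
      using mean_pow_mono[OF f p0, of "cmod (z \<phi>)" "(1 + r) / 2"] z[of \<phi>] r by simp
  qed auto
  also have "\<dots> = 2 * pi * circ k ((1 + r) / 2)" by simp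
  finally have "circ k r + 2 * ((1 - r) / 4) powr p * circ (\<lambda>z. cmod (deriv f z) powr p) r \<le> circ k ((1 + r) / 2)"
    by (simp add: divide_right_mono)
  then have "2 * pi * (mean_pow p f r + 2 * ((1 - r) / 4) powr p * mean_pow p (deriv f) r) \<le> 2 * pi * mean_pow p f ((1 + r) / 2)"
    unfolding kc circ_powr_eq_mean_pow[OF f' p0] by (simp add: algebra_simps)
  then have "mean_pow p f r + 2 * ((1 - r) / 4) powr p * mean_pow p (deriv f) r \<le> mean_pow p f ((1 + r) / 2)"
    using pi_gt_zero by (subst (asm) mult_le_cancel_left_pos) auto
  then show ?thesis by simp
qed

text \<open>
  By \<open>deriv_mean_pow_le\<close> the integral in the B-norm is at most a constant times that of \<open>M'(t) (1-s)^(\<alpha>-2)\<close> over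
  \<open>s < t < (1+s)/2\<close>.  For fixed \<open>t\<close> the range of \<open>s\<close> has length at most \<open>1 - t\<close>, and there
  \<open>1 - s\<close> is comparable to \<open>1 - t\<close>.
\<close>
theorem A_space_subset_B_space:
  assumes p: "p \<ge> 2" and \<alpha>: "\<alpha> > 0"
  shows "A_space \<alpha> p \<subseteq> B_space \<alpha> p"
proof
  fix f assume A: "f \<in> A_space \<alpha> p"
  have p0: "p > 0" using p by simp
  have f: "f holomorphic_on ball 0 1"
    and fin: "(\<integral>\<^sup>+ r \<in> {0<..<1}. ennreal (deriv (mean_pow p f) r * (1 - r) powr (\<alpha> - 1)) \<partial>lborel) < \<infinity>"
    using A by (auto simp: mem_A_space_iff[OF p0])
  define d where "d = deriv (mean_pow p f)"
  define d' where "d' t = (if t \<in> {0<..<1} then d t else 0)" for t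
  have [measurable]: "d' \<in> borel_measurable borel"
    unfolding d'_def d_def using continuous_on_deriv_mean_pow[OF f p0]
    by (intro borel_measurable_continuous_on_if) auto
  have d0: "0 \<le> d' t" for t
    unfolding d'_def d_def using deriv_mean_pow_nonneg[OF f p0] by auto
  define K where "K = 2 powr \<bar>\<alpha> - 2\<bar>"
  define C where "C = 2 * pi * (4 powr p / 2)"
  have f': "deriv f holomorphic_on ball 0 1" using f by (simp add: holomorphic_deriv)
  define X where "X s t = ennreal (C * (1 - s) powr (\<alpha> - 2)) * (ennreal (d' t) * indicator {s<..<(1 + s) / 2} t) * indicator {0<..<1} s" for s t
  have [measurable]: "(\<lambda>(s, t). X s t) \<in> borel_measurable (lborel \<Otimes>\<^sub>M lborel)"
  proof -
    have [measurable]: "Measurable.pred (lborel \<Otimes>\<^sub>M lborel) (\<lambda>x::real \<times> real. snd x \<in> {fst x<..<(1 + fst x) / 2})"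
      unfolding greaterThanLessThan_iff by measurable
    have [measurable]: "(\<lambda>x::real \<times> real. indicator {0<..<1} (fst x) :: ennreal) \<in> borel_measurable (lborel \<Otimes>\<^sub>M lborel)"
      by (rule measurable_compose[OF measurable_fst, where g = "indicator {0<..<1}"]) simp
    show ?thesis unfolding X_def split_beta by measurable
  qed
  have "(\<integral>\<^sup>+ z \<in> ball 0 1. ennreal (cmod (deriv f z) powr p * (1 - cmod z) powr (\<alpha> + p - 2)) \<partial>lborel)
      = (\<integral>\<^sup>+ s \<in> {0<..<1}. ennreal (2 * pi * s * (1 - s) powr (\<alpha> + p - 2) * mean_pow p (deriv f) s) \<partial>lborel)"
    by (rule besov_integral_polar[OF f p0])
  also have "\<dots> \<le> (\<integral>\<^sup>+ s. \<integral>\<^sup>+ t. X s t \<partial>lborel \<partial>lborel)"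
  proof (rule nn_integral_mono)
    fix s :: real
    show "ennreal (2 * pi * s * (1 - s) powr (\<alpha> + p - 2) * mean_pow p (deriv f) s) * indicator {0<..<1} s \<le> (\<integral>\<^sup>+ t. X s t \<partial>lborel)"
    proof (cases "s \<in> {0<..<1}")
      case True
      then have s: "0 < s" "s < 1" by auto
      have N0: "0 \<le> mean_pow p (deriv f) s" using mean_pow_nonneg[OF f' p0] s by auto
      have w: "(1 - s) powr (\<alpha> + p - 2) = (1 - s) powr (\<alpha> - 2) * (4 powr p * ((1 - s) / 4) powr p)"
        using s by (simp add: powr_add[symmetric] powr_divide) (simp add: algebra_simps)
      have "2 * pi * s * (1 - s) powr (\<alpha> + p - 2) * mean_pow p (deriv f) s \<le> 2 * pi * 1 * (1 - s) powr (\<alpha> + p - 2) * mean_pow p (deriv f) s"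
        using s N0 by (intro mult_right_mono mult_left_mono) auto
      also have "2 * pi * 1 * (1 - s) powr (\<alpha> + p - 2) * mean_pow p (deriv f) s =
          2 * pi * 1 * ((1 - s) powr (\<alpha> - 2) * (4 powr p * ((1 - s) / 4) powr p)) * mean_pow p (deriv f) s"
        unfolding w ..
      also have "2 * pi * 1 * ((1 - s) powr (\<alpha> - 2) * (4 powr p * ((1 - s) / 4) powr p)) * mean_pow p (deriv f) s = C * (1 - s) powr (\<alpha> - 2) * (2 * ((1 - s) / 4) powr p * mean_pow p (deriv f) s)"
        by (simp add: C_def)
      also have "\<dots> \<le> C * (1 - s) powr (\<alpha> - 2) * (mean_pow p f ((1 + s) / 2) - mean_pow p f s)"
        using s by (intro mult_left_mono deriv_mean_pow_le f p) (auto simp: C_def)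
      finally have key: "2 * pi * s * (1 - s) powr (\<alpha> + p - 2) * mean_pow p (deriv f) s
          \<le> C * (1 - s) powr (\<alpha> - 2) * (mean_pow p f ((1 + s) / 2) - mean_pow p f s)" .
      have "0 \<le> mean_pow p f ((1 + s) / 2) - mean_pow p f s"
        using mean_pow_mono[OF f p0, of s "(1+s)/2"] s by simp
      then have "ennreal (2 * pi * s * (1 - s) powr (\<alpha> + p - 2) * mean_pow p (deriv f) s) \<le>
          ennreal (C * (1 - s) powr (\<alpha> - 2)) * ennreal (mean_pow p f ((1 + s) / 2) - mean_pow p f s)"
        by (subst ennreal_mult''[symmetric]) (auto intro!: ennreal_leI[OF key])
      also have "ennreal (mean_pow p f ((1 + s) / 2) - mean_pow p f s) = (\<integral>\<^sup>+ t \<in> {s<..<(1 + s) / 2}. ennreal (d t) \<partial>lborel)"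
        unfolding d_def using s by (intro nn_integral_deriv_mean_pow[OF f p0, symmetric]) auto
      also have "\<dots> = (\<integral>\<^sup>+ t. ennreal (d' t) * indicator {s<..<(1 + s) / 2} t \<partial>lborel)"
        using s by (intro nn_integral_cong) (auto simp: d'_def split: split_indicator)
      also have "ennreal (C * (1 - s) powr (\<alpha> - 2)) * \<dots> = (\<integral>\<^sup>+ t. X s t \<partial>lborel)"
        using True by (simp add: X_def nn_integral_cmult)
      finally show ?thesis using True by simp
    qed simp
  qed
  also have "\<dots> = (\<integral>\<^sup>+ t. \<integral>\<^sup>+ s. X s t \<partial>lborel \<partial>lborel)"
    by (subst lborel_pair.Fubini') simp_all
  also have "\<dots> < \<infinity>"
  proof (rule nn_integral_finite_compare[where C = "ennreal (C * K)" and g = "\<lambda>t. ennreal (d' t * (1 - t) powr (\<alpha> - 1))"])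
    show "(\<integral>\<^sup>+ t. ennreal (d' t * (1 - t) powr (\<alpha> - 1)) \<partial>lborel) < \<infinity>"
    proof -
      have "(\<integral>\<^sup>+ t. ennreal (d' t * (1 - t) powr (\<alpha> - 1)) \<partial>lborel) =
        (\<integral>\<^sup>+ r \<in> {0<..<1}. ennreal (d r * (1 - r) powr (\<alpha> - 1)) \<partial>lborel)"
        by (intro nn_integral_cong) (auto simp: d'_def split: split_indicator)
      then show ?thesis using fin by (simp add: d_def)
    qed
    show "ennreal (C * K) < \<infinity>" by simp
    show "AE t in lborel. (\<integral>\<^sup>+ s. X s t \<partial>lborel) \<le> ennreal (C * K) * ennreal (d' t * (1 - t) powr (\<alpha> - 1))"
    proof (rule AE_I2)
      fix t :: real
      show "(\<integral>\<^sup>+ s. X s t \<partial>lborel) \<le> ennreal (C * K) * ennreal (d' t * (1 - t) powr (\<alpha> - 1))"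
      proof (cases "t \<in> {0<..<1}")
        case True
        have "(\<integral>\<^sup>+ s. X s t \<partial>lborel) \<le> (\<integral>\<^sup>+ s. ennreal (C * K * (1 - t) powr (\<alpha> - 2) * d' t) * indicator {2 * t - 1<..<t} s \<partial>lborel)"
        proof (rule nn_integral_mono)
          fix s :: real
          show "X s t \<le> ennreal (C * K * (1 - t) powr (\<alpha> - 2) * d' t) * indicator {2 * t - 1<..<t} s"
          proof (cases "s \<in> {0<..<1} \<and> t \<in> {s<..<(1 + s) / 2}")
            case st: True
            then have s: "2 * t - 1 < s" "s < t" by auto
            have "(1 - s) powr (\<alpha> - 2) \<le> K * (1 - t) powr (\<alpha> - 2)"
              unfolding K_def using s True by (intro powr_comparable) auto
            then have "C * (1 - s) powr (\<alpha> - 2) * d' t \<le> C * (K * (1 - t) powr (\<alpha> - 2)) * d' t"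
              using d0 by (intro mult_right_mono mult_left_mono) (auto simp: C_def)
            moreover have "X s t = ennreal (C * (1 - s) powr (\<alpha> - 2) * d' t)"
              using st d0[of t] by (simp add: X_def ennreal_mult'')
            ultimately show ?thesis using st s by (simp add: mult_ac ennreal_leI)
          next
            case False
            then have "X s t = 0" by (auto simp: X_def split: split_indicator)
            then show ?thesis by simp
          qed
        qed
        also have "\<dots> = ennreal (C * K * (1 - t) powr (\<alpha> - 2) * d' t) * ennreal (1 - t)"
          using True by (simp add: nn_integral_cmult)
        also have "\<dots> = ennreal (C * K * (1 - t) powr (\<alpha> - 2) * d' t * (1 - t))"
          using True by (subst ennreal_mult'') auto
        also have "C * K * (1 - t) powr (\<alpha> - 2) * d' t * (1 - t) = C * K * (d' t * ((1 - t) powr (\<alpha> - 2) * (1 - t) powr 1))"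
          using True by simp
        also have "\<dots> = C * K * (d' t * (1 - t) powr (\<alpha> - 1))"
          unfolding powr_add[symmetric] by simp
        finally show ?thesis using d0[of t] by (simp add: ennreal_mult''[symmetric])
      next
        case False
        then have "d' t = 0" by (auto simp: d'_def)
        then have "X s t = 0" for s by (simp add: X_def)
        then show ?thesis by simp
      qed
    qed
  qed measurable
  finally show "f \<in> B_space \<alpha> p" using f p \<alpha> by (subst mem_B_space_iff) auto
qed

section \<open>The case p at most 2\<close>

lemma circle_mean_value:
  assumes F: "F holomorphic_on ball 0 1" and r: "0 < r" "r < 1"
  shows "((\<lambda>\<theta>. F (rcis r \<theta>)) has_integral 2 * of_real pi * F 0) {0..2*pi}"
proof -
  have "F holomorphic_on cball 0 r" by (rule holomorphic_on_subset[OF F]) (use r in auto)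
  then have "((\<lambda>u. F u / (u - 0)) has_contour_integral (2 * of_real pi * \<i> * F 0)) (circlepath 0 r)"
    using r by (intro Cauchy_integral_circlepath_simple) auto
  then have "((\<lambda>t. F (0 + r * cis t) / (0 + r * cis t - 0) * r * \<i> * cis t) has_integral (2 * of_real pi * \<i> * F 0)) {0..2*pi}"
    unfolding circlepath_def by (subst (asm) has_contour_integral_part_circlepath_iff) auto
  moreover have "(\<lambda>t. F (0 + r * cis t) / (0 + r * cis t - 0) * r * \<i> * cis t) = (\<lambda>t. F (rcis r t) * \<i>)"
    using r by (simp add: rcis_def fun_eq_iff)
  ultimately have "((\<lambda>t. F (rcis r t) * \<i>) has_integral (2 * of_real pi * F 0 * \<i>)) {0..2*pi}"
    by (simp only: mult_ac)
  from has_integral_divide[OF this, of \<i>] show ?thesis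
    by (simp only: nonzero_mult_div_cancel_right[OF complex_i_not_zero])
qed

text \<open>
  The graph of a concave power lies below its tangents.  It is obtained from the convexity of the
  power with exponent \<open>1/q\<close>.
\<close>
lemma powr_le_tangent:
  fixes x t q :: real
  assumes "x \<ge> 0" "t > 0" "0 < q" "q \<le> 1"
  shows "x powr q \<le> t powr q + q * t powr (q - 1) * (x - t)"
proof (cases "x = 0")
  case True
  have "t powr (q - 1) * t = t powr q" using assms powr_add[of t "q - 1" 1] by simp
  then have "q * t powr (q - 1) * t = q * t powr q" by simp
  also have "\<dots> \<le> 1 * t powr q" using assms by (intro mult_right_mono) auto
  finally show ?thesis using True by simp
next
  case False
  define u where "u = x / t"
  have u: "u > 0" using False assms by (simp add: u_def)
  have d: "((\<lambda>y. y powr (1/q)) has_real_derivative (1/q) * 1 powr (1/q - 1)) (at 1 within {0<..})"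
    by (rule has_field_derivative_at_within, rule has_real_derivative_powr) simp
  have "(u powr q) powr (1/q) - 1 powr (1/q) \<ge> (1/q) * 1 powr (1/q - 1) * (u powr q - 1)"
    by (rule convex_on_imp_above_tangent[OF powr_convex _ _ _ d]) (use assms u in \<open>auto simp: interior_open\<close>)
  then have "u - 1 \<ge> (u powr q - 1) / q" using u assms by (simp add: powr_powr)
  then have *: "u powr q \<le> 1 + q * (u - 1)" using assms by (simp add: pos_divide_le_eq mult.commute)
  have "x powr q = t powr q * u powr q" using assms by (simp add: u_def powr_divide)
  also have "\<dots> \<le> t powr q * (1 + q * (u - 1))" by (intro mult_left_mono *) auto
  also have "\<dots> = t powr q + q * (t powr q / t) * (x - t)" using assms by (simp add: u_def field_simps)
  also have "t powr q / t = t powr (q - 1)" using assms by (simp add: powr_diff)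
  finally show ?thesis .
qed

text \<open>
  If \<open>|F 0| \<le> B\<close>, then \<open>|F| \<le> 2 B\<close> on the circle.  Otherwise \<open>|F|^p\<close> is bounded by the
  tangent of \<open>x powr (p/2)\<close> at \<open>|F 0|^2\<close>: the term linear in \<open>F z - F 0\<close> has mean 0, and the
  quadratic term is at most \<open>|F 0|^(p-2) B^2 \<le> B^p\<close>.
\<close>
lemma mean_pow_growth_upper:
  assumes F: "F holomorphic_on ball 0 1" and p: "0 < p" "p \<le> 2" and r: "0 < r" "r < 1"
    and B: "B \<ge> 0" "\<And>z. cmod z = r \<Longrightarrow> cmod (F z - F 0) \<le> B"
  shows "mean_pow p F r - cmod (F 0) powr p \<le> 4 * B powr p"
proof -
  define a where "a = F 0"
  define q where "q = p / 2"
  have q: "0 < q" "q \<le> 1" using p by (auto simp: q_def)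
  have iF: "((\<lambda>\<theta>. cmod (F (rcis r \<theta>)) powr p) has_integral 2 * pi * mean_pow p F r) {0..2*pi}"
    unfolding circ_powr_eq_mean_pow[OF F p(1), symmetric] using r
    by (intro circ_has_integral continuous_on_norm_powr F p) auto
  show ?thesis
  proof (cases "cmod a \<le> B")
    case True
    have ic: "((\<lambda>\<theta>. 4 * B powr p) has_integral 2 * pi * (4 * B powr p)) {0..2*pi}"
      using has_integral_const_real[of "4 * B powr p" 0 "2*pi"] by simp
    have "2 * pi * mean_pow p F r \<le> 2 * pi * (4 * B powr p)"
    proof (rule has_integral_le[OF iF ic])
      fix \<theta> :: real
      have "cmod (F (rcis r \<theta>)) \<le> cmod (F (rcis r \<theta>) - a) + cmod a" using norm_triangle_ineq[of "F (rcis r \<theta>) - a" a] by simp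
      also have "\<dots> \<le> 2 * B" using B(2)[of "rcis r \<theta>"] True r by (simp add: a_def)
      finally have "cmod (F (rcis r \<theta>)) powr p \<le> (2 * B) powr p" using p by (intro powr_mono2) auto
      also have "\<dots> = 2 powr p * B powr p" using B by (simp add: powr_mult)
      also have "\<dots> \<le> 2 powr 2 * B powr p" using p by (intro mult_right_mono powr_mono) auto
      finally show "cmod (F (rcis r \<theta>)) powr p \<le> 4 * B powr p" by simp
    qed
    then have "mean_pow p F r \<le> 4 * B powr p" using pi_gt_zero by (subst (asm) mult_le_cancel_left_pos) auto
    then show ?thesis using powr_ge_zero[of "cmod (F 0)" p] by linarith
  next
    case False
    then have a: "cmod a > 0" "B < cmod a" using B by auto
    have a2: "((cmod a)\<^sup>2) powr (q - 1) = cmod a powr (p - 2)"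
      using powr_half_square[of "cmod a" "p - 2"] by (simp add: q_def diff_divide_distrib)
    define b where "b \<theta> = Re (cnj a * (F (rcis r \<theta>) - a))" for \<theta>
    have "((\<lambda>\<theta>. cnj a * (F (rcis r \<theta>) - a)) has_integral cnj a * (2 * of_real pi * F 0 - 2 * of_real pi * a)) {0..2*pi}"
      using has_integral_const_real[of a 0 "2*pi"]
      by (intro has_integral_mult_right has_integral_diff circle_mean_value[OF F r]) (auto simp: scaleR_conv_of_real)
    from has_integral_Re[OF this] have ib: "(b has_integral 0) {0..2*pi}"
      by (simp add: b_def[abs_def] a_def)
    define c where "c = cmod a powr p + q * cmod a powr (p - 2) * B\<^sup>2"
    have ic: "((\<lambda>\<theta>. c + q * cmod a powr (p - 2) * 2 * b \<theta>) has_integral 2 * pi * c + q * cmod a powr (p - 2) * 2 * 0) {0..2*pi}"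
      using has_integral_const_real[of c 0 "2*pi"] by (intro has_integral_add has_integral_mult_right ib) auto
    have "2 * pi * mean_pow p F r \<le> 2 * pi * c + q * cmod a powr (p - 2) * 2 * 0"
    proof (rule has_integral_le[OF iF ic])
      fix \<theta> :: real
      let ?w = "F (rcis r \<theta>) - a"
      have e: "(cmod (F (rcis r \<theta>)))\<^sup>2 - (cmod a)\<^sup>2 = 2 * b \<theta> + (cmod ?w)\<^sup>2"
        by (simp add: b_def cmod_power2) (simp add: power2_eq_square algebra_simps)
      have "cmod (F (rcis r \<theta>)) powr p = ((cmod (F (rcis r \<theta>)))\<^sup>2) powr q" by (simp add: q_def powr_half_square)
      also have "\<dots> \<le> ((cmod a)\<^sup>2) powr q + q * ((cmod a)\<^sup>2) powr (q - 1) * ((cmod (F (rcis r \<theta>)))\<^sup>2 - (cmod a)\<^sup>2)"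
        using a q by (intro powr_le_tangent) auto
      also have "((cmod a)\<^sup>2) powr q = cmod a powr p" by (simp add: q_def powr_half_square)
      finally have "cmod (F (rcis r \<theta>)) powr p \<le> cmod a powr p + q * cmod a powr (p - 2) * (2 * b \<theta> + (cmod ?w)\<^sup>2)"
        unfolding a2 e .
      also have "\<dots> \<le> cmod a powr p + q * cmod a powr (p - 2) * (2 * b \<theta> + B\<^sup>2)"
        using B(2)[of "rcis r \<theta>"] r q by (intro add_left_mono mult_left_mono power_mono) (auto simp: a_def)
      finally show "cmod (F (rcis r \<theta>)) powr p \<le> c + q * cmod a powr (p - 2) * 2 * b \<theta>"
        by (simp add: c_def algebra_simps)
    qed
    then have "2 * pi * mean_pow p F r \<le> 2 * pi * c" by simp
    then have "mean_pow p F r \<le> c" using pi_gt_zero by (subst (asm) mult_le_cancel_left_pos) auto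
    moreover have "q * cmod a powr (p - 2) * B\<^sup>2 \<le> 4 * B powr p"
    proof (cases "B = 0")
      case False
      then have B0: "B > 0" using B by simp
      have "q * cmod a powr (p - 2) * B\<^sup>2 \<le> 1 * B powr (p - 2) * B\<^sup>2"
        using a p q B0 by (intro mult_right_mono mult_mono powr_mono2') auto
      also have "\<dots> = B powr (p - 2) * B powr 2" using B0 by (simp add: powr_numeral)
      also have "\<dots> = B powr p" by (simp flip: powr_add)
      finally show ?thesis by (smt (verit) powr_ge_zero)
    qed (use p in simp)
    ultimately show ?thesis by (simp add: c_def a_def)
  qed
qed

lemma nn_integral_ball_scale:
  fixes t :: complex
  assumes m: "(\<lambda>z. k z * indicator (ball t (c * r)) z) \<in> borel_measurable borel" and c: "c > 0"
  shows "(\<integral>\<^sup>+ z \<in> ball t (c * r). k z \<partial>lborel) = ennreal (c\<^sup>2) * (\<integral>\<^sup>+ w \<in> ball 0 r. k (t + of_real c * w) \<partial>lborel)"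
proof -
  have i: "indicator (ball t (c * r)) (t + of_real c * w) = (indicator (ball 0 r) w :: ennreal)" for w
    using c by (simp add: indicator_def dist_norm norm_mult)
  show ?thesis
    using nn_integral_lborel_scale[OF m, of c t] c by (simp add: i scaleR_conv_of_real)
qed

lemma measurable_norm_powr_indicator:
  assumes g: "g holomorphic_on S" and "p > 0" "open S"
  shows "(\<lambda>z. ennreal (cmod (g z) powr p) * indicator S z) \<in> borel_measurable borel"
  using assms by (intro measurable_indicator_continuous continuous_on_norm_powr) auto

lemma norm_deriv_powr_le_area:
  assumes F: "F holomorphic_on ball 0 1" and p: "p > 0" and w: "cmod w \<le> 1/2"
  shows "ennreal (pi / 4 * cmod (F w) powr p) \<le> (\<integral>\<^sup>+ z \<in> ball 0 1. ennreal (cmod (F z) powr p) \<partial>lborel)"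
proof -
  define G where "G v = F (w + of_real (1/2) * v)" for v
  have inb: "w + of_real (1/2) * v \<in> ball 0 1" if "v \<in> ball 0 1" for v
  proof -
    have "cmod (w + of_real (1/2) * v) \<le> cmod w + cmod (of_real (1/2) * v)" by (rule norm_triangle_ineq)
    also have "\<dots> < 1" using w that by (simp add: norm_mult)
    finally show ?thesis by simp
  qed
  have G: "G holomorphic_on ball 0 1"
    unfolding G_def by (rule holomorphic_on_compose_lambda[OF _ F]) (auto intro!: holomorphic_intros simp: inb[simplified])
  have sub: "ball w (1/2) \<subseteq> ball 0 1"
  proof
    fix z assume "z \<in> ball w (1/2)"
    then show "z \<in> ball 0 1" using w norm_triangle_ineq[of "z - w" w] by (simp add: dist_norm norm_minus_commute)
  qed
  have m: "(\<lambda>z. ennreal (cmod (F z) powr p) * indicator (ball w (1/2 * 1)) z) \<in> borel_measurable borel"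
    using sub by (intro measurable_norm_powr_indicator p holomorphic_on_subset[OF F]) auto
  have "ennreal (pi / 4 * cmod (F w) powr p) = ennreal ((1/2)\<^sup>2) * ennreal (pi * cmod (G 0) powr p)"
    by (simp add: G_def power2_eq_square ennreal_mult[symmetric])
  also have "\<dots> \<le> ennreal ((1/2)\<^sup>2) * (\<integral>\<^sup>+ v \<in> ball 0 1. ennreal (cmod (G v) powr p) \<partial>lborel)"
    by (intro mult_left_mono subharmonic_disc G p) auto
  also have "\<dots> = (\<integral>\<^sup>+ z \<in> ball w (1/2 * 1). ennreal (cmod (F z) powr p) \<partial>lborel)"
    using nn_integral_ball_scale[OF m] by (simp add: G_def)
  also have "\<dots> \<le> (\<integral>\<^sup>+ z \<in> ball 0 1. ennreal (cmod (F z) powr p) \<partial>lborel)"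
    using sub by (intro nn_integral_mono) (auto split: split_indicator)
  finally show ?thesis .
qed

text \<open>
  Let \<open>x\<close> be the integral of \<open>|F'|^p\<close> over the disc.  By subharmonicity \<open>|F'|^p \<le> 2 x\<close> for
  \<open>|z| \<le> 1/2\<close>, which bounds \<open>F - F 0\<close> there and hence the growth of the mean between the radii
  \<open>1/4\<close> and \<open>1/2\<close>; the latter is at least a multiple of \<open>hs_mass p F (1/4)\<close>.
\<close>
lemma hs_mass_le_unit:
  assumes F: "F holomorphic_on ball 0 1" and p: "0 < p" "p \<le> 2"
  shows "hs_mass p F (1/4) \<le> ennreal (32 * pi / p\<^sup>2) * (\<integral>\<^sup>+ z \<in> ball 0 1. ennreal (cmod (deriv F z) powr p) \<partial>lborel)"
    (is "_ \<le> _ * ?X")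
proof (cases "?X = \<infinity>")
  case True
  then show ?thesis using p by (simp add: ennreal_mult_top)
next
  case False
  then obtain x where x: "?X = ennreal x" "x \<ge> 0" by (cases ?X) auto
  have F': "deriv F holomorphic_on ball 0 1" using F by (simp add: holomorphic_deriv)
  define B where "B = (2 * x) powr (1/p)"
  have B: "B \<ge> 0" "B powr p = 2 * x" using x p by (auto simp: B_def powr_powr)
  have dB: "cmod (deriv F w) \<le> B" if "cmod w \<le> 1/2" for w
  proof -
    have "pi / 4 * cmod (deriv F w) powr p \<le> x"
      using norm_deriv_powr_le_area[OF F' p(1) that] x by (simp add: ennreal_le_iff)
    moreover have "1 / 2 * cmod (deriv F w) powr p \<le> pi / 4 * cmod (deriv F w) powr p"
      using pi_gt3 by (intro mult_right_mono) auto
    ultimately have le: "cmod (deriv F w) powr p \<le> B powr p" unfolding B(2) by linarith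
    show ?thesis
    proof (rule ccontr)
      assume "\<not> cmod (deriv F w) \<le> B"
      then have "B < cmod (deriv F w)" by simp
      from powr_less_mono2[OF p(1) B(1) this] le show False by simp
    qed
  qed
  have "cmod (F z - F 0) \<le> B" if z: "cmod z = 1/2" for z
  proof -
    have "cmod (F z - F 0) \<le> B * cmod (z - 0)"
    proof (rule field_differentiable_bound[of "cball 0 (1/2)"])
      fix w :: complex assume "w \<in> cball 0 (1/2)"
      then show "(F has_field_derivative deriv F w) (at w within cball 0 (1/2))"
        by (intro has_field_derivative_at_within[OF holomorphic_derivI[OF F]]) auto
      show "cmod (deriv F w) \<le> B" using dB \<open>w \<in> cball 0 (1/2)\<close> by auto
    qed (use z in auto)
    then show ?thesis using z B by simp
  qed
  then have "mean_pow p F (1/2) - cmod (F 0) powr p \<le> 4 * B powr p"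
    by (intro mean_pow_growth_upper F p B) auto
  moreover have "cmod (F 0) powr p \<le> mean_pow p F (1/4)" by (rule subharmonic_circle[OF F p(1)]) auto
  ultimately have g: "mean_pow p F (1/2) - mean_pow p F (1/4) \<le> 8 * x" unfolding B by simp
  have l: "ln (1/2) - ln (1/4 :: real) \<ge> 1/2"
  proof -
    have "ln (4::real) = 2 * ln 2" using ln_realpow[of 2 2] by simp
    then have "ln (1/2) - ln (1/4 :: real) = ln 2" by (simp add: ln_div)
    then show ?thesis using ln2_ge_two_thirds by linarith
  qed
  define m where "m = enn2real (hs_mass p F (1/4))"
  have m: "hs_mass p F (1/4) = ennreal m" using hardy_stein(1)[OF F p(1), of "1/4"] by (simp add: m_def less_top)
  have "p\<^sup>2 * m * (1/2) \<le> p\<^sup>2 * m * (ln (1/2) - ln (1/4))" using l by (intro mult_left_mono) (auto simp: m_def)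
  also have "\<dots> \<le> 2 * pi * (mean_pow p F (1/2) - mean_pow p F (1/4))"
    using hs_limit(2)[OF F p(1), of "1/4" "1/2"]
    unfolding m_def circ_powr_eq_mean_pow[OF F p(1)] right_diff_distrib by linarith
  also have "\<dots> \<le> 2 * pi * (8 * x)" by (intro mult_left_mono g) auto
  finally have "p\<^sup>2 * m * (1/2) \<le> 2 * pi * (8 * x)" .
  from mult_right_mono[OF this, of "2 / p\<^sup>2"]
  have "(p\<^sup>2 * m * (1/2)) * (2 / p\<^sup>2) \<le> (2 * pi * (8 * x)) * (2 / p\<^sup>2)" by simp
  moreover have "(p\<^sup>2 * m * (1/2)) * (2 / p\<^sup>2) = m" "(2 * pi * (8 * x)) * (2 / p\<^sup>2) = 32 * pi / p\<^sup>2 * x"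
    using p by simp_all
  ultimately have "m \<le> 32 * pi / p\<^sup>2 * x" by (simp only:)
  then show ?thesis unfolding m x(1) by (subst ennreal_mult[symmetric]) (simp_all add: x(2) ennreal_leI)
qed

text \<open>
  The rescaled form of \<open>hs_mass_le_unit\<close>, for the function \<open>f(z + c w)\<close> of \<open>w\<close> with
  \<open>c = (1 - |z|)/2\<close>.
\<close>
lemma hs_density_local:
  assumes f: "f holomorphic_on ball 0 1" and p: "0 < p" "p \<le> 2" and z: "cmod z < 1"
  shows "(\<integral>\<^sup>+ w \<in> ball z ((1 - cmod z) / 8). ennreal (hs_density p f w) \<partial>lborel) \<le>
    ennreal (32 * pi / p\<^sup>2 * ((1 - cmod z) / 2) powr (p - 2)) *
    (\<integral>\<^sup>+ w \<in> ball z ((1 - cmod z) / 2). ennreal (cmod (deriv f w) powr p) \<partial>lborel)"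
proof -
  define c where "c = (1 - cmod z) / 2"
  have c: "c > 0" using z by (simp add: c_def)
  define A where "A w = z + of_real c * w" for w
  define F where "F w = f (A w)" for w
  have sub: "ball z (c * r) \<subseteq> ball 0 1" if "r \<le> 1" for r
  proof
    fix w assume "w \<in> ball z (c * r)"
    then have "cmod (w - z) < c * r" by (simp add: dist_norm norm_minus_commute)
    also have "\<dots> \<le> c * 1" using c that by (intro mult_left_mono) auto
    finally have "cmod w < c + cmod z" using norm_triangle_ineq[of "w - z" z] by simp
    then show "w \<in> ball 0 1" using z by (simp add: c_def field_simps)
  qed
  have A: "A w \<in> ball 0 1" if "w \<in> ball 0 1" for w
  proof -
    have "A w \<in> ball z (c * 1)" using that c by (simp add: A_def dist_norm norm_mult)
    then show ?thesis using sub[of 1] by blast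
  qed
  have F: "F holomorphic_on ball 0 1" unfolding F_def
    by (rule holomorphic_on_compose_lambda[OF _ f A]) (auto simp: A_def intro!: holomorphic_intros)
  have dF: "deriv F w = deriv f (A w) * of_real c" if "w \<in> ball 0 1" for w
  proof -
    have "(A has_field_derivative of_real c) (at w)" unfolding A_def by (auto intro!: derivative_eq_intros)
    moreover have "(f has_field_derivative deriv f (A w)) (at (A w))"
      using A[OF that] by (intro holomorphic_derivI[OF f]) auto
    ultimately have "(F has_field_derivative deriv f (A w) * of_real c) (at w)"
      unfolding F_def by (rule DERIV_chain2[rotated])
    then show ?thesis by (rule DERIV_imp_deriv)
  qed
  have f': "deriv f holomorphic_on ball 0 1" using f by (simp add: holomorphic_deriv)
  have m1: "(\<lambda>w. ennreal (hs_density p f w) * indicator (ball z (c * (1/4))) w) \<in> borel_measurable borel"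
  proof -
    have [measurable]: "(\<lambda>z. if cmod z < 1 then hs_density p f z else 0) \<in> borel_measurable borel"
      by (rule measurable_hs_density[OF f])
    have "(\<lambda>w. ennreal (if cmod w < 1 then hs_density p f w else 0) * indicator (ball z (c * (1/4))) w) \<in> borel_measurable borel"
      by measurable
    also have "(\<lambda>w. ennreal (if cmod w < 1 then hs_density p f w else 0) * indicator (ball z (c * (1/4))) w) =
       (\<lambda>w. ennreal (hs_density p f w) * indicator (ball z (c * (1/4))) w)"
      using sub[of "1/4"] by (auto simp: fun_eq_iff subset_iff split: split_indicator)
    finally show ?thesis .
  qed
  have m2: "(\<lambda>w. ennreal (cmod (deriv f w) powr p) * indicator (ball z (c * 1)) w) \<in> borel_measurable borel"
    using sub[of 1] by (intro measurable_norm_powr_indicator p holomorphic_on_subset[OF f']) auto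
  have "(\<integral>\<^sup>+ w \<in> ball z (c * (1/4)). ennreal (hs_density p f w) \<partial>lborel) =
     (\<integral>\<^sup>+ w. ennreal (c\<^sup>2) * (ennreal (hs_density p f (A w)) * indicator (ball 0 (1/4)) w) \<partial>lborel)"
    unfolding nn_integral_ball_scale[OF m1 c] A_def
  proof (rule nn_integral_cmult[symmetric])
    have [measurable]: "(\<lambda>w. z + of_real c * w) \<in> borel_measurable borel" by measurable
    have "(\<lambda>w. ennreal (hs_density p f (z + of_real c * w)) * indicator (ball z (c * (1/4))) (z + of_real c * w)) \<in> borel_measurable borel"
      by (rule measurable_compose[OF _ m1]) measurable
    also have "(\<lambda>w. ennreal (hs_density p f (z + of_real c * w)) * indicator (ball z (c * (1/4))) (z + of_real c * w)) =
      (\<lambda>w. ennreal (hs_density p f (z + of_real c * w)) * indicator (ball 0 (1/4)) w)"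
      using c by (auto simp: fun_eq_iff indicator_def dist_norm norm_mult)
    finally show "(\<lambda>w. ennreal (hs_density p f (z + of_real c * w)) * indicator (ball 0 (1/4)) w) \<in> borel_measurable lborel" by simp
  qed
  also have "\<dots> = hs_mass p F (1/4)"
    unfolding hs_mass_def
  proof (rule nn_integral_cong)
    fix w :: complex
    show "ennreal (c\<^sup>2) * (ennreal (hs_density p f (A w)) * indicator (ball 0 (1/4)) w) = ennreal (hs_density p F w) * indicator (ball 0 (1/4)) w"
      using c by (auto simp: hs_density_def dF F_def norm_mult power_mult_distrib ennreal_mult' mult_ac split: split_indicator)
  qed
  also have "\<dots> \<le> ennreal (32 * pi / p\<^sup>2) * (\<integral>\<^sup>+ z \<in> ball 0 1. ennreal (cmod (deriv F z) powr p) \<partial>lborel)"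
    by (rule hs_mass_le_unit[OF F p])
  also have "(\<integral>\<^sup>+ z \<in> ball 0 1. ennreal (cmod (deriv F z) powr p) \<partial>lborel) =
     (\<integral>\<^sup>+ w. ennreal (c powr p) * (ennreal (cmod (deriv f (A w)) powr p) * indicator (ball 0 1) w) \<partial>lborel)"
    using c by (intro nn_integral_cong) (auto simp: dF norm_mult powr_mult ennreal_mult' mult_ac split: split_indicator)
  also have "\<dots> = ennreal (c powr p) * (\<integral>\<^sup>+ w. ennreal (cmod (deriv f (A w)) powr p) * indicator (ball 0 1) w \<partial>lborel)"
  proof (rule nn_integral_cmult)
    have "(\<lambda>w. deriv f (A w)) holomorphic_on ball 0 1"
      by (rule holomorphic_on_compose_lambda[OF _ f' A]) (auto simp: A_def intro!: holomorphic_intros)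
    then show "(\<lambda>w. ennreal (cmod (deriv f (A w)) powr p) * indicator (ball 0 1) w) \<in> borel_measurable lborel"
      using measurable_norm_powr_indicator[of "\<lambda>w. deriv f (A w)" "ball 0 1" p] p by simp
  qed
  also have "ennreal (c powr p) = ennreal (c powr (p - 2)) * ennreal (c\<^sup>2)"
    using c by (simp add: ennreal_mult[symmetric] powr_diff powr_numeral)
  also have "ennreal (c powr (p - 2)) * ennreal (c\<^sup>2) * (\<integral>\<^sup>+ w. ennreal (cmod (deriv f (A w)) powr p) * indicator (ball 0 1) w \<partial>lborel)
     = ennreal (c powr (p - 2)) * (\<integral>\<^sup>+ w \<in> ball z (c * 1). ennreal (cmod (deriv f w) powr p) \<partial>lborel)"
    unfolding nn_integral_ball_scale[OF m2 c] A_def by (simp add: mult.assoc)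
  also have "ennreal (32 * pi / p\<^sup>2) * (ennreal (c powr (p - 2)) * (\<integral>\<^sup>+ w \<in> ball z (c * 1). ennreal (cmod (deriv f w) powr p) \<partial>lborel))
     = ennreal (32 * pi / p\<^sup>2 * c powr (p - 2)) * (\<integral>\<^sup>+ w \<in> ball z (c * 1). ennreal (cmod (deriv f w) powr p) \<partial>lborel)"
  proof -
    have "ennreal (32 * pi / p\<^sup>2 * c powr (p - 2)) = ennreal (32 * pi / p\<^sup>2) * ennreal (c powr (p - 2))"
      by (rule ennreal_mult) auto
    then show ?thesis by (simp only: mult.assoc)
  qed
  moreover have "c * (1/4) = (1 - cmod z) / 8" "c * 1 = (1 - cmod z) / 2" "c = (1 - cmod z) / 2" by (simp_all add: c_def)
  ultimately show ?thesis by (simp only:)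
qed

lemma emeasure_complex_ball:
  assumes "r \<ge> 0"
  shows "emeasure lborel (ball (c::complex) r) = ennreal (pi * r\<^sup>2)"
  using assms by (simp add: emeasure_ball unit_ball_vol_2)

lemma boundary_distance_ball:
  fixes z w :: complex
  shows "\<bar>(1 - cmod z) - (1 - cmod w)\<bar> \<le> dist z w"
  using norm_triangle_ineq3[of z w] by (simp add: dist_norm abs_minus_commute)

lemma nn_integral_one_minus_powr:
  assumes a: "0 \<le> a" "a < 1" and \<alpha>: "\<alpha> > 0"
  shows "(\<integral>\<^sup>+ r \<in> {a<..<1}. ennreal ((1 - r) powr (\<alpha> - 1)) \<partial>lborel) = ennreal ((1 - a) powr \<alpha> / \<alpha>)"
proof (rule nn_integral_has_integral_lebesgue')
  have "((\<lambda>r. (1 - r) powr (\<alpha> - 1)) has_integral (- ((1 - 1) powr \<alpha> / \<alpha>) - - ((1 - a) powr \<alpha> / \<alpha>))) {a..1}"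
  proof (rule fundamental_theorem_of_calculus_interior)
    show "continuous_on {a..1} (\<lambda>r. - ((1 - r) powr \<alpha> / \<alpha>))"
      using \<alpha> by (intro continuous_intros continuous_on_powr') auto
    fix r assume "r \<in> {a<..<1}"
    then have "((\<lambda>r. - ((1 - r) powr \<alpha> / \<alpha>)) has_real_derivative (1 - r) powr (\<alpha> - 1)) (at r)"
      using \<alpha> by (auto intro!: derivative_eq_intros simp: field_simps)
    then show "((\<lambda>r. - ((1 - r) powr \<alpha> / \<alpha>)) has_vector_derivative (1 - r) powr (\<alpha> - 1)) (at r)"
      by (simp add: has_real_derivative_iff_has_vector_derivative)
  qed (use a in auto)
  then show "((\<lambda>r. (1 - r) powr (\<alpha> - 1)) has_integral (1 - a) powr \<alpha> / \<alpha>) {a<..<1}"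
    using has_integral_open_interval[of "\<lambda>r. (1 - r) powr (\<alpha> - 1)" _ a 1] by simp
qed simp

text \<open>
  By the Hardy--Stein identity and Tonelli's theorem, the part of the integral in the A-norm
  over radii at least \<open>1/2\<close> is at most a constant times a weighted area integral.  The radii up to \<open>1/2\<close> are treated separately because of the
  factor \<open>1/r\<close> in the identity; they always contribute a finite amount.
\<close>
lemma mem_A_space_if_area:
  assumes f: "f holomorphic_on ball 0 1" and p: "p > 0" and \<alpha>: "\<alpha> > 0"
    and fin: "(\<integral>\<^sup>+ w \<in> ball 0 1. ennreal (hs_density p f w * (1 - cmod w) powr \<alpha>) \<partial>lborel) < \<infinity>"
  shows "f \<in> A_space \<alpha> p"
proof -
  define d where "d = deriv (mean_pow p f)"
  have d: "d r = p\<^sup>2 / (2 * pi) * enn2real (hs_mass p f r) / r" "0 \<le> d r" if "0 < r" "r < 1" for r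
    unfolding d_def using deriv_mean_pow[OF f p that] deriv_mean_pow_nonneg[OF f p that] by auto
  define h where "h w = (if cmod w < 1 then hs_density p f w else 0)" for w
  have [measurable]: "h \<in> borel_measurable borel" unfolding h_def by (rule measurable_hs_density[OF f])
  have h0: "0 \<le> h w" for w by (simp add: h_def hs_density_nonneg)
  have m: "continuous_on {0<..<1} (\<lambda>r. d r * (1 - r) powr (\<alpha> - 1))"
    unfolding d_def by (intro continuous_intros continuous_on_deriv_mean_pow f p) auto
  have "(\<integral>\<^sup>+ r \<in> {0<..<1}. ennreal (d r * (1 - r) powr (\<alpha> - 1)) \<partial>lborel) =
     (\<integral>\<^sup>+ r. ennreal (d r * (1 - r) powr (\<alpha> - 1)) * indicator {0<..<1/2} r + ennreal (d r * (1 - r) powr (\<alpha> - 1)) * indicator {1/2..<1} r \<partial>lborel)"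
    by (intro nn_integral_cong) (auto split: split_indicator)
  also have "\<dots> = (\<integral>\<^sup>+ r \<in> {0<..<1/2}. ennreal (d r * (1 - r) powr (\<alpha> - 1)) \<partial>lborel)
      + (\<integral>\<^sup>+ r \<in> {1/2..<1}. ennreal (d r * (1 - r) powr (\<alpha> - 1)) \<partial>lborel)"
    by (rule nn_integral_add)
       (auto intro!: measurable_indicator_continuous continuous_on_subset[OF m])
  also have "\<dots> < \<infinity>"
  proof -
    have "(\<integral>\<^sup>+ r \<in> {0<..<1/2}. ennreal (d r * (1 - r) powr (\<alpha> - 1)) \<partial>lborel) < \<infinity>"
    proof (rule nn_integral_finite_compare[where C = "ennreal (2 powr \<bar>\<alpha> - 1\<bar>)" and g = "\<lambda>r. ennreal (d r) * indicator {0<..<1/2} r"])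
      show "(\<lambda>r. ennreal (d r) * indicator {0<..<1/2} r) \<in> borel_measurable lborel"
      proof -
        have "continuous_on {0<..<1/2} d"
          unfolding d_def by (rule continuous_on_subset[OF continuous_on_deriv_mean_pow[OF f p]]) auto
        then show ?thesis by (auto intro!: measurable_indicator_continuous)
      qed
      show "(\<integral>\<^sup>+ r \<in> {0<..<1/2}. ennreal (d r) \<partial>lborel) < \<infinity>"
        unfolding d_def by (subst nn_integral_deriv_mean_pow[OF f p]) auto
      show "AE r in lborel. ennreal (d r * (1 - r) powr (\<alpha> - 1)) * indicator {0<..<1/2} r
          \<le> ennreal (2 powr \<bar>\<alpha> - 1\<bar>) * (ennreal (d r) * indicator {0<..<1/2} r)"
      proof (rule AE_I2)
        fix r :: real
        show "ennreal (d r * (1 - r) powr (\<alpha> - 1)) * indicator {0<..<1/2} r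
          \<le> ennreal (2 powr \<bar>\<alpha> - 1\<bar>) * (ennreal (d r) * indicator {0<..<1/2} r)"
        proof (cases "r \<in> {0<..<1/2}")
          case True
          have "(1 - r) powr (\<alpha> - 1) \<le> 2 powr \<bar>\<alpha> - 1\<bar> * 1 powr (\<alpha> - 1)"
            using True by (intro powr_comparable) auto
          then have "d r * (1 - r) powr (\<alpha> - 1) \<le> d r * (2 powr \<bar>\<alpha> - 1\<bar>)"
            using d(2)[of r] True by (intro mult_left_mono) auto
          then show ?thesis using True d(2)[of r] by (simp add: ennreal_mult[symmetric] ennreal_leI mult.commute)
        qed simp
      qed
    qed simp
    moreover have "(\<integral>\<^sup>+ r \<in> {1/2..<1}. ennreal (d r * (1 - r) powr (\<alpha> - 1)) \<partial>lborel) < \<infinity>"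
    proof -
      define X where "X r w = ennreal ((1 - r) powr (\<alpha> - 1)) * indicator {0<..<1} r * (ennreal (h w) * indicator (ball 0 r) w)" for r and w :: complex
      have [measurable]: "(\<lambda>(r, w). X r w) \<in> borel_measurable (lborel \<Otimes>\<^sub>M lborel)"
      proof -
        have [measurable]: "Measurable.pred (lborel \<Otimes>\<^sub>M lborel) (\<lambda>x::real \<times> complex. snd x \<in> ball 0 (fst x))"
          unfolding mem_ball_0 by measurable
        have [measurable]: "(\<lambda>x::real \<times> complex. indicator {0<..<1} (fst x) :: ennreal) \<in> borel_measurable (lborel \<Otimes>\<^sub>M lborel)"
          by (rule measurable_compose[OF measurable_fst, where g = "indicator {0<..<1}"]) simp
        show ?thesis unfolding X_def split_beta by measurable
      qed
      have "(\<integral>\<^sup>+ r \<in> {1/2..<1}. ennreal (d r * (1 - r) powr (\<alpha> - 1)) \<partial>lborel) \<le>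
         (\<integral>\<^sup>+ r. ennreal (p\<^sup>2 / pi) * (\<integral>\<^sup>+ w. X r w \<partial>lborel) \<partial>lborel)"
      proof (rule nn_integral_mono)
        fix r :: real
        show "ennreal (d r * (1 - r) powr (\<alpha> - 1)) * indicator {1/2..<1} r \<le> ennreal (p\<^sup>2 / pi) * (\<integral>\<^sup>+ w. X r w \<partial>lborel)"
        proof (cases "r \<in> {1/2..<1}")
          case True
          define mm where "mm = enn2real (hs_mass p f r)"
          have mm: "mm \<ge> 0" "hs_mass p f r = ennreal mm"
            using hardy_stein(1)[OF f p, of r] True by (auto simp: mm_def less_top)
          have "1 / r \<le> 2" using True by (simp add: field_simps)
          then have "p\<^sup>2 / (2 * pi) * mm * (1 / r) \<le> p\<^sup>2 / (2 * pi) * mm * 2"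
            using mm by (intro mult_left_mono) auto
          then have "d r \<le> p\<^sup>2 / pi * mm" using d(1)[of r] True by (simp add: mm_def)
          then have "d r * (1 - r) powr (\<alpha> - 1) \<le> p\<^sup>2 / pi * mm * (1 - r) powr (\<alpha> - 1)" by (intro mult_right_mono) auto
          then have "ennreal (d r * (1 - r) powr (\<alpha> - 1)) \<le> ennreal (p\<^sup>2 / pi) * (ennreal ((1 - r) powr (\<alpha> - 1)) * ennreal mm)"
            using mm by (simp add: ennreal_mult[symmetric] ennreal_leI mult_ac)
          also have "ennreal mm = (\<integral>\<^sup>+ w. ennreal (h w) * indicator (ball 0 r) w \<partial>lborel)"
            unfolding mm(2)[symmetric] hs_mass_def using True
            by (intro nn_integral_cong) (auto simp: h_def split: split_indicator)
          also have "ennreal ((1 - r) powr (\<alpha> - 1)) * \<dots> = (\<integral>\<^sup>+ w. X r w \<partial>lborel)"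
            unfolding X_def using True by (simp add: nn_integral_cmult)
          finally show ?thesis using True by simp
        qed simp
      qed
      also have "\<dots> = ennreal (p\<^sup>2 / pi) * (\<integral>\<^sup>+ r. \<integral>\<^sup>+ w. X r w \<partial>lborel \<partial>lborel)"
        by (rule nn_integral_cmult) measurable
      also have "(\<integral>\<^sup>+ r. \<integral>\<^sup>+ w. X r w \<partial>lborel \<partial>lborel) = (\<integral>\<^sup>+ w. \<integral>\<^sup>+ r. X r w \<partial>lborel \<partial>lborel)"
        by (subst lborel_pair.Fubini') simp_all
      also have "\<dots> = (\<integral>\<^sup>+ w. ennreal (1 / \<alpha>) * (ennreal (hs_density p f w * (1 - cmod w) powr \<alpha>) * indicator (ball 0 1) w) \<partial>lborel)"
      proof (rule nn_integral_cong)
        fix w :: complex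
        show "(\<integral>\<^sup>+ r. X r w \<partial>lborel) = ennreal (1 / \<alpha>) * (ennreal (hs_density p f w * (1 - cmod w) powr \<alpha>) * indicator (ball 0 1) w)"
        proof (cases "cmod w < 1")
          case True
          have "(\<integral>\<^sup>+ r. X r w \<partial>lborel) = (\<integral>\<^sup>+ r. ennreal (h w) * (ennreal ((1 - r) powr (\<alpha> - 1)) * indicator {cmod w<..<1} r) \<partial>lborel)"
            by (intro nn_integral_cong) (auto simp: X_def mult_ac split: split_indicator intro: le_less_trans[OF norm_ge_zero])
          also have "\<dots> = ennreal (h w) * ennreal ((1 - cmod w) powr \<alpha> / \<alpha>)"
            by (subst nn_integral_cmult) (use True \<alpha> in \<open>auto simp: nn_integral_one_minus_powr\<close>)
          finally show ?thesis using True \<alpha> h0[of w] by (simp add: h_def ennreal_mult[symmetric] mult_ac)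
        next
          case False
          then have "X r w = 0" for r by (auto simp: X_def h_def)
          then show ?thesis using False by simp
        qed
      qed
      also have "\<dots> = ennreal (1 / \<alpha>) * (\<integral>\<^sup>+ w \<in> ball 0 1. ennreal (hs_density p f w * (1 - cmod w) powr \<alpha>) \<partial>lborel)"
      proof (rule nn_integral_cmult)
        have "(\<lambda>w. ennreal (h w * (if cmod w < 1 then (1 - cmod w) powr \<alpha> else 0))) \<in> borel_measurable borel" by measurable
        also have "(\<lambda>w. ennreal (h w * (if cmod w < 1 then (1 - cmod w) powr \<alpha> else 0))) =
           (\<lambda>w. ennreal (hs_density p f w * (1 - cmod w) powr \<alpha>) * indicator (ball 0 1) w)"
          by (auto simp: fun_eq_iff h_def)
        finally show "(\<lambda>w. ennreal (hs_density p f w * (1 - cmod w) powr \<alpha>) * indicator (ball 0 1) w) \<in> borel_measurable lborel" by simp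
      qed
      also have "ennreal (p\<^sup>2 / pi) * \<dots> < \<infinity>" using fin by (simp add: ennreal_mult_less_top)
      finally show ?thesis .
    qed
    ultimately show ?thesis by simp
  qed
  finally show ?thesis using f p by (simp add: mem_A_space_iff d_def)
qed

text \<open>
  The points \<open>z\<close> whose disc of radius \<open>(1-|z|)/8\<close> contains \<open>w\<close> include the disc of radius
  \<open>(1-|w|)/16\<close> about \<open>w\<close>.
\<close>
lemma kernel_lower:
  assumes w: "cmod w < 1"
  shows "ennreal ((1 - cmod w) powr s) \<le> ennreal (256 * 2 powr \<bar>s - 2\<bar> / pi) *
    (\<integral>\<^sup>+ z \<in> ball 0 1. ennreal ((1 - cmod z) powr (s - 2)) * indicator (ball z ((1 - cmod z) / 8)) w \<partial>lborel)"
proof -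
  define \<delta> where "\<delta> = 1 - cmod w"
  define k where "k = 2 powr \<bar>s - 2\<bar>"
  have \<delta>: "\<delta> > 0" using w by (simp add: \<delta>_def)
  have k: "k > 0" by (simp add: k_def)
  have "ennreal (\<delta> powr s) = ennreal (256 * k / pi) * (ennreal (\<delta> powr (s - 2) / k) * ennreal (pi * (\<delta> / 16)\<^sup>2))"
  proof -
    have "\<delta> powr s = \<delta> powr (s - 2) * \<delta>\<^sup>2" using \<delta> by (simp add: powr_diff powr_numeral)
    then have "\<delta> powr s = 256 * k / pi * (\<delta> powr (s - 2) / k * (pi * (\<delta> / 16)\<^sup>2))"
      using k by (simp add: power_divide)
    then show ?thesis using k by (simp add: ennreal_mult[symmetric])
  qed
  also have "ennreal (pi * (\<delta> / 16)\<^sup>2) = emeasure lborel (ball w (\<delta> / 16))" using \<delta> by (simp add: emeasure_complex_ball)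
  also have "ennreal (\<delta> powr (s - 2) / k) * \<dots> = (\<integral>\<^sup>+ z \<in> ball w (\<delta> / 16). ennreal (\<delta> powr (s - 2) / k) \<partial>lborel)"
    by (simp add: nn_integral_cmult_indicator)
  also have "\<dots> \<le> (\<integral>\<^sup>+ z \<in> ball 0 1. ennreal ((1 - cmod z) powr (s - 2)) * indicator (ball z ((1 - cmod z) / 8)) w \<partial>lborel)"
  proof (rule nn_integral_mono)
    fix z :: complex
    show "ennreal (\<delta> powr (s - 2) / k) * indicator (ball w (\<delta> / 16)) z \<le>
      ennreal ((1 - cmod z) powr (s - 2)) * indicator (ball z ((1 - cmod z) / 8)) w * indicator (ball 0 1) z"
    proof (cases "z \<in> ball w (\<delta> / 16)")
      case True
      then have "dist w z < \<delta> / 16" by simp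
      then have z: "15/16 * \<delta> < 1 - cmod z" "1 - cmod z < 17/16 * \<delta>" "dist z w < \<delta> / 16"
        using boundary_distance_ball[of w z] unfolding \<delta>_def by (auto simp: dist_commute abs_le_iff)
      have "\<delta> powr (s - 2) \<le> k * (1 - cmod z) powr (s - 2)"
        unfolding k_def using z \<delta> by (intro powr_comparable) auto
      then have "\<delta> powr (s - 2) / k \<le> (1 - cmod z) powr (s - 2)" using k by (simp add: field_simps)
      then show ?thesis using z \<delta> True by (auto simp: indicator_def ennreal_leI)
    qed simp
  qed
  finally show ?thesis by (simp add: \<delta>_def k_def mult_left_mono)
qed

text \<open>
  The points \<open>z\<close> whose disc of radius \<open>(1-|z|)/2\<close> contains \<open>w\<close> lie in the disc of radius
  \<open>1-|w|\<close> about \<open>w\<close>.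
\<close>
lemma kernel_upper:
  assumes w: "cmod w < 1"
  shows "(\<integral>\<^sup>+ z \<in> ball 0 1. ennreal ((1 - cmod z) powr (s - 2)) * indicator (ball z ((1 - cmod z) / 2)) w \<partial>lborel)
     \<le> ennreal (pi * 2 powr \<bar>s - 2\<bar> * (1 - cmod w) powr s)"
proof -
  define \<delta> where "\<delta> = 1 - cmod w"
  define k where "k = 2 powr \<bar>s - 2\<bar>"
  have \<delta>: "\<delta> > 0" using w by (simp add: \<delta>_def)
  have "(\<integral>\<^sup>+ z \<in> ball 0 1. ennreal ((1 - cmod z) powr (s - 2)) * indicator (ball z ((1 - cmod z) / 2)) w \<partial>lborel)
    \<le> (\<integral>\<^sup>+ z \<in> ball w \<delta>. ennreal (k * \<delta> powr (s - 2)) \<partial>lborel)"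
  proof (rule nn_integral_mono)
    fix z :: complex
    show "ennreal ((1 - cmod z) powr (s - 2)) * indicator (ball z ((1 - cmod z) / 2)) w * indicator (ball 0 1) z
      \<le> ennreal (k * \<delta> powr (s - 2)) * indicator (ball w \<delta>) z"
    proof (cases "w \<in> ball z ((1 - cmod z) / 2) \<and> z \<in> ball 0 1")
      case True
      then have d: "dist z w < (1 - cmod z) / 2" "cmod z < 1" by auto
      then have z: "1 - cmod z < 2 * \<delta>" "\<delta> < 2 * (1 - cmod z)" "dist w z < \<delta>"
        using boundary_distance_ball[of z w] unfolding \<delta>_def by (auto simp: dist_commute abs_le_iff)
      have "(1 - cmod z) powr (s - 2) \<le> k * \<delta> powr (s - 2)"
        unfolding k_def using z \<delta> d by (intro powr_comparable) auto
      then show ?thesis using z by (auto simp: indicator_def ennreal_leI)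
    next
      case False
      then show ?thesis by (auto split: split_indicator)
    qed
  qed
  also have "\<dots> = ennreal (k * \<delta> powr (s - 2)) * ennreal (pi * \<delta>\<^sup>2)"
    using \<delta> by (simp add: nn_integral_cmult_indicator emeasure_complex_ball)
  also have "\<dots> = ennreal (pi * k * (\<delta> powr (s - 2) * \<delta>\<^sup>2))"
    by (simp add: ennreal_mult[symmetric] k_def mult_ac)
  also have "\<delta> powr (s - 2) * \<delta>\<^sup>2 = \<delta> powr s" using \<delta> by (simp add: powr_diff powr_numeral)
  finally show ?thesis by (simp add: \<delta>_def k_def)
qed

lemma measurable_moving_ball [measurable]:
  assumes [measurable]: "r \<in> borel_measurable borel"
  shows "(\<lambda>(z, w). indicator (ball z (r z)) w :: ennreal) \<in> borel_measurable (lborel \<Otimes>\<^sub>M (lborel :: complex measure))"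
proof -
  have [measurable]: "Measurable.pred (lborel \<Otimes>\<^sub>M lborel) (\<lambda>x::complex \<times> complex. snd x \<in> ball (fst x) (r (fst x)))"
    unfolding mem_ball by measurable
  show ?thesis unfolding split_beta by measurable
qed

text \<open>
  The weight \<open>(1-|w|)^\<alpha>\<close> is written as an integral over \<open>z\<close> by \<open>kernel_lower\<close>, the local
  estimate is applied on the disc about each \<open>z\<close>, and \<open>kernel_upper\<close> removes the integral over
  \<open>z\<close> again.
\<close>
theorem B_space_subset_A_space:
  assumes p: "0 < p" "p \<le> 2" and \<alpha>: "\<alpha> > 0" "\<alpha> + p > 1"
  shows "B_space \<alpha> p \<subseteq> A_space \<alpha> p"
proof
  fix f assume "f \<in> B_space \<alpha> p"
  then have f: "f holomorphic_on ball 0 1"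
    and fin: "(\<integral>\<^sup>+ z \<in> ball 0 1. ennreal (cmod (deriv f z) powr p * (1 - cmod z) powr (\<alpha> + p - 2)) \<partial>lborel) < \<infinity>"
    using p \<alpha> by (auto simp: mem_B_space_iff)
  have f': "deriv f holomorphic_on ball 0 1" using f by (simp add: holomorphic_deriv)
  define h where "h w = (if cmod w < 1 then hs_density p f w else 0)" for w
  have [measurable]: "h \<in> borel_measurable borel" unfolding h_def by (rule measurable_hs_density[OF f])
  have h0: "0 \<le> h w" for w by (simp add: h_def hs_density_nonneg)
  define g where "g w = (if cmod w < 1 then cmod (deriv f w) powr p else 0)" for w
  have [measurable]: "g \<in> borel_measurable borel"
    unfolding g_def by (intro measurable_if_continuous_on_ball continuous_on_norm_powr f' p)
  have g0: "0 \<le> g w" for w by (simp add: g_def)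
  define I where "I c z w = (indicator (ball z ((1 - cmod z) / c)) w :: ennreal)" for c :: real and z w :: complex
  have [measurable]: "(\<lambda>(z, w). I c z w) \<in> borel_measurable (lborel \<Otimes>\<^sub>M lborel)" for c
    unfolding I_def by measurable
  define C1 where "C1 = 256 * 2 powr \<bar>\<alpha> - 2\<bar> / pi"
  define C2 where "C2 = 32 * pi / p\<^sup>2 * (1/2) powr (p - 2)"
  define C3 where "C3 = pi * 2 powr \<bar>\<alpha> + p - 2 - 2\<bar>"
  have C: "C1 \<ge> 0" "C2 \<ge> 0" "C3 \<ge> 0" by (simp_all add: C1_def C2_def C3_def)
  define a where "a s z = ennreal ((1 - cmod z) powr s) * indicator (ball 0 1) z" for s :: real and z :: complex
  have [measurable]: "a s \<in> borel_measurable borel" for s unfolding a_def by measurable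
  have sub: "ball z ((1 - cmod z) / c) \<subseteq> ball 0 1" if "c \<ge> 1" "cmod z < 1" for z :: complex and c
  proof
    fix w assume "w \<in> ball z ((1 - cmod z) / c)"
    then have "dist z w < (1 - cmod z) / c" by simp
    also have "\<dots> \<le> (1 - cmod z) / 1" using that by (intro divide_left_mono) auto
    finally show "w \<in> ball 0 1" using boundary_distance_ball[of z w] by (auto simp: abs_le_iff)
  qed
  have "(\<integral>\<^sup>+ w \<in> ball 0 1. ennreal (hs_density p f w * (1 - cmod w) powr \<alpha>) \<partial>lborel)
     = (\<integral>\<^sup>+ w. ennreal (h w) * (ennreal ((1 - cmod w) powr \<alpha>) * indicator (ball 0 1) w) \<partial>lborel)"
    by (intro nn_integral_cong) (auto simp: h_def ennreal_mult hs_density_nonneg split: split_indicator)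
  also have "\<dots> \<le> (\<integral>\<^sup>+ w. ennreal (h w) * (ennreal C1 * (\<integral>\<^sup>+ z. a (\<alpha> - 2) z * I 8 z w \<partial>lborel)) \<partial>lborel)"
  proof (rule nn_integral_mono)
    fix w :: complex
    show "ennreal (h w) * (ennreal ((1 - cmod w) powr \<alpha>) * indicator (ball 0 1) w) \<le>
       ennreal (h w) * (ennreal C1 * (\<integral>\<^sup>+ z. a (\<alpha> - 2) z * I 8 z w \<partial>lborel))"
      using kernel_lower[of w \<alpha>]
      by (cases "cmod w < 1") (auto intro!: mult_left_mono simp: C1_def a_def I_def mult_ac)
  qed
  also have "\<dots> = (\<integral>\<^sup>+ w. \<integral>\<^sup>+ z. ennreal C1 * (a (\<alpha> - 2) z * (ennreal (h w) * I 8 z w)) \<partial>lborel \<partial>lborel)"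
    by (subst nn_integral_cmult[symmetric], measurable, subst nn_integral_cmult[symmetric], measurable) (simp add: mult_ac)
  also have "\<dots> = (\<integral>\<^sup>+ z. \<integral>\<^sup>+ w. ennreal C1 * (a (\<alpha> - 2) z * (ennreal (h w) * I 8 z w)) \<partial>lborel \<partial>lborel)"
    by (subst lborel_pair.Fubini'[symmetric]) (simp_all add: split_beta')
  also have "\<dots> = (\<integral>\<^sup>+ z. ennreal C1 * (a (\<alpha> - 2) z * (\<integral>\<^sup>+ w. ennreal (h w) * I 8 z w \<partial>lborel)) \<partial>lborel)"
    by (simp add: nn_integral_cmult)
  also have "\<dots> \<le> (\<integral>\<^sup>+ z. ennreal C1 * (ennreal C2 * (a (\<alpha> + p - 4) z * (\<integral>\<^sup>+ w. ennreal (g w) * I 2 z w \<partial>lborel))) \<partial>lborel)"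
  proof (rule nn_integral_mono)
    fix z :: complex
    show "ennreal C1 * (a (\<alpha> - 2) z * (\<integral>\<^sup>+ w. ennreal (h w) * I 8 z w \<partial>lborel)) \<le>
      ennreal C1 * (ennreal C2 * (a (\<alpha> + p - 4) z * (\<integral>\<^sup>+ w. ennreal (g w) * I 2 z w \<partial>lborel)))"
    proof (cases "cmod z < 1")
      case True
      have "(\<integral>\<^sup>+ w. ennreal (h w) * I 8 z w \<partial>lborel) = (\<integral>\<^sup>+ w \<in> ball z ((1 - cmod z) / 8). ennreal (hs_density p f w) \<partial>lborel)"
        using sub[of 8 z] True by (intro nn_integral_cong) (auto simp: I_def h_def subset_iff split: split_indicator)
      also have "\<dots> \<le> ennreal (32 * pi / p\<^sup>2 * ((1 - cmod z) / 2) powr (p - 2)) *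
          (\<integral>\<^sup>+ w \<in> ball z ((1 - cmod z) / 2). ennreal (cmod (deriv f w) powr p) \<partial>lborel)"
        by (rule hs_density_local[OF f p True])
      also have "(\<integral>\<^sup>+ w \<in> ball z ((1 - cmod z) / 2). ennreal (cmod (deriv f w) powr p) \<partial>lborel) = (\<integral>\<^sup>+ w. ennreal (g w) * I 2 z w \<partial>lborel)"
        using sub[of 2 z] True by (intro nn_integral_cong) (auto simp: I_def g_def subset_iff split: split_indicator)
      also have "32 * pi / p\<^sup>2 * ((1 - cmod z) / 2) powr (p - 2) = C2 * (1 - cmod z) powr (p - 2)"
        using True by (simp add: C2_def powr_divide)
      finally have "a (\<alpha> - 2) z * (\<integral>\<^sup>+ w. ennreal (h w) * I 8 z w \<partial>lborel) \<le>
         a (\<alpha> - 2) z * (ennreal (C2 * (1 - cmod z) powr (p - 2)) * (\<integral>\<^sup>+ w. ennreal (g w) * I 2 z w \<partial>lborel))"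
        by (intro mult_left_mono) auto
      also have "\<dots> = ennreal C2 * (ennreal ((1 - cmod z) powr (\<alpha> - 2) * (1 - cmod z) powr (p - 2)) * (\<integral>\<^sup>+ w. ennreal (g w) * I 2 z w \<partial>lborel))"
        using True C by (simp add: a_def ennreal_mult mult_ac)
      also have "(1 - cmod z) powr (\<alpha> - 2) * (1 - cmod z) powr (p - 2) = (1 - cmod z) powr (\<alpha> + p - 4)"
        by (simp flip: powr_add)
      also have "ennreal ((1 - cmod z) powr (\<alpha> + p - 4)) = a (\<alpha> + p - 4) z" using True by (simp add: a_def)
      finally show ?thesis by (intro mult_left_mono) auto
    qed (simp add: a_def)
  qed
  also have "\<dots> = (\<integral>\<^sup>+ z. \<integral>\<^sup>+ w. ennreal (C1 * C2) * (ennreal (g w) * (a (\<alpha> + p - 4) z * I 2 z w)) \<partial>lborel \<partial>lborel)"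
  proof (rule nn_integral_cong)
    fix z :: complex
    have "(\<integral>\<^sup>+ w. ennreal (C1 * C2) * (ennreal (g w) * (a (\<alpha> + p - 4) z * I 2 z w)) \<partial>lborel) =
      (\<integral>\<^sup>+ w. (ennreal (C1 * C2) * a (\<alpha> + p - 4) z) * (ennreal (g w) * I 2 z w) \<partial>lborel)"
      by (simp add: mult_ac)
    also have "\<dots> = (ennreal (C1 * C2) * a (\<alpha> + p - 4) z) * (\<integral>\<^sup>+ w. ennreal (g w) * I 2 z w \<partial>lborel)"
      by (rule nn_integral_cmult) measurable
    finally show "ennreal C1 * (ennreal C2 * (a (\<alpha> + p - 4) z * (\<integral>\<^sup>+ w. ennreal (g w) * I 2 z w \<partial>lborel))) =
      (\<integral>\<^sup>+ w. ennreal (C1 * C2) * (ennreal (g w) * (a (\<alpha> + p - 4) z * I 2 z w)) \<partial>lborel)"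
      using C by (simp add: ennreal_mult mult.assoc)
  qed
  also have "\<dots> = (\<integral>\<^sup>+ w. \<integral>\<^sup>+ z. ennreal (C1 * C2) * (ennreal (g w) * (a (\<alpha> + p - 4) z * I 2 z w)) \<partial>lborel \<partial>lborel)"
    by (subst lborel_pair.Fubini') (simp_all add: split_beta')
  also have "\<dots> = (\<integral>\<^sup>+ w. ennreal (C1 * C2) * (ennreal (g w) * (\<integral>\<^sup>+ z. a (\<alpha> + p - 4) z * I 2 z w \<partial>lborel)) \<partial>lborel)"
    by (simp add: nn_integral_cmult)
  also have "\<dots> \<le> (\<integral>\<^sup>+ w. ennreal (C1 * C2 * C3) * (ennreal (cmod (deriv f w) powr p * (1 - cmod w) powr (\<alpha> + p - 2)) * indicator (ball 0 1) w) \<partial>lborel)"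
  proof (rule nn_integral_mono)
    fix w :: complex
    show "ennreal (C1 * C2) * (ennreal (g w) * (\<integral>\<^sup>+ z. a (\<alpha> + p - 4) z * I 2 z w \<partial>lborel)) \<le>
      ennreal (C1 * C2 * C3) * (ennreal (cmod (deriv f w) powr p * (1 - cmod w) powr (\<alpha> + p - 2)) * indicator (ball 0 1) w)"
    proof (cases "cmod w < 1")
      case True
      have "(\<integral>\<^sup>+ z. a (\<alpha> + p - 4) z * I 2 z w \<partial>lborel) \<le> ennreal (C3 * (1 - cmod w) powr (\<alpha> + p - 2))"
        using kernel_upper[OF True, of "\<alpha> + p - 2"] by (simp add: C3_def a_def I_def mult_ac)
      then have "ennreal (C1 * C2) * (ennreal (g w) * (\<integral>\<^sup>+ z. a (\<alpha> + p - 4) z * I 2 z w \<partial>lborel)) \<le>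
        ennreal (C1 * C2) * (ennreal (g w) * ennreal (C3 * (1 - cmod w) powr (\<alpha> + p - 2)))"
        by (intro mult_left_mono) auto
      also have "\<dots> = ennreal (C1 * C2 * C3) * ennreal (cmod (deriv f w) powr p * (1 - cmod w) powr (\<alpha> + p - 2))"
        using True g0[of w] C by (simp add: ennreal_mult[symmetric] g_def mult_ac)
      finally show ?thesis using True by simp
    qed (simp add: g_def)
  qed
  also have "\<dots> = ennreal (C1 * C2 * C3) * (\<integral>\<^sup>+ w \<in> ball 0 1. ennreal (cmod (deriv f w) powr p * (1 - cmod w) powr (\<alpha> + p - 2)) \<partial>lborel)"
    by (intro nn_integral_cmult) (auto intro!: measurable_indicator_continuous continuous_intros continuous_on_norm_powr f' p)
  also have "\<dots> < \<infinity>" using fin by (simp add: ennreal_mult_less_top)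
  finally show "f \<in> A_space \<alpha> p" by (rule mem_A_space_if_area[OF f p(1) \<alpha>(1)])
qed

section \<open>Comparing the spaces A for different exponents\<close>

text \<open>
  For \<open>\<alpha> = 1\<close> the weight is constant, and the \<open>p\<close>-th power of the A-norm is the limit of the
  integral means: these spaces are the Hardy spaces.
\<close>
lemma mem_A_space_1_iff:
  assumes f: "f holomorphic_on ball 0 1" and p: "p > 0"
  shows "f \<in> A_space 1 p \<longleftrightarrow> (\<exists>C. \<forall>r. 0 \<le> r \<longrightarrow> r < 1 \<longrightarrow> mean_pow p f r \<le> C)"
proof -
  define d where "d = deriv (mean_pow p f)"
  have d0: "0 \<le> d r" if "0 < r" "r < 1" for r unfolding d_def using deriv_mean_pow_nonneg[OF f p that] .
  have ft: "(\<integral>\<^sup>+ t \<in> {0<..<r}. ennreal (d t) \<partial>lborel) = ennreal (mean_pow p f r - mean_pow p f 0)" if "0 \<le> r" "r < 1" for r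
    unfolding d_def by (rule nn_integral_deriv_mean_pow[OF f p]) (use that in auto)
  have M0: "mean_pow p f 0 \<ge> 0" by (simp add: mean_pow_0[OF f p])
  have eq: "f \<in> A_space 1 p \<longleftrightarrow> (\<integral>\<^sup>+ t \<in> {0<..<1}. ennreal (d t) \<partial>lborel) < \<infinity>"
  proof -
    have "(\<integral>\<^sup>+ r \<in> {0<..<1}. ennreal (d r * (1 - r) powr (1 - 1)) \<partial>lborel) = (\<integral>\<^sup>+ t \<in> {0<..<1}. ennreal (d t) \<partial>lborel)"
      by (intro nn_integral_cong) (auto split: split_indicator)
    then show ?thesis using f p by (simp add: mem_A_space_iff d_def)
  qed
  show ?thesis unfolding eq
  proof
    assume "(\<integral>\<^sup>+ t \<in> {0<..<1}. ennreal (d t) \<partial>lborel) < \<infinity>"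
    then obtain x where x: "(\<integral>\<^sup>+ t \<in> {0<..<1}. ennreal (d t) \<partial>lborel) = ennreal x" "x \<ge> 0"
      by (cases "\<integral>\<^sup>+ t \<in> {0<..<1}. ennreal (d t) \<partial>lborel") auto
    have "mean_pow p f r \<le> x + mean_pow p f 0" if "0 \<le> r" "r < 1" for r
    proof -
      have "ennreal (mean_pow p f r - mean_pow p f 0) \<le> ennreal x"
        unfolding ft[OF that, symmetric] x(1)[symmetric] using that
        by (intro nn_integral_mono) (auto split: split_indicator)
      then show ?thesis using x by (simp add: ennreal_le_iff)
    qed
    then show "\<exists>C. \<forall>r. 0 \<le> r \<longrightarrow> r < 1 \<longrightarrow> mean_pow p f r \<le> C" by blast
  next
    assume "\<exists>C. \<forall>r. 0 \<le> r \<longrightarrow> r < 1 \<longrightarrow> mean_pow p f r \<le> C"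
    then obtain C where C: "\<And>r. 0 \<le> r \<Longrightarrow> r < 1 \<Longrightarrow> mean_pow p f r \<le> C" by blast
    define e where "e n = 1 - inverse (real (Suc n))" for n
    have e: "0 \<le> e n" "e n < 1" for n by (auto simp: e_def divide_simps)
    have me: "e m \<le> e n" if "m \<le> n" for m n using that by (simp add: e_def le_imp_inverse_le)
    define k where "k t = ennreal (d t) * indicator {0<..<1} t" for t
    have k: "k \<in> borel_measurable lborel"
      using measurable_indicator_continuous[OF continuous_on_deriv_mean_pow[OF f p]] by (simp add: k_def[abs_def] d_def)
    have "t \<in> (\<Union>n. {0<..<e n})" if "t \<in> {0<..<1}" for t
      using reals_Archimedean[of "1 - t"] that by (auto simp: e_def algebra_simps)
    then have "(\<integral>\<^sup>+ t \<in> {0<..<1}. ennreal (d t) \<partial>lborel) = (\<integral>\<^sup>+ t \<in> (\<Union>n. {0<..<e n}). k t \<partial>lborel)"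
      by (intro nn_integral_cong) (auto simp: k_def split: split_indicator)
    also have "\<dots> = (SUP n. \<integral>\<^sup>+ t \<in> {0<..<e n}. k t \<partial>lborel)"
      by (rule nn_integral_UN_incseq[OF k]) (use me in \<open>fastforce simp: incseq_def\<close>)+
    also have "\<dots> = (SUP n. \<integral>\<^sup>+ t \<in> {0<..<e n}. ennreal (d t) \<partial>lborel)"
      using e(2) by (intro SUP_cong nn_integral_cong) (auto simp: k_def split: split_indicator intro: less_trans)
    also have "\<dots> \<le> ennreal C"
    proof (rule SUP_least)
      fix n
      have "mean_pow p f (e n) - mean_pow p f 0 \<le> C" using C[OF e] M0 by (simp add: add_increasing2 diff_le_eq)
      then show "(\<integral>\<^sup>+ t \<in> {0<..<e n}. ennreal (d t) \<partial>lborel) \<le> ennreal C" unfolding ft[OF e] by (rule ennreal_leI)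
    qed
    also have "\<dots> < \<infinity>" by simp
    finally show "(\<integral>\<^sup>+ t \<in> {0<..<1}. ennreal (d t) \<partial>lborel) < \<infinity>" .
  qed
qed

lemma A_space_1_mono:
  assumes pq: "0 < p" "p \<le> q" and f: "f \<in> A_space 1 q"
  shows "f \<in> A_space 1 p"
proof -
  have q: "q > 0" using pq by simp
  have h: "f holomorphic_on ball 0 1" using f q by (simp add: mem_A_space_iff)
  obtain C where C: "\<And>r. 0 \<le> r \<Longrightarrow> r < 1 \<Longrightarrow> mean_pow q f r \<le> C"
    using f mem_A_space_1_iff[OF h q] by blast
  have "mean_pow p f r \<le> 1 + C" if r: "0 \<le> r" "r < 1" for r
  proof -
    have "circ (\<lambda>z. cmod (f z) powr p) r \<le> circ (\<lambda>z. 1 + cmod (f z) powr q) r"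
    proof (rule circ_mono)
      fix z
      show "cmod (f z) powr p \<le> 1 + cmod (f z) powr q"
      proof (cases "cmod (f z) \<le> 1")
        case True
        then have "cmod (f z) powr p \<le> 1 powr p" using pq by (intro powr_mono2) auto
        then show ?thesis by (simp add: add_increasing2)
      next
        case False
        then have "cmod (f z) powr p \<le> cmod (f z) powr q" using pq by (intro powr_mono) auto
        then show ?thesis by simp
      qed
    qed (use r h pq q in \<open>auto intro!: continuous_intros continuous_on_norm_powr\<close>)
    also have "circ (\<lambda>z. 1 + cmod (f z) powr q) r = 2 * pi * 1 + circ (\<lambda>z. cmod (f z) powr q) r"
    proof -
      have "((\<lambda>\<theta>. 1 + cmod (f (rcis r \<theta>)) powr q) has_integral 2 * pi * 1 + circ (\<lambda>z. cmod (f z) powr q) r) {0..2*pi}"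
        using has_integral_const_real[of "1::real" 0 "2*pi"] r h q
        by (intro has_integral_add circ_has_integral continuous_on_norm_powr) auto
      then show ?thesis by (simp add: circ_def integral_unique)
    qed
    finally have "2 * pi * mean_pow p f r \<le> 2 * pi * (1 + mean_pow q f r)"
      unfolding circ_powr_eq_mean_pow[OF h pq(1)] circ_powr_eq_mean_pow[OF h q] by (simp add: algebra_simps)
    then have "mean_pow p f r \<le> 1 + mean_pow q f r" using pi_gt_zero by (subst (asm) mult_le_cancel_left_pos) auto
    then show ?thesis using C[OF r] by simp
  qed
  then show ?thesis using mem_A_space_1_iff[OF h pq(1)] by blast
qed

text \<open>
  If \<open>|f| \<ge> 1\<close>, the Hardy--Stein density increases with the exponent.
\<close>
lemma A_space_mono_bounded_below:
  assumes pq: "0 < p" "p \<le> q" and f: "f \<in> A_space \<alpha> q"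
    and ge: "\<And>z. z \<in> ball 0 1 \<Longrightarrow> 1 \<le> cmod (f z)"
  shows "f \<in> A_space \<alpha> p"
proof -
  have q: "q > 0" using pq by simp
  have h: "f holomorphic_on ball 0 1"
    and fin: "(\<integral>\<^sup>+ r \<in> {0<..<1}. ennreal (deriv (mean_pow q f) r * (1 - r) powr (\<alpha> - 1)) \<partial>lborel) < \<infinity>"
    using f q by (auto simp: mem_A_space_iff)
  have le: "deriv (mean_pow p f) r \<le> p\<^sup>2 / q\<^sup>2 * deriv (mean_pow q f) r" if r: "0 < r" "r < 1" for r
  proof -
    have "hs_mass p f r \<le> hs_mass q f r"
      unfolding hs_mass_def
    proof (rule nn_integral_mono)
      fix z
      show "ennreal (hs_density p f z) * indicator (ball 0 r) z \<le> ennreal (hs_density q f z) * indicator (ball 0 r) z"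
        using ge[of z] r pq
        by (auto split: split_indicator simp: hs_density_def intro!: ennreal_leI mult_right_mono powr_mono)
    qed
    then have "enn2real (hs_mass p f r) \<le> enn2real (hs_mass q f r)"
      using hardy_stein(1)[OF h q r(2)] by (intro enn2real_mono) auto
    then have "p\<^sup>2 / (2 * pi) * enn2real (hs_mass p f r) / r \<le> p\<^sup>2 / (2 * pi) * enn2real (hs_mass q f r) / r"
      using r by (intro divide_right_mono mult_left_mono) auto
    also have "\<dots> = p\<^sup>2 / q\<^sup>2 * (q\<^sup>2 / (2 * pi) * enn2real (hs_mass q f r) / r)" using q by simp
    finally show ?thesis unfolding deriv_mean_pow[OF h pq(1) r] deriv_mean_pow[OF h q r] .
  qed
  have "(\<integral>\<^sup>+ r \<in> {0<..<1}. ennreal (deriv (mean_pow p f) r * (1 - r) powr (\<alpha> - 1)) \<partial>lborel) < \<infinity>"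
  proof (rule nn_integral_finite_compare[OF _ _ _ fin])
    show "(\<lambda>r. ennreal (deriv (mean_pow q f) r * (1 - r) powr (\<alpha> - 1)) * indicator {0<..<1} r) \<in> borel_measurable lborel"
      using continuous_on_deriv_mean_pow[OF h q] by (auto intro!: measurable_indicator_continuous continuous_intros)
    show "ennreal (p\<^sup>2 / q\<^sup>2) < \<infinity>" by simp
    show "AE r in lborel. ennreal (deriv (mean_pow p f) r * (1 - r) powr (\<alpha> - 1)) * indicator {0<..<1} r \<le>
      ennreal (p\<^sup>2 / q\<^sup>2) * (ennreal (deriv (mean_pow q f) r * (1 - r) powr (\<alpha> - 1)) * indicator {0<..<1} r)"
    proof (rule AE_I2)
      fix r :: real
      show "ennreal (deriv (mean_pow p f) r * (1 - r) powr (\<alpha> - 1)) * indicator {0<..<1} r \<le>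
        ennreal (p\<^sup>2 / q\<^sup>2) * (ennreal (deriv (mean_pow q f) r * (1 - r) powr (\<alpha> - 1)) * indicator {0<..<1} r)"
      proof (cases "r \<in> {0<..<1}")
        case True
        then have "deriv (mean_pow p f) r * (1 - r) powr (\<alpha> - 1) \<le> p\<^sup>2 / q\<^sup>2 * deriv (mean_pow q f) r * (1 - r) powr (\<alpha> - 1)"
          by (intro mult_right_mono le) auto
        then show ?thesis
          using True deriv_mean_pow_nonneg[OF h q, of r] by (simp add: ennreal_mult[symmetric] ennreal_leI mult.assoc)
      qed simp
    qed
  qed
  then show ?thesis using h pq by (simp add: mem_A_space_iff)
qed

section \<open>Lacunary series\<close>

lemma exp_minus_le_inverse_square:
  fixes y :: real
  assumes "y > 0"
  shows "exp (- y) \<le> 2 / y\<^sup>2"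
proof -
  have "y\<^sup>2 / 2 \<le> exp y" using exp_lower_Taylor_quadratic[of y] assms by simp
  then have "inverse (exp y) \<le> inverse (y\<^sup>2 / 2)" using assms by (intro le_imp_inverse_le) auto
  then show ?thesis by (simp add: exp_minus)
qed

text \<open>
  Since \<open>r \<le> exp (- x)\<close>, the power is at most \<open>e * exp (- x m)\<close>, and \<open>exp (- y) \<le> 2 / y^2\<close>.
\<close>
lemma power_near_one_upper:
  fixes r x :: real
  assumes r: "0 \<le> r" "r \<le> 1 - x" and x: "0 < x" "x \<le> 1" and m: "m \<ge> 1"
  shows "r ^ (m - 1) \<le> 6 / (x * real m)\<^sup>2"
proof -
  have "r ^ (m - 1) \<le> (exp (- x)) ^ (m - 1)"
    using r exp_ge_add_one_self[of "- x"] by (intro power_mono) auto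
  also have "\<dots> = exp (real (m - 1) * (- x))" by (simp only: exp_of_nat_mult)
  also have "\<dots> = exp x * exp (- (x * real m))" using m by (simp add: of_nat_diff algebra_simps flip: exp_add)
  also have "\<dots> \<le> 3 * (2 / (x * real m)\<^sup>2)"
  proof (rule mult_mono)
    have "exp x \<le> exp 1" using x by simp
    then show "exp x \<le> 3" using exp_le by linarith
    show "exp (- (x * real m)) \<le> 2 / (x * real m)\<^sup>2" using x m by (intro exp_minus_le_inverse_square) auto
  qed auto
  finally show ?thesis by simp
qed

lemma power_near_one_lower:
  fixes r :: real
  assumes r: "1 - 1 / real m \<le> r" and m: "m \<ge> 2"
  shows "1/3 \<le> r ^ (m - 1)"
proof -
  define k where "k = m - 1"
  have k: "k \<ge> 1" "real m = real k + 1" using m by (auto simp: k_def)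
  have "(1 + 1 / real k) ^ k \<le> (exp (1 / real k)) ^ k" by (intro power_mono exp_ge_add_one_self) auto
  also have "\<dots> = exp (real k * (1 / real k))" by (simp only: exp_of_nat_mult)
  also have "\<dots> \<le> 3" using k exp_le by simp
  finally have "(1 + 1 / real k) ^ k \<le> 3" .
  moreover have "1 - 1 / real m = inverse (1 + 1 / real k)" using k by (simp add: field_simps)
  ultimately have "1/3 \<le> (1 - 1 / real m) ^ k"
    using k le_imp_inverse_le[of "(1 + 1 / real k) ^ k" 3] by (simp add: power_inverse add_pos_pos)
  also have "\<dots> \<le> r ^ k" using r m by (intro power_mono) auto
  finally show ?thesis by (simp add: k_def)
qed

lemma inverse_powr_mult:
  fixes X e :: real
  assumes "X > 0"
  shows "(1 / X) powr e * (1 / X) powr 1 = X powr (- e - 1)"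
proof -
  have "(1 / X) powr e * (1 / X) powr 1 = (1 / X) powr (e + 1)" by (simp only: powr_add)
  also have "\<dots> = X powr (- (e + 1))" using assms by (simp only: powr_divide powr_minus_divide powr_one_eq_one)
  finally show ?thesis by simp
qed

lemma ennreal_le_suminf:
  fixes h :: "nat \<Rightarrow> ennreal"
  shows "h j \<le> (\<Sum>i. h i)"
  using sum_le_suminf[of h "{j}"] by simp

text \<open>
  A function whose derivative is a lacunary series with ratio \<open>Q\<close> and coefficients
  \<open>c k = R^k * b k\<close>.  The hypotheses on \<open>R\<close> and \<open>b\<close> say that the \<open>c k\<close> grow at least by the
  factor 17 and at most by the factor \<open>Q\<close> in each step.  This and \<open>Q \<ge> 400\<close> make the \<open>j\<close>-th term
  dominate all others together, for \<open>j \<ge> 1\<close>, where \<open>1 - |z|\<close> is between \<open>Q^(-j)/2\<close> and \<open>Q^(-j)\<close>.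
\<close>
locale lacunary =
  fixes Q :: nat and R :: real and b :: "nat \<Rightarrow> real" and f :: "complex \<Rightarrow> complex"
  assumes Q: "400 \<le> Q" and R: "0 < R" "R \<le> real Q"
    and b: "\<And>k. 0 < b k" "\<And>k. b (Suc k) \<le> b k" "\<And>k. 17 * b k \<le> R * b (Suc k)"
    and f: "f holomorphic_on ball 0 1"
    and deriv_sums: "\<And>z. z \<in> ball 0 1 \<Longrightarrow> (\<lambda>k. of_real (R ^ k * b k) * z ^ (Q ^ k - 1)) sums deriv f z"
begin

text \<open>
  The \<open>k\<close>-th coefficient of the derivative.
\<close>
definition c :: "nat \<Rightarrow> real" where "c k = R ^ k * b k"

lemma c_pos: "0 < c k" using R b by (simp add: c_def)

lemma sum_c_le: "(\<Sum>k<j. c k) \<le> c j / 16"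
proof (induction j)
  case 0
  then show ?case using c_pos[of 0] by simp
next
  case (Suc j)
  have "R ^ j * (17 * b j) \<le> R ^ j * (R * b (Suc j))" using R b by (intro mult_left_mono) auto
  then have "17 * c j \<le> c (Suc j)" by (simp add: c_def mult_ac)
  then show ?case using Suc by simp
qed

lemma c_le: "c (j + i) \<le> real Q ^ i * c j"
proof (induction i)
  case (Suc i)
  have "c (j + Suc i) = R * (R ^ (j + i) * b (Suc (j + i)))" by (simp add: c_def)
  also have "\<dots> \<le> real Q * (R ^ (j + i) * b (j + i))"
    using R b[of "j + i"] less_imp_le[OF b(1)] by (intro mult_mono mult_left_mono) auto
  also have "\<dots> \<le> real Q * (real Q ^ i * c j)" using Suc by (intro mult_left_mono) (auto simp: c_def)
  finally show ?case by simp
qed simp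

text \<open>
  The terms below the \<open>j\<close>-th contribute at most \<open>c j / 16\<close>, by geometric growth.  In the terms
  above it the decay of \<open>|z|^(Q^k)\<close> beats the growth of \<open>c k\<close>.
\<close>
lemma deriv_approx:
  assumes z: "z \<in> ball 0 1" "cmod z \<le> 1 - 1 / (\<kappa> * real Q ^ j)" and \<kappa>: "\<kappa> \<ge> 1"
  shows "cmod (deriv f z - of_real (c j) * z ^ (Q ^ j - 1)) \<le> (1/16 + 6 * \<kappa>\<^sup>2 / (real Q - 1)) * c j"
proof -
  define t where "t k = of_real (c k) * z ^ (Q ^ k - 1)" for k
  define r where "r = cmod z"
  have r: "0 \<le> r" "r < 1" using z by (auto simp: r_def)
  have Q1: "real Q > 1" using Q by simp
  have s: "t sums deriv f z" using deriv_sums[OF z(1)] by (simp add: t_def[abs_def] c_def)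
  have tail: "(\<lambda>i. t (i + Suc j)) sums (deriv f z - (\<Sum>k<Suc j. t k))" by (rule sums_split_initial_segment[OF s])
  have nt: "cmod (t k) = c k * r ^ (Q ^ k - 1)" for k
    using c_pos[of k] by (simp add: t_def norm_mult norm_power r_def)
  have "(\<lambda>i. 6 * \<kappa>\<^sup>2 * c j * (1 / real Q) * (1 / real Q) ^ i) sums (6 * \<kappa>\<^sup>2 * c j * (1 / real Q) * (1 / (1 - 1 / real Q)))"
    using Q1 by (intro sums_mult geometric_sums) auto
  moreover have "6 * \<kappa>\<^sup>2 * c j * (1 / real Q) * (1 / (1 - 1 / real Q)) = 6 * \<kappa>\<^sup>2 / (real Q - 1) * c j"
    using Q1 by (simp add: field_simps)
  ultimately have geo: "(\<lambda>i. 6 * \<kappa>\<^sup>2 * c j * (1 / real Q) * (1 / real Q) ^ i) sums (6 * \<kappa>\<^sup>2 / (real Q - 1) * c j)" by (simp only:)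
  have "cmod (deriv f z - (\<Sum>k<Suc j. t k)) \<le> 6 * \<kappa>\<^sup>2 / (real Q - 1) * c j"
  proof (rule norm_sums_le[OF tail geo])
    fix i
    define x where "x = 1 / (\<kappa> * real Q ^ j)"
    have "1 \<le> \<kappa> * real Q ^ j" using \<kappa> Q1 by (smt (verit) mult_le_cancel_left1 one_le_power)
    then have x: "0 < x" "x \<le> 1" by (auto simp: x_def)
    have "r ^ (Q ^ (j + Suc i) - 1) \<le> 6 / (x * real (Q ^ (j + Suc i)))\<^sup>2"
      using z r x Q by (intro power_near_one_upper) (auto simp: r_def x_def)
    also have "x * real (Q ^ (j + Suc i)) = real Q ^ Suc i / \<kappa>" using Q1 by (simp add: x_def power_add)
    also have "6 / (real Q ^ Suc i / \<kappa>)\<^sup>2 = 6 * \<kappa>\<^sup>2 / (real Q ^ Suc i)\<^sup>2" by (simp add: power_divide)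
    finally have pw: "r ^ (Q ^ (j + Suc i) - 1) \<le> 6 * \<kappa>\<^sup>2 / (real Q ^ Suc i)\<^sup>2" .
    have "c (j + Suc i) * r ^ (Q ^ (j + Suc i) - 1) \<le> (real Q ^ Suc i * c j) * (6 * \<kappa>\<^sup>2 / (real Q ^ Suc i)\<^sup>2)"
    proof (rule mult_mono)
      show "0 \<le> real Q ^ Suc i * c j" using less_imp_le[OF c_pos] by (intro mult_nonneg_nonneg) auto
    qed (use c_le[of j "Suc i"] pw r in simp_all)
    also have "\<dots> = 6 * \<kappa>\<^sup>2 * c j * (1 / real Q) * (1 / real Q) ^ i"
      using Q1 by (simp add: power2_eq_square power_divide)
    finally show "cmod (t (i + Suc j)) \<le> 6 * \<kappa>\<^sup>2 * c j * (1 / real Q) * (1 / real Q) ^ i"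
      unfolding nt by (simp add: add.commute)
  qed
  moreover have "cmod (\<Sum>k<j. t k) \<le> c j / 16"
  proof -
    have "cmod (\<Sum>k<j. t k) \<le> (\<Sum>k<j. c k)"
    proof (rule sum_norm_le)
      fix k
      have "r ^ (Q ^ k - 1) \<le> 1" using r by (intro power_le_one) auto
      then show "cmod (t k) \<le> c k" unfolding nt using c_pos[of k] by (simp add: mult_left_le)
    qed
    then show ?thesis using sum_c_le[of j] by simp
  qed
  moreover have "deriv f z - of_real (c j) * z ^ (Q ^ j - 1) = (deriv f z - (\<Sum>k<Suc j. t k)) + (\<Sum>k<j. t k)"
    by (simp add: t_def)
  ultimately have "cmod (deriv f z - of_real (c j) * z ^ (Q ^ j - 1)) \<le> 6 * \<kappa>\<^sup>2 / (real Q - 1) * c j + c j / 16"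
    by (metis add_mono norm_triangle_le)
  then show ?thesis by (simp add: algebra_simps)
qed

lemma norm_deriv_lower:
  assumes z: "1 - 1 / real Q ^ j \<le> cmod z" "cmod z \<le> 1 - 1 / (2 * real Q ^ j)" and j: "j \<ge> 1"
  shows "c j / 8 \<le> cmod (deriv f z)"
proof -
  have Q1: "real Q \<ge> 400" using Q by simp
  have "1 / (2 * real Q ^ j) > 0" using Q1 by simp
  then have "cmod z < 1" using z by linarith
  then have zb: "z \<in> ball 0 1" by simp
  have "cmod (deriv f z - of_real (c j) * z ^ (Q ^ j - 1)) \<le> (1/16 + 6 * 2\<^sup>2 / (real Q - 1)) * c j"
    using z zb by (intro deriv_approx) auto
  also have "\<dots> \<le> (1/16 + 1/16) * c j"
    using Q1 c_pos[of j] by (intro mult_right_mono) (auto simp: field_simps)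
  finally have 1: "cmod (deriv f z - of_real (c j) * z ^ (Q ^ j - 1)) \<le> c j / 8" by simp
  have "Q ^ j \<ge> Q ^ 1" using Q j by (intro power_increasing) auto
  then have "1/3 \<le> cmod z ^ (Q ^ j - 1)" using z Q by (intro power_near_one_lower) auto
  then have "c j * (1/3) \<le> c j * cmod z ^ (Q ^ j - 1)" using c_pos[of j] by (intro mult_left_mono) auto
  also have "\<dots> = cmod (of_real (c j) * z ^ (Q ^ j - 1))" using c_pos[of j] by (simp add: norm_mult norm_power)
  finally have 2: "c j / 3 \<le> cmod (of_real (c j) * z ^ (Q ^ j - 1))" by simp
  have "cmod (of_real (c j) * z ^ (Q ^ j - 1)) \<le> cmod (deriv f z) + cmod (deriv f z - of_real (c j) * z ^ (Q ^ j - 1))"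
    by (metis norm_minus_commute norm_triangle_sub)
  then show ?thesis using 1 2 c_pos[of j] by linarith
qed

text \<open>
  A constant with \<open>|f'| \<le> K * c j\<close> for \<open>1 - |z| \<ge> 1 / Q^(j+1)\<close>.
\<close>
definition K :: real where "K = 2 + 6 * (real Q)\<^sup>2 / (real Q - 1)"

lemma K_pos: "K > 0" using Q by (simp add: K_def add_pos_nonneg)

lemma norm_deriv_upper:
  assumes z: "cmod z \<le> 1 - 1 / real Q ^ Suc j"
  shows "cmod (deriv f z) \<le> K * c j"
proof -
  have Q1: "real Q \<ge> 400" using Q by simp
  have "1 / real Q ^ Suc j > 0" using Q1 by (intro divide_pos_pos zero_less_power) auto
  then have "cmod z < 1" using z by linarith
  then have zb: "z \<in> ball 0 1" by simp
  have 1: "cmod (deriv f z - of_real (c j) * z ^ (Q ^ j - 1)) \<le> (1/16 + 6 * (real Q)\<^sup>2 / (real Q - 1)) * c j"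
    using z zb Q1 by (intro deriv_approx) auto
  have "cmod (of_real (c j) * z ^ (Q ^ j - 1)) \<le> c j"
    using c_pos[of j] zb by (simp add: norm_mult norm_power mult_left_le power_le_one)
  moreover have "cmod (deriv f z) \<le> cmod (of_real (c j) * z ^ (Q ^ j - 1)) + cmod (deriv f z - of_real (c j) * z ^ (Q ^ j - 1))"
    by (rule norm_triangle_sub)
  ultimately have "cmod (deriv f z) \<le> c j + (1/16 + 6 * (real Q)\<^sup>2 / (real Q - 1)) * c j" using 1 by linarith
  also have "\<dots> \<le> K * c j" unfolding K_def using c_pos[of j] by (simp add: algebra_simps)
  finally show ?thesis .
qed


lemma deriv_mean_bounds:
  assumes p: "p > 0" and s: "0 \<le> s" "s < 1"
  shows "\<And>B. B \<ge> 0 \<Longrightarrow> (\<And>z. cmod z = s \<Longrightarrow> cmod (deriv f z) \<le> B) \<Longrightarrow> mean_pow p (deriv f) s \<le> B powr p"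
    and "\<And>B. B \<ge> 0 \<Longrightarrow> (\<And>z. cmod z = s \<Longrightarrow> B \<le> cmod (deriv f z)) \<Longrightarrow> B powr p \<le> mean_pow p (deriv f) s"
proof -
  have f': "deriv f holomorphic_on ball 0 1" using f by (simp add: holomorphic_deriv)
  note c = continuous_on_norm_powr[OF f' p]
  fix B :: real assume B: "B \<ge> 0"
  show "mean_pow p (deriv f) s \<le> B powr p" if "\<And>z. cmod z = s \<Longrightarrow> cmod (deriv f z) \<le> B"
  proof -
    have "circ (\<lambda>z. cmod (deriv f z) powr p) s \<le> circ (\<lambda>z. B powr p) s"
      using that p by (intro circ_mono c s) (auto intro: powr_mono2)
    then show ?thesis by (simp add: mean_pow_eq_circ circ_const divide_le_eq mult.commute)
  qed
  show "B powr p \<le> mean_pow p (deriv f) s" if "\<And>z. cmod z = s \<Longrightarrow> B \<le> cmod (deriv f z)"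
  proof -
    have "circ (\<lambda>z. B powr p) s \<le> circ (\<lambda>z. cmod (deriv f z) powr p) s"
      using that p B by (intro circ_mono c s) (auto intro: powr_mono2)
    then show ?thesis by (simp add: mean_pow_eq_circ circ_const le_divide_eq mult.commute)
  qed
qed

text \<open>
  The contribution, up to constant factors, of the annulus where \<open>1 - |z|\<close> is comparable to
  \<open>Q^(-j)\<close> to the B-norm: there \<open>|f'|^p\<close> is comparable to \<open>c j ^ p\<close>, the weight to
  \<open>Q^(-j (\<alpha>+p-2))\<close>, and the width of the annulus to \<open>Q^(-j)\<close>.
\<close>
definition besov_term :: "real \<Rightarrow> real \<Rightarrow> nat \<Rightarrow> real" where
  "besov_term \<alpha> p j = c j powr p * (real Q ^ j) powr (1 - \<alpha> - p)"

lemma exists_annulus: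
  assumes "0 \<le> s" "s < 1"
  obtains j where "1 - 1 / real Q ^ j \<le> s" "s < 1 - 1 / real Q ^ Suc j"
proof -
  have Q1: "real Q \<ge> 400" using Q by simp
  have ex: "\<exists>j. s < 1 - 1 / real Q ^ Suc j"
  proof -
    obtain n where n: "(1 / real Q) ^ n < 1 - s" using real_arch_pow_inv[of "1 - s" "1 / real Q"] assms Q1 by auto
    have "(1 / real Q) ^ Suc n \<le> (1 / real Q) ^ n" using Q1 by (intro power_decreasing) auto
    then have "s < 1 - (1 / real Q) ^ Suc n" using n by linarith
    then show ?thesis by (auto simp: power_one_over)
  qed
  define j where "j = (LEAST j. s < 1 - 1 / real Q ^ Suc j)"
  have 1: "s < 1 - 1 / real Q ^ Suc j" unfolding j_def using ex by (rule LeastI_ex)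
  have "1 - 1 / real Q ^ j \<le> s"
  proof (cases j)
    case (Suc i)
    then have "\<not> s < 1 - 1 / real Q ^ Suc i" using not_less_Least[of i "\<lambda>j. s < 1 - 1 / real Q ^ Suc j"] by (simp add: j_def)
    then show ?thesis using Suc by simp
  qed (use assms in simp)
  then show ?thesis using 1 that by blast
qed

lemma mem_B_space_radial:
  assumes "p > 0" "\<alpha> + p > 1"
  shows "f \<in> B_space \<alpha> p \<longleftrightarrow>
    (\<integral>\<^sup>+ s \<in> {0<..<1}. ennreal (2 * pi * s * (1 - s) powr (\<alpha> + p - 2) * mean_pow p (deriv f) s) \<partial>lborel) < \<infinity>"
  using f by (simp add: mem_B_space_iff assms besov_integral_polar)

lemma mem_B_space_if_summable:
  assumes p: "p > 0" and \<alpha>: "\<alpha> + p > 1" and x: "summable (besov_term \<alpha> p)"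
  shows "f \<in> B_space \<alpha> p"
proof -
  have Q1: "real Q \<ge> 400" using Q by simp
  define e where "e = \<alpha> + p - 2"
  define C where "C = 2 * pi * K powr p * real Q powr \<bar>e\<bar>"
  have x0: "0 \<le> besov_term \<alpha> p j" for j by (simp add: besov_term_def)
  define J where "J j = {1 - 1 / real Q ^ j..<1 - 1 / real Q ^ Suc j}" for j
  have f': "deriv f holomorphic_on ball 0 1" using f by (simp add: holomorphic_deriv)
  define F where "F s = 2 * pi * s * (1 - s) powr e * mean_pow p (deriv f) s" for s
  define y where "y j = 2 * pi * (real Q powr \<bar>e\<bar> * (1 / real Q ^ j) powr e) * (K * c j) powr p" for j
  have F: "F s \<le> y j" if s: "0 < s" "s \<in> J j" for s j
  proof -
    have "1 / real Q ^ Suc j > 0" using Q1 by (intro divide_pos_pos zero_less_power) auto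
    moreover have "s < 1 - 1 / real Q ^ Suc j" using s unfolding J_def by (simp only: atLeastLessThan_iff)
    ultimately have s1: "s < 1" by linarith
    have N: "mean_pow p (deriv f) s \<le> (K * c j) powr p"
      using s s1 K_pos c_pos[of j] by (intro deriv_mean_bounds(1)[OF p] norm_deriv_upper) (auto simp: J_def)
    have N0: "0 \<le> mean_pow p (deriv f) s" using mean_pow_nonneg[OF f' p] s s1 by auto
    have W: "(1 - s) powr e \<le> real Q powr \<bar>e\<bar> * (1 / real Q ^ j) powr e"
    proof (rule powr_comparable)
      have "1 - s \<le> 1 / real Q ^ j" using s by (simp add: J_def)
      also have "\<dots> \<le> real Q * (1 / real Q ^ j)" using Q1 by (simp add: divide_right_mono)
      finally show "1 - s \<le> real Q * (1 / real Q ^ j)" .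
      have "1 / real Q ^ j = real Q * (1 / real Q ^ Suc j)" using Q1 by simp
      also have "\<dots> \<le> real Q * (1 - s)" using s Q1 by (intro mult_left_mono) (auto simp: J_def)
      finally show "1 / real Q ^ j \<le> real Q * (1 - s)" .
    qed (use s1 Q1 in auto)
    have A: "2 * pi * s \<le> 2 * pi" using s1 by simp
    have "2 * pi * s * (1 - s) powr e \<le> 2 * pi * (real Q powr \<bar>e\<bar> * (1 / real Q ^ j) powr e)"
      by (rule mult_mono[OF A W]) auto
    then show ?thesis unfolding F_def y_def by (rule mult_mono[OF _ N _ N0]) auto
  qed
  have "(\<integral>\<^sup>+ s \<in> {0<..<1}. ennreal (F s) \<partial>lborel) \<le>
     (\<integral>\<^sup>+ s. (\<Sum>j. ennreal (y j) * indicator (J j) s) \<partial>lborel)"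
  proof (rule nn_integral_mono)
    fix s :: real
    show "ennreal (F s) * indicator {0<..<1} s \<le>
      (\<Sum>j. ennreal (y j) * indicator (J j) s)" (is "_ \<le> (\<Sum>j. ?t j)")
    proof (cases "s \<in> {0<..<1}")
      case True
      then obtain j where j: "s \<in> J j" using exists_annulus[of s] by (auto simp: J_def)
      have "ennreal (F s) * indicator {0<..<1} s \<le> ?t j"
        using F[OF _ j] True j by (auto intro!: ennreal_leI)
      also have "\<dots> \<le> (\<Sum>j. ?t j)" by (rule ennreal_le_suminf)
      finally show ?thesis .
    qed simp
  qed
  also have "\<dots> = (\<Sum>j. \<integral>\<^sup>+ s. ennreal (y j) * indicator (J j) s \<partial>lborel)"
    by (rule nn_integral_suminf) (auto simp: J_def)
  also have "\<dots> \<le> (\<Sum>j. ennreal (C * besov_term \<alpha> p j))"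
  proof (rule suminf_le)
    fix j
    have len: "emeasure lborel (J j) \<le> ennreal (1 / real Q ^ j)"
    proof -
      have "1 / real Q ^ Suc j \<le> 1 / real Q ^ j" using Q1 by (intro divide_left_mono power_increasing) auto
      moreover have "0 \<le> 1 / real Q ^ Suc j" by simp
      ultimately show ?thesis unfolding J_def by (subst emeasure_lborel_Ico) (auto intro!: ennreal_leI)
    qed
    have "(\<integral>\<^sup>+ s. ennreal (y j) * indicator (J j) s \<partial>lborel)
      = ennreal (y j) * emeasure lborel (J j)"
      by (rule nn_integral_cmult_indicator) (simp add: J_def)
    also have "\<dots> \<le> ennreal (y j) * ennreal (1 / real Q ^ j)"
      by (intro mult_left_mono len) auto
    also have "\<dots> = ennreal (y j * (1 / real Q ^ j))"
      using Q1 by (subst ennreal_mult''[symmetric]) (auto simp: y_def)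
    also have "y j * (1 / real Q ^ j) = C * (c j powr p * ((1 / real Q ^ j) powr e * (1 / real Q ^ j) powr 1))"
      using K_pos c_pos[of j] Q1 by (simp add: C_def y_def powr_mult)
    also have "(1 / real Q ^ j) powr e * (1 / real Q ^ j) powr 1 = (real Q ^ j) powr (1 - \<alpha> - p)"
    proof -
      have "- e - 1 = 1 - \<alpha> - p" by (simp add: e_def)
      then show ?thesis using inverse_powr_mult[of "real Q ^ j" e] Q1 by (simp only:) simp
    qed
    finally show "(\<integral>\<^sup>+ s. ennreal (y j) * indicator (J j) s \<partial>lborel)
       \<le> ennreal (C * besov_term \<alpha> p j)" by (simp add: besov_term_def)
  qed auto
  also have "\<dots> = ennreal (\<Sum>j. C * besov_term \<alpha> p j)"
    using x x0 Q1 by (intro suminf_ennreal2 summable_mult) (auto simp: C_def intro!: mult_nonneg_nonneg)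
  also have "\<dots> < \<infinity>" by simp
  finally show ?thesis using mem_B_space_radial[OF p \<alpha>] by (simp add: F_def e_def)
qed

lemma summable_if_mem_B_space:
  assumes p: "p > 0" and \<alpha>: "\<alpha> + p > 1" and B: "f \<in> B_space \<alpha> p"
  shows "summable (besov_term \<alpha> p)"
proof -
  have Q1: "real Q \<ge> 400" using Q by simp
  define e where "e = \<alpha> + p - 2"
  define C where "C = pi * 2 powr (- \<bar>e\<bar>) * (1/8) powr p / 2"
  have C: "C > 0" by (simp add: C_def)
  define J where "J j = {1 - 1 / real Q ^ Suc j..1 - 1 / (2 * real Q ^ Suc j)}" for j
  have f': "deriv f holomorphic_on ball 0 1" using f by (simp add: holomorphic_deriv)
  define F where "F s = 2 * pi * s * (1 - s) powr e * mean_pow p (deriv f) s" for s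
  define y where "y j = pi * (2 powr (- \<bar>e\<bar>) * (1 / real Q ^ j) powr e) * (c j / 8) powr p" for j
  have J01: "1/2 \<le> s \<and> s < 1" if "s \<in> J j" for s j
  proof -
    have "1 / real Q ^ Suc j \<le> 1 / real Q ^ 1" using Q1 by (intro divide_left_mono power_increasing) auto
    also have "\<dots> \<le> 1/2" using Q1 by (simp add: field_simps)
    finally have "1/2 \<le> 1 - 1 / real Q ^ Suc j" by simp
    moreover have "0 < 1 / (2 * real Q ^ Suc j)" using Q1 by (intro divide_pos_pos mult_pos_pos zero_less_power) auto
    moreover have "1 - 1 / real Q ^ Suc j \<le> s" "s \<le> 1 - 1 / (2 * real Q ^ Suc j)"
      using that unfolding J_def by (simp_all only: atLeastAtMost_iff)
    ultimately show ?thesis by linarith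
  qed
  have F: "y (Suc j) \<le> F s" if s: "s \<in> J j" for s j
  proof -
    have s1: "1/2 \<le> s" "s < 1" using J01[OF s] by auto
    have N: "(c (Suc j) / 8) powr p \<le> mean_pow p (deriv f) s"
      using s s1 c_pos[of "Suc j"] by (intro deriv_mean_bounds(2)[OF p] norm_deriv_lower) (auto simp: J_def)
    have "(1 / real Q ^ Suc j) powr e \<le> 2 powr \<bar>e\<bar> * (1 - s) powr e"
    proof (rule powr_comparable)
      have "1 - s \<le> 1 / real Q ^ Suc j" using s by (simp add: J_def)
      also have "\<dots> \<le> 2 * (1 / real Q ^ Suc j)" using Q1 by (simp add: divide_right_mono)
      finally show "1 - s \<le> 2 * (1 / real Q ^ Suc j)" .
      have "1 / real Q ^ Suc j = 2 * (1 / (2 * real Q ^ Suc j))" by simp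
      also have "\<dots> \<le> 2 * (1 - s)" using s unfolding J_def by (intro mult_left_mono) auto
      finally show "1 / real Q ^ Suc j \<le> 2 * (1 - s)" .
      show "0 < 1 / real Q ^ Suc j" using Q1 by (intro divide_pos_pos zero_less_power) auto
    qed (use s1 in auto)
    then have "2 powr (- \<bar>e\<bar>) * (1 / real Q ^ Suc j) powr e \<le> 2 powr (- \<bar>e\<bar>) * (2 powr \<bar>e\<bar> * (1 - s) powr e)"
      by (intro mult_left_mono) auto
    also have "\<dots> = (1 - s) powr e" by (simp add: powr_minus)
    finally have w: "2 powr (- \<bar>e\<bar>) * (1 / real Q ^ Suc j) powr e \<le> (1 - s) powr e" .
    have "pi * 1 \<le> pi * (2 * s)" using s1 by (intro mult_left_mono) auto
    then have "pi \<le> 2 * pi * s" by simp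
    then show ?thesis unfolding F_def y_def using N w s1 by (intro mult_mono) auto
  qed
  have disj: "disjoint_family J"
  proof -
    have "J i \<inter> J j = {}" if "i < j" for i j
    proof -
      have "2 * real Q ^ Suc i < real Q * real Q ^ Suc i" using Q1 by (intro mult_strict_right_mono zero_less_power) auto
      also have "\<dots> = real Q ^ Suc (Suc i)" by simp
      also have "\<dots> \<le> real Q ^ Suc j" using that Q1 by (intro power_increasing) auto
      finally have "1 / real Q ^ Suc j < 1 / (2 * real Q ^ Suc i)"
        using Q1 by (intro divide_strict_left_mono mult_pos_pos zero_less_power) auto
      then show ?thesis by (auto simp: J_def)
    qed
    then show ?thesis unfolding disjoint_family_on_def by (metis inf_commute nat_neq_iff)
  qed
  have "(\<Sum>j. ennreal (y (Suc j)) * ennreal (1 / (2 * real Q ^ Suc j))) = (\<Sum>j. \<integral>\<^sup>+ s. ennreal (y (Suc j)) * indicator (J j) s \<partial>lborel)"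
  proof (rule arg_cong[where f = suminf], rule ext)
    fix j
    have a: "0 \<le> 1 / (2 * real Q ^ Suc j)" by simp
    have b: "1 / real Q ^ Suc j = 1 / (2 * real Q ^ Suc j) + 1 / (2 * real Q ^ Suc j)" by simp
    have "emeasure lborel (J j) = ennreal (1 / (2 * real Q ^ Suc j))"
      unfolding J_def using a b by (subst emeasure_lborel_Icc) (linarith, simp only: b, simp)
    then show "ennreal (y (Suc j)) * ennreal (1 / (2 * real Q ^ Suc j)) = (\<integral>\<^sup>+ s. ennreal (y (Suc j)) * indicator (J j) s \<partial>lborel)"
      by (subst nn_integral_cmult_indicator) (auto simp: J_def)
  qed
  also have "\<dots> = (\<integral>\<^sup>+ s. (\<Sum>j. ennreal (y (Suc j)) * indicator (J j) s) \<partial>lborel)"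
    by (rule nn_integral_suminf[symmetric]) (auto simp: J_def)
  also have "\<dots> \<le> (\<integral>\<^sup>+ s \<in> {0<..<1}. ennreal (F s) \<partial>lborel)"
  proof (rule nn_integral_mono)
    fix s :: real
    show "(\<Sum>j. ennreal (y (Suc j)) * indicator (J j) s) \<le> ennreal (F s) * indicator {0<..<1} s"
    proof (cases "\<exists>j. s \<in> J j")
      case True
      then obtain j where j: "s \<in> J j" by blast
      have "(\<Sum>j. ennreal (y (Suc j)) * indicator (J j) s) = ennreal (y (Suc j))"
        by (rule suminf_cmult_indicator[OF disj j])
      then show ?thesis using F[OF j] J01[OF j] by (auto intro!: ennreal_leI)
    next
      case False
      then show ?thesis by simp
    qed
  qed
  also have "\<dots> < \<infinity>" using B mem_B_space_radial[OF p \<alpha>] by (simp add: F_def e_def)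
  finally have fin: "(\<Sum>j. ennreal (y (Suc j)) * ennreal (1 / (2 * real Q ^ Suc j))) < \<infinity>" .
  have yx: "y j * (1 / (2 * real Q ^ j)) = C * besov_term \<alpha> p j" for j
  proof -
    have "y j * (1 / (2 * real Q ^ j)) = C * (c j powr p * ((1 / real Q ^ j) powr e * (1 / real Q ^ j) powr 1))"
      using c_pos[of j] Q1 by (simp add: C_def y_def powr_divide)
    also have "(1 / real Q ^ j) powr e * (1 / real Q ^ j) powr 1 = (real Q ^ j) powr (1 - \<alpha> - p)"
    proof -
      have "- e - 1 = 1 - \<alpha> - p" by (simp add: e_def)
      then show ?thesis using inverse_powr_mult[of "real Q ^ j" e] Q1 by (simp only:) simp
    qed
    finally show ?thesis by (simp add: besov_term_def)
  qed
  have "(\<Sum>j. ennreal (C * besov_term \<alpha> p (Suc j))) \<noteq> \<infinity>"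
  proof -
    have "ennreal (C * besov_term \<alpha> p (Suc j)) = ennreal (y (Suc j)) * ennreal (1 / (2 * real Q ^ Suc j))" for j
      unfolding yx[symmetric] by (rule ennreal_mult'') simp
    then show ?thesis using fin by simp
  qed
  then have "summable (\<lambda>j. C * besov_term \<alpha> p (Suc j))"
    using C by (intro summable_suminf_not_top) (auto simp: besov_term_def)
  then have "summable (\<lambda>j. besov_term \<alpha> p (Suc j))" using C by (simp add: summable_cmult_iff)
  then show ?thesis by (simp add: summable_Suc_iff)
qed

end

lemma gap_series_exists:
  fixes a :: "nat \<Rightarrow> real"
  assumes a: "\<And>k. 0 \<le> a k" "\<And>k. a k \<le> 1" and Q: "Q \<ge> 2"
  obtains g where "g holomorphic_on ball 0 1"
    "\<And>z. z \<in> ball 0 1 \<Longrightarrow> (\<lambda>k. of_real (a k) * z ^ (Q ^ k)) sums g z"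
    "\<And>z. z \<in> ball 0 1 \<Longrightarrow> (\<lambda>k. of_real (a k * real Q ^ k) * z ^ (Q ^ k - 1)) sums deriv g z"
proof -
  let ?t = "\<lambda>k z :: complex. of_real (a k) * z ^ (Q ^ k)"
  let ?t' = "\<lambda>k z :: complex. of_real (a k * real Q ^ k) * z ^ (Q ^ k - 1)"
  have "\<exists>g g'. \<forall>x \<in> ball 0 1. ((\<lambda>k. ?t k x) sums g x) \<and> ((\<lambda>k. ?t' k x) sums g' x) \<and> (g has_field_derivative g' x) (at x)"
  proof (rule series_and_derivative_comparison_complex)
    fix k and x :: complex
    show "(?t k has_field_derivative ?t' k x) (at x)"
      by (auto intro!: derivative_eq_intros)
  next
    fix x :: complex assume x: "x \<in> ball 0 1"
    define d where "d = (1 - cmod x) / 2"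
    define r where "r = (1 + cmod x) / 2"
    have dr: "d > 0" "0 \<le> r" "r < 1" using x by (auto simp: d_def r_def)
    show "\<exists>d h. 0 < d \<and> summable h \<and> range h \<subseteq> \<real>\<^sub>\<ge>\<^sub>0 \<and>
       (\<forall>\<^sub>F k in sequentially. \<forall>y\<in>ball x d \<inter> ball 0 1. cmod (?t k y) \<le> cmod (h k))"
    proof (intro exI[of _ d] exI[of _ "\<lambda>k. complex_of_real (r ^ k)"] conjI always_eventually allI ballI)
      show "summable (\<lambda>k. complex_of_real (r ^ k))" using dr by (intro summable_of_real summable_geometric) auto
      show "range (\<lambda>k. complex_of_real (r ^ k)) \<subseteq> \<real>\<^sub>\<ge>\<^sub>0" using dr by auto
      fix k y assume y: "y \<in> ball x d \<inter> ball 0 1"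
      have "cmod y \<le> cmod x + cmod (y - x)" by (metis norm_triangle_sub)
      then have yr: "cmod y \<le> r" using y by (simp add: dist_norm norm_minus_commute d_def r_def field_simps)
      have "k \<le> Q ^ k" using Q by (intro less_imp_le power_gt_expt) auto
      then have "r ^ (Q ^ k) \<le> r ^ k" using dr by (intro power_decreasing) auto
      moreover have "cmod (?t k y) \<le> 1 * r ^ (Q ^ k)"
        unfolding norm_mult norm_power using a yr by (intro mult_mono power_mono) auto
      ultimately show "cmod (?t k y) \<le> cmod (complex_of_real (r ^ k))" using dr by (simp add: norm_power)
    qed (use dr in auto)
  qed auto
  then obtain g g' where g: "\<And>x. x \<in> ball 0 1 \<Longrightarrow> (\<lambda>k. ?t k x) sums g x"
    "\<And>x. x \<in> ball 0 1 \<Longrightarrow> (\<lambda>k. ?t' k x) sums g' x" "\<And>x. x \<in> ball 0 1 \<Longrightarrow> (g has_field_derivative g' x) (at x)"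
    by blast
  show ?thesis
  proof (rule that[of g])
    show "g holomorphic_on ball 0 1" unfolding holomorphic_on_open[OF open_ball] using g(3) by blast
    show "(\<lambda>k. ?t' k z) sums deriv g z" if "z \<in> ball 0 1" for z
      using g(2)[OF that] DERIV_imp_deriv[OF g(3)[OF that]] by simp
  qed (rule g(1))
qed

text \<open>
  The series has coefficients \<open>a k = Q^(-k (1-\<alpha>)/2) * (k+1)^(-1/m)\<close>.  Its \<open>j\<close>-th Besov term for
  the exponent \<open>p\<close> is \<open>Q^(j (1-\<alpha>) (1-p/2)) * (j+1)^(-p/m)\<close>.  For \<open>p = m \<le> 2\<close> this is at
  least \<open>1/(j+1)\<close>, and for \<open>p = M \<ge> 2\<close> at most \<open>(j+1)^(-M/m)\<close>, which is summable.
  If \<open>\<alpha> < 1\<close>, then the \<open>a k\<close> are summable, and adding the constant \<open>1 + \<Sum> a k\<close> gives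
  \<open>|f| \<ge> 1\<close>.
\<close>
lemma besov_separation:
  assumes \<alpha>: "0 < \<alpha>" "\<alpha> \<le> 1" and m: "0 < m" "m \<le> 2" "2 \<le> M" "m < M" "\<alpha> + m > 1"
  shows "\<exists>f. f \<in> B_space \<alpha> M \<and> f \<notin> B_space \<alpha> m \<and> (\<alpha> < 1 \<longrightarrow> (\<forall>z \<in> ball 0 1. 1 \<le> cmod (f z)))"
proof -
  define L where "L = 2 powr (1 / m)"
  have L: "L \<ge> 1" using m by (simp add: L_def ge_one_powr_ge_zero)
  obtain Q :: nat where Qr: "(17 * L)\<^sup>2 + 400 \<le> real Q" using real_arch_simple by blast
  have Q4: "400 \<le> Q" and QL: "(17 * L)\<^sup>2 \<le> real Q" 
  proof -
    have "400 \<le> real Q" using Qr zero_le_power2[of "17 * L"] by linarith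
    then show "400 \<le> Q" by simp
    show "(17 * L)\<^sup>2 \<le> real Q" using Qr by linarith
  qed
  \<comment> \<open>The derivative has coefficients \<open>a k * Q^k = R^k * b k\<close> with \<open>R = Q^((1+\<alpha>)/2)\<close>.\<close>
  define \<gamma> where "\<gamma> = (1 + \<alpha>) / 2"
  define R where "R = real Q powr \<gamma>"
  define b where "b k = (real k + 1) powr (- 1 / m)" for k
  have Q1: "real Q \<ge> 400" using Q4 by simp
  have R: "0 < R" "R \<le> real Q"
  proof -
    show "0 < R" using Q1 by (simp add: R_def)
    have "real Q powr \<gamma> \<le> real Q powr 1" using Q1 \<alpha> by (intro powr_mono) (auto simp: \<gamma>_def)
    then show "R \<le> real Q" using Q1 by (simp add: R_def)
  qed
  have RL: "17 * L \<le> R"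
  proof -
    have "17 * L = sqrt ((17 * L)\<^sup>2)"
      by (rule real_sqrt_unique[symmetric, OF refl]) (use L in simp)
    also have "\<dots> \<le> sqrt (real Q)" using QL by (rule real_sqrt_le_mono)
    also have "\<dots> = real Q powr (1/2)" by (simp add: powr_half_sqrt)
    also have "\<dots> \<le> R" unfolding R_def using Q1 \<alpha> by (intro powr_mono) (auto simp: \<gamma>_def)
    finally show ?thesis .
  qed
  have b0: "0 < b k" and b1: "b k \<le> 1" and bS: "b (Suc k) \<le> b k" for k
  proof -
    show "0 < b k" by (simp add: b_def add_nonneg_pos)
    have "b k \<le> 1 powr (- 1 / m)" unfolding b_def using m by (intro powr_mono2') auto
    then show "b k \<le> 1" by simp
    show "b (Suc k) \<le> b k" unfolding b_def using m by (intro powr_mono2') auto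
  qed
  have bL: "b k \<le> L * b (Suc k)" for k
  proof -
    have "b k \<le> 2 powr \<bar>- 1 / m\<bar> * b (Suc k)" unfolding b_def by (rule powr_comparable) auto
    then show ?thesis using m by (simp add: L_def)
  qed
  have b17: "17 * b k \<le> R * b (Suc k)" for k
  proof -
    have "17 * b k \<le> 17 * (L * b (Suc k))" using bL by simp
    also have "\<dots> = (17 * L) * b (Suc k)" by simp
    also have "\<dots> \<le> R * b (Suc k)" using RL b0[of "Suc k"] by (intro mult_right_mono) auto
    finally show ?thesis .
  qed
  define a where "a k = (R / real Q) ^ k * b k" for k
  have RQ: "0 \<le> R / real Q" "R / real Q \<le> 1" using R Q1 by auto
  have a: "0 \<le> a k" "a k \<le> 1" for k
    unfolding a_def using RQ b0[of k] b1[of k] by (auto intro!: mult_nonneg_nonneg mult_le_one power_le_one)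
  have Q2: "2 \<le> Q" using Q4 by simp
  obtain g where g: "g holomorphic_on ball 0 1"
    "\<And>z. z \<in> ball 0 1 \<Longrightarrow> (\<lambda>k. of_real (a k) * z ^ (Q ^ k)) sums g z"
    "\<And>z. z \<in> ball 0 1 \<Longrightarrow> (\<lambda>k. of_real (a k * real Q ^ k) * z ^ (Q ^ k - 1)) sums deriv g z"
    using gap_series_exists[of a Q, OF a Q2] by blast
  \<comment> \<open>For \<open>\<alpha> = 1\<close> the series may diverge; the value of \<open>S\<close> is then irrelevant.\<close>
  define S where "S = (\<Sum>k. a k)"
  define f where "f z = of_real (1 + S) + g z" for z
  have f: "f holomorphic_on ball 0 1" unfolding f_def by (intro holomorphic_intros g)
  have df: "deriv f z = deriv g z" if "z \<in> ball 0 1" for z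
  proof (rule DERIV_imp_deriv)
    show "(f has_field_derivative deriv g z) (at z)"
      unfolding f_def using holomorphic_derivI[OF g(1) open_ball that]
      by (auto intro!: derivative_eq_intros)
  qed
  have aQ: "a k * real Q ^ k = R ^ k * b k" for k using Q1 by (simp add: a_def power_divide)
  interpret lacunary Q R b f
  proof
    show "(\<lambda>k. of_real (R ^ k * b k) * z ^ (Q ^ k - 1)) sums deriv f z" if "z \<in> ball 0 1" for z
      using g(3)[OF that] df[OF that] by (simp only: aQ)
  qed (use Q4 R b0 bS b17 f in auto)
  have x: "besov_term \<alpha> p k = (real Q ^ k) powr ((1 - \<alpha>) * (1 - p / 2)) * (real k + 1) powr (- p / m)" for p k
  proof -
    have "R ^ k = (real Q ^ k) powr \<gamma>"
      using Q1 by (simp add: R_def powr_powr mult.commute flip: powr_realpow)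
    then have "besov_term \<alpha> p k = ((real Q ^ k) powr (\<gamma> * p) * (real Q ^ k) powr (1 - \<alpha> - p)) * (real k + 1) powr (- p / m)"
      using Q1 by (simp add: besov_term_def c_def b_def powr_mult powr_powr)
    also have "(real Q ^ k) powr (\<gamma> * p) * (real Q ^ k) powr (1 - \<alpha> - p) = (real Q ^ k) powr ((1 - \<alpha>) * (1 - p / 2))"
      unfolding powr_add[symmetric] by (simp add: \<gamma>_def field_simps)
    finally show ?thesis .
  qed
  have Qk: "1 \<le> real Q ^ k" for k using Q1 by (intro one_le_power) auto
  have "f \<in> B_space \<alpha> M"
  proof (rule mem_B_space_if_summable)
    show "summable (besov_term \<alpha> M)"
    proof (rule summable_comparison_test')
      have "summable (\<lambda>n. real n powr (- M / m))" using m by (simp add: summable_real_powr_iff field_simps)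
      then show "summable (\<lambda>n. real (Suc n) powr (- M / m))"
        by (rule iffD2[OF summable_Suc_iff[of "\<lambda>n. real n powr (- M / m)"]])
      fix k
      have "(real Q ^ k) powr ((1 - \<alpha>) * (1 - M / 2)) \<le> (real Q ^ k) powr 0"
        using Qk[of k] \<alpha> m by (intro powr_mono) (auto simp: mult_nonneg_nonpos)
      also have "\<dots> \<le> 1" by simp
      finally have "besov_term \<alpha> M k \<le> 1 * (real k + 1) powr (- M / m)" unfolding x by (intro mult_right_mono) auto
      then show "norm (besov_term \<alpha> M k) \<le> real (Suc k) powr (- M / m)" unfolding x by (simp add: add.commute)
    qed
  qed (use m in auto)
  moreover have "f \<notin> B_space \<alpha> m"
  proof
    assume "f \<in> B_space \<alpha> m"
    then have sx: "summable (besov_term \<alpha> m)" by (rule summable_if_mem_B_space[rotated 2]) (use m in auto)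
    have "summable (\<lambda>n. real (Suc n) powr (- 1))"
    proof (rule summable_comparison_test'[OF sx])
      fix k
      have "1 \<le> (real Q ^ k) powr ((1 - \<alpha>) * (1 - m / 2))"
        using Qk[of k] \<alpha> m by (intro ge_one_powr_ge_zero) auto
      then have "1 * (real k + 1) powr (- 1) \<le> besov_term \<alpha> m k" unfolding x using m by (intro mult_mono) auto
      then show "norm (real (Suc k) powr (- 1)) \<le> besov_term \<alpha> m k" by (simp add: add.commute)
    qed
    then have "summable (\<lambda>n. real n powr (- 1))"
      by (rule iffD1[OF summable_Suc_iff[of "\<lambda>n. real n powr (- 1)"]])
    then show False using summable_real_powr_iff[of "- 1"] by (simp only:)
  qed
  moreover have "1 \<le> cmod (f z)" if "\<alpha> < 1" and z: "z \<in> ball 0 1" for z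
  proof -
    have "\<gamma> < 1" using that by (simp add: \<gamma>_def)
    then have "real Q powr \<gamma> < real Q powr 1" using Q1 by (intro powr_less_mono) auto
    then have lt: "R / real Q < 1" using Q1 by (simp add: R_def)
    have "summable a"
    proof (rule summable_comparison_test')
      show "summable (\<lambda>k. (R / real Q) ^ k)" using lt RQ by (intro summable_geometric) auto
      fix k
      show "norm (a k) \<le> (R / real Q) ^ k"
        using a[of k] RQ b1[of k] b0[of k] by (simp add: a_def mult_left_le)
    qed
    then have as: "a sums S" by (simp add: S_def summable_sums)
    have gS: "cmod (g z) \<le> S"
    proof (rule norm_sums_le[OF g(2)[OF z] as])
      fix k
      have "cmod z ^ (Q ^ k) \<le> 1" using z by (intro power_le_one) auto
      then show "cmod (of_real (a k) * z ^ (Q ^ k)) \<le> a k" using a[of k] by (simp add: norm_mult norm_power mult_left_le)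
    qed
    have "of_real (1 + S) = f z - g z" by (simp add: f_def)
    then have "cmod (of_real (1 + S)) \<le> cmod (f z) + cmod (g z)"
      by (simp only: norm_triangle_ineq4)
    moreover have "1 + S \<le> cmod (of_real (1 + S))" by (simp only: norm_of_real abs_ge_self)
    ultimately show ?thesis using gS by linarith
  qed
  ultimately show ?thesis by blast
qed

theorem theorem1p6:
  fixes \<alpha> p :: real
  assumes "0 < \<alpha>" and "\<alpha> \<le> 1" and "0 < p" and "\<alpha> + p > 1"
  shows "(p \<le> 2 \<longrightarrow> B_space \<alpha> p \<subseteq> A_space \<alpha> p) \<and>
         (2 \<le> p \<longrightarrow> A_space \<alpha> p \<subseteq> B_space \<alpha> p) \<and>
         (p \<noteq> 2 \<longrightarrow> A_space \<alpha> p \<noteq> B_space \<alpha> p)"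
proof (intro conjI impI)
  show "B_space \<alpha> p \<subseteq> A_space \<alpha> p" if "p \<le> 2"
    using B_space_subset_A_space[of p \<alpha>] that assms by simp
  show "A_space \<alpha> p \<subseteq> B_space \<alpha> p" if "2 \<le> p"
    using A_space_subset_B_space[of p \<alpha>] that assms by simp
  have AB2: "A_space \<alpha> 2 = B_space \<alpha> 2"
    using A_space_subset_B_space[of 2 \<alpha>] B_space_subset_A_space[of 2 \<alpha>] assms by auto
  have mono: "f \<in> A_space \<alpha> r"
    if "f \<in> A_space \<alpha> s" "0 < r" "r \<le> s" "\<alpha> < 1 \<Longrightarrow> \<forall>z \<in> ball 0 1. 1 \<le> cmod (f z)" for f r s
  proof (cases "\<alpha> < 1")
    case True
    then show ?thesis using that by (intro A_space_mono_bounded_below[of r s f \<alpha>]) auto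
  next
    case False
    then have "\<alpha> = 1" using assms by simp
    then show ?thesis using that A_space_1_mono[of r s f] by simp
  qed
  assume "p \<noteq> 2"
  then consider "p < 2" | "p > 2" by linarith
  then show "A_space \<alpha> p \<noteq> B_space \<alpha> p"
  proof cases
    case 1
    obtain f where f: "f \<in> B_space \<alpha> 2" "f \<notin> B_space \<alpha> p"
      and ge: "\<alpha> < 1 \<Longrightarrow> \<forall>z \<in> ball 0 1. 1 \<le> cmod (f z)"
      using besov_separation[of \<alpha> p 2] 1 assms by auto
    have "f \<in> A_space \<alpha> p" by (rule mono[of f 2 p]) (use f ge AB2 1 assms in auto)
    then show ?thesis using f by auto
  next
    case 2
    obtain f where f: "f \<in> B_space \<alpha> p" "f \<notin> B_space \<alpha> 2"
      and ge: "\<alpha> < 1 \<Longrightarrow> \<forall>z \<in> ball 0 1. 1 \<le> cmod (f z)"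
      using besov_separation[of \<alpha> 2 p] 2 assms by auto
    have "f \<notin> A_space \<alpha> p"
    proof
      assume "f \<in> A_space \<alpha> p"
      then have "f \<in> A_space \<alpha> 2" by (rule mono) (use ge 2 in auto)
      then show False using f AB2 by simp
    qed
    then show ?thesis using f by auto
  qed
qed

end
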